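(* The two-stage robust representative selection problem with continuous budgeted uncertainty, (2RS-C), can be solved in $O(n\log n)$ time, where $n$ is the number of items.
   Context: Problem (2RS-C). Input: a number $n$ of items, a partition $[n]=T_1\cup\dots\cup T_m$ of $[n]=\{1,\dots,n\}$ into nonempty disjoint sets, first-stage costs $C\in\mathbb{R}_{\ge 0}^n$, vectors $\underline c,d\in\mathbb{R}_{\ge 0}^n$, and a budget $\Gamma\in\mathbb{R}_{\ge 0}$. The continuous budgeted uncertainty set is $$U^C=\Big\{c\in\mathbb{R}_{\ge 0}^n:\ \exists\,\delta\in[0,1]^n \text{ with } c_i=\underline c_i+d_i\delta_i\ \forall i\in[n],\ \sum_{i=1}^n\delta_i\le\Gamma\Big\}.$$ Let $X'=\{x\in\{0,1\}^n:\ \sum_{i\in T_j}x_i\le 1\ \forall j\in[m]\}$ and, for $x\in X'$, $Y(x)=\{y\in\{0,1\}^n:\ \sum_{i\in T_j}(x_i+y_i)=1\ \forall j\in[m],\ x_i+y_i\le 1\ \forall i\in[n]\}$. The task is to solve $$\min_{x\in X'}\Big(\sum_{i=1}^n C_ix_i+\max_{c\in U^C}\min_{y\in Y(x)}\sum_{i=1}^n c_iy_i\Big),$$ i.e. to compute the optimal value and an optimal first-stage solution $x$. Running time is counted in elementary steps, where an arithmetic operation or a comparison of two numbers takes constant time. *)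

theory Defs
  imports "HOL-Analysis.Analysis" "HOL-Library.Landau_Symbols" "HOL-Library.Disjoint_Sets"
begin

section \<open>Two-stage robust representative selection\<close>

text \<open>
  Vectors indexed by \<open>[n] = {1..n}\<close> are functions on the naturals; feasible sets contain only
  extensional ones (\<open>undefined\<close> outside \<open>{1..n}\<close>), so each vector is represented exactly once.
\<close>

record rep_input =
  num_items :: nat
  num_parts :: nat
  part_items :: "nat \<Rightarrow> nat set"
  first_cost :: "nat \<Rightarrow> real"
  base_cost :: "nat \<Rightarrow> real"
  deviation :: "nat \<Rightarrow> real"
  budget :: real

definition valid_input :: "rep_input \<Rightarrow> bool" where
  "valid_input I \<longleftrightarrow>
     (\<Union>j\<in>{1..num_parts I}. part_items I j) = {1..num_items I} \<and>
     disjoint_family_on (part_items I) {1..num_parts I} \<and>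
     (\<forall>j\<in>{1..num_parts I}. part_items I j \<noteq> {}) \<and>
     (\<forall>i\<in>{1..num_items I}. 0 \<le> first_cost I i \<and> 0 \<le> base_cost I i \<and> 0 \<le> deviation I i) \<and>
     0 \<le> budget I"

definition uncertainty_set :: "rep_input \<Rightarrow> (nat \<Rightarrow> real) set" where
  "uncertainty_set I =
     {c \<in> {1..num_items I} \<rightarrow>\<^sub>E {0..}.
        \<exists>\<delta> \<in> {1..num_items I} \<rightarrow>\<^sub>E {0..1}.
          (\<forall>i\<in>{1..num_items I}. c i = base_cost I i + deviation I i * \<delta> i) \<and>
          (\<Sum>i=1..num_items I. \<delta> i) \<le> budget I}"

definition first_stage :: "rep_input \<Rightarrow> (nat \<Rightarrow> nat) set" where
  "first_stage I =
     {x \<in> {1..num_items I} \<rightarrow>\<^sub>E {0, 1}. \<forall>j\<in>{1..num_parts I}. (\<Sum>i\<in>part_items I j. x i) \<le> 1}"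

definition second_stage :: "rep_input \<Rightarrow> (nat \<Rightarrow> nat) \<Rightarrow> (nat \<Rightarrow> nat) set" where
  "second_stage I x =
     {y \<in> {1..num_items I} \<rightarrow>\<^sub>E {0, 1}.
        (\<forall>j\<in>{1..num_parts I}. (\<Sum>i\<in>part_items I j. x i + y i) = 1) \<and>
        (\<forall>i\<in>{1..num_items I}. x i + y i \<le> 1)}"

definition recourse_cost :: "rep_input \<Rightarrow> (nat \<Rightarrow> nat) \<Rightarrow> (nat \<Rightarrow> real) \<Rightarrow> real" where
  "recourse_cost I x c =
     (MIN y\<in>second_stage I x. \<Sum>i=1..num_items I. c i * real (y i))"

text \<open>
  The maximum over the infinite uncertainty set is written as a supremum; lemma
  \<open>worst_case_attained\<close> below shows that it is a maximum.
\<close>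

definition robust_cost :: "rep_input \<Rightarrow> (nat \<Rightarrow> nat) \<Rightarrow> real" where
  "robust_cost I x =
     (\<Sum>i=1..num_items I. first_cost I i * real (x i)) +
     (SUP c\<in>uncertainty_set I. recourse_cost I x c)"

definition optimal_value :: "rep_input \<Rightarrow> real" where
  "optimal_value I = (MIN x\<in>first_stage I. robust_cost I x)"


subsection \<open>All minima and maxima above are over nonempty sets and attained\<close>

lemma finite_first_stage: "finite (first_stage I)"
  unfolding first_stage_def
  by (rule finite_subset[OF _ finite_PiE[of "{1..num_items I}" "\<lambda>_. {0, 1}"]]) auto

lemma finite_second_stage: "finite (second_stage I x)"
  unfolding second_stage_def
  by (rule finite_subset[OF _ finite_PiE[of "{1..num_items I}" "\<lambda>_. {0, 1}"]]) auto

lemma part_subset: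
  assumes "valid_input I" "j \<in> {1..num_parts I}"
  shows "part_items I j \<subseteq> {1..num_items I}"
  using assms unfolding valid_input_def by blast

lemma first_stage_nonempty:
  assumes "valid_input I"
  shows "first_stage I \<noteq> {}"
proof -
  have "restrict (\<lambda>_. 0) {1..num_items I} \<in> first_stage I"
    unfolding first_stage_def
    using part_subset[OF assms] by (auto intro!: sum.neutral simp: subset_iff)
  then show ?thesis by blast
qed

lemma second_stage_nonempty:
  assumes I: "valid_input I" and x: "x \<in> first_stage I"
  shows "second_stage I x \<noteq> {}"
proof -
  define n m where "n = num_items I" and "m = num_parts I"
  have "\<forall>j\<in>{1..m}. \<exists>i. i \<in> part_items I j"
    using I by (auto simp: valid_input_def m_def)
  then obtain r where r: "\<And>j. j \<in> {1..m} \<Longrightarrow> r j \<in> part_items I j"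
    by metis
  define y where "y = restrict (\<lambda>i. if \<exists>j\<in>{1..m}. i = r j \<and> (\<Sum>k\<in>part_items I j. x k) = 0
                                   then 1 else (0::nat)) {1..n}"
  have sub: "part_items I j \<subseteq> {1..n}" if "j \<in> {1..m}" for j
    using part_subset[OF I] that by (simp add: n_def m_def)
  have disj: "j = k" if "j \<in> {1..m}" "k \<in> {1..m}" "i \<in> part_items I j" "i \<in> part_items I k" for i j k
    using I that unfolding valid_input_def disjoint_family_on_def m_def by (metis IntI empty_iff)
  have yval: "y i = (if i = r j \<and> (\<Sum>k\<in>part_items I j. x k) = 0 then 1 else 0)"
    if "j \<in> {1..m}" "i \<in> part_items I j" for i j
  proof -
    have "i \<in> {1..n}" using sub that by blast
    moreover have "(\<exists>k\<in>{1..m}. i = r k \<and> (\<Sum>k\<in>part_items I k. x k) = 0) \<longleftrightarrow>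
                   i = r j \<and> (\<Sum>k\<in>part_items I j. x k) = 0"
    proof
      assume "\<exists>k\<in>{1..m}. i = r k \<and> (\<Sum>k\<in>part_items I k. x k) = 0"
      then obtain k where k: "k \<in> {1..m}" "i = r k" "(\<Sum>k\<in>part_items I k. x k) = 0" by blast
      then have "k = j" using disj[OF k(1) that(1)] r[OF k(1)] that(2) by simp
      with k show "i = r j \<and> (\<Sum>k\<in>part_items I j. x k) = 0" by simp
    next
      assume "i = r j \<and> (\<Sum>k\<in>part_items I j. x k) = 0"
      with that(1) show "\<exists>k\<in>{1..m}. i = r k \<and> (\<Sum>k\<in>part_items I k. x k) = 0" by blast
    qed
    ultimately show ?thesis unfolding y_def by simp
  qed
  have fin: "finite (part_items I j)" if "j \<in> {1..m}" for j
    using sub[OF that] finite_subset by blast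
  have xle: "(\<Sum>k\<in>part_items I j. x k) \<le> 1" if "j \<in> {1..m}" for j
    using x that by (auto simp: first_stage_def m_def)
  have ysum: "(\<Sum>i\<in>part_items I j. y i) = (if (\<Sum>k\<in>part_items I j. x k) = 0 then 1 else 0)"
    if j: "j \<in> {1..m}" for j
  proof -
    have "(\<Sum>i\<in>part_items I j. y i) =
          (\<Sum>i\<in>part_items I j. if r j = i then (if (\<Sum>k\<in>part_items I j. x k) = 0 then 1 else 0) else 0)"
      by (rule sum.cong) (auto simp: yval[OF j])
    also have "\<dots> = (if (\<Sum>k\<in>part_items I j. x k) = 0 then 1 else 0)"
      using fin[OF j] r[OF j] by (subst sum.delta') simp_all
    finally show ?thesis .
  qed
  have tot: "(\<Sum>i\<in>part_items I j. x i + y i) = 1" if j: "j \<in> {1..m}" for j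
    using xle[OF j] ysum[OF j] by (auto simp: sum.distrib)
  have "x i + y i \<le> 1" if i: "i \<in> {1..n}" for i
  proof -
    obtain j where j: "j \<in> {1..m}" "i \<in> part_items I j"
      using I i unfolding valid_input_def n_def m_def by blast
    have "x i + y i \<le> (\<Sum>i\<in>part_items I j. x i + y i)"
      using fin[OF j(1)] j(2) by (intro member_le_sum) auto
    then show ?thesis using tot[OF j(1)] by simp
  qed
  moreover have "y \<in> {1..n} \<rightarrow>\<^sub>E {0, 1}"
    by (auto simp: y_def)
  ultimately have "y \<in> second_stage I x"
    using tot by (auto simp: second_stage_def n_def m_def)
  then show ?thesis by blast
qed

lemma compact_restricted_cube:
  "compact ({1..n::nat} \<rightarrow>\<^sub>E {0..1::real})"
proof -
  have eq: "({1..n} \<rightarrow>\<^sub>E {0..1::real}) =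
            PiE UNIV (\<lambda>i. if i \<in> {1..n} then {0..1} else {undefined})"
    by (auto simp: PiE_iff extensional_def split: if_splits)
  have "compactin (product_topology (\<lambda>i. euclidean) UNIV)
          (PiE UNIV (\<lambda>i. if i \<in> {1..n} then {0..1::real} else {undefined}))"
    by (subst compactin_PiE) auto
  then show ?thesis
    unfolding eq by (simp add: euclidean_product_topology)
qed

lemma continuous_on_Min_image:
  fixes f :: "'b \<Rightarrow> 'a::topological_space \<Rightarrow> real"
  assumes "finite Y" "Y \<noteq> {}" "\<And>y. y \<in> Y \<Longrightarrow> continuous_on S (f y)"
  shows "continuous_on S (\<lambda>s. MIN y\<in>Y. f y s)"
  using assms
proof (induction Y rule: finite_ne_induct)
  case (insert y Y)
  then have "continuous_on S (\<lambda>s. min (f y s) (MIN y\<in>Y. f y s))"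
    by (intro continuous_on_min) auto
  with insert show ?case by simp
qed simp

lemma worst_case_attained:
  assumes I: "valid_input I" and x: "x \<in> first_stage I"
  shows "\<exists>c\<in>uncertainty_set I.
           (\<forall>c'\<in>uncertainty_set I. recourse_cost I x c' \<le> recourse_cost I x c) \<and>
           (SUP c\<in>uncertainty_set I. recourse_cost I x c) = recourse_cost I x c"
proof -
  define n where "n = num_items I"
  define D where "D = ({1..n} \<rightarrow>\<^sub>E {0..1::real}) \<inter> {\<delta>. (\<Sum>i=1..n. \<delta> i) \<le> budget I}"
  define F where "F = (\<lambda>\<delta>. restrict (\<lambda>i. base_cost I i + deviation I i * \<delta> i) {1..n})"
  have img: "uncertainty_set I = F ` D"
  proof (intro set_eqI iffI)
    fix c assume "c \<in> uncertainty_set I"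
    then obtain \<delta> where "\<delta> \<in> D" "\<forall>i\<in>{1..n}. c i = base_cost I i + deviation I i * \<delta> i"
      and "c \<in> extensional {1..n}"
      by (auto simp: uncertainty_set_def D_def n_def PiE_iff)
    then have "c = F \<delta>" by (auto simp: F_def extensional_def)
    with \<open>\<delta> \<in> D\<close> show "c \<in> F ` D" by blast
  next
    fix c assume "c \<in> F ` D"
    then obtain \<delta> where \<delta>: "\<delta> \<in> D" and c: "c = F \<delta>" by blast
    have \<delta>': "\<delta> \<in> {1..n} \<rightarrow>\<^sub>E {0..1}" "(\<Sum>i=1..n. \<delta> i) \<le> budget I"
      using \<delta> by (auto simp: D_def)
    have eq: "\<forall>i\<in>{1..n}. c i = base_cost I i + deviation I i * \<delta> i"
      by (simp add: c F_def)
    have "0 \<le> base_cost I i + deviation I i * \<delta> i" if "i \<in> {1..n}" for i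
    proof -
      have "0 \<le> \<delta> i" using \<delta>'(1) that by (auto simp: PiE_iff)
      then show ?thesis using I that by (simp add: valid_input_def n_def)
    qed
    then have "c \<in> {1..n} \<rightarrow>\<^sub>E {0..}"
      by (simp add: c F_def PiE_iff)
    with \<delta>' eq show "c \<in> uncertainty_set I"
      unfolding uncertainty_set_def n_def by blast
  qed
  have "closed {\<delta>::nat \<Rightarrow> real. (\<Sum>i=1..n. \<delta> i) \<le> budget I}"
    by (intro closed_Collect_le continuous_on_sum continuous_on_product_coordinates
        continuous_on_const)
  then have cD: "compact D"
    unfolding D_def using compact_restricted_cube by (intro compact_Int_closed)
  have "restrict (\<lambda>_. 0) {1..n} \<in> D"
    using I by (auto simp: D_def valid_input_def)
  then have neD: "D \<noteq> {}" by blast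
  have "recourse_cost I x (F \<delta>) =
        (MIN y\<in>second_stage I x. \<Sum>i=1..n. (base_cost I i + deviation I i * \<delta> i) * real (y i))" for \<delta>
    by (simp add: recourse_cost_def F_def n_def)
  moreover have "continuous_on D (\<lambda>\<delta>. MIN y\<in>second_stage I x.
        \<Sum>i=1..n. (base_cost I i + deviation I i * \<delta> i) * real (y i))"
    by (intro continuous_on_Min_image finite_second_stage second_stage_nonempty[OF I x]
        continuous_intros continuous_on_subset[OF continuous_on_product_coordinates]) auto
  ultimately have "continuous_on D (\<lambda>\<delta>. recourse_cost I x (F \<delta>))"
    by simp
  from continuous_attains_sup[OF cD neD this]
  obtain \<delta> where \<delta>: "\<delta> \<in> D" "\<And>\<delta>'. \<delta>' \<in> D \<Longrightarrow> recourse_cost I x (F \<delta>') \<le> recourse_cost I x (F \<delta>)"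
    by blast
  have "(SUP c\<in>uncertainty_set I. recourse_cost I x c) = recourse_cost I x (F \<delta>)"
    by (rule cSup_eq_maximum) (use \<delta> img in auto)
  moreover have "F \<delta> \<in> uncertainty_set I" using \<delta>(1) by (simp add: img)
  moreover have "\<forall>c'\<in>uncertainty_set I. recourse_cost I x c' \<le> recourse_cost I x (F \<delta>)"
    using \<delta>(2) by (simp add: img)
  ultimately show ?thesis by (intro bexI[of _ "F \<delta>"] conjI)
qed


section \<open>A real random-access machine\<close>

text \<open>
  Programs are written in a structured imperative language for the real RAM.  A state consists of
  scalars and arrays holding natural numbers (indices) and scalars and arrays holding reals.  A
  program is a finite syntactic object; it mentions finitely many names, and arrays are accessed by
  computed indices.  Indices admit addition, truncated subtraction and comparison; reals admit the
  field operations and comparison.  There is no conversion between reals and indices; in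
  particular there is no unit-cost rounding.  The only constants are natural numbers and integers.
  Division by zero yields zero, as usual in HOL.
\<close>

type_synonym vname = string

record state =
  nvar :: "vname \<Rightarrow> nat"
  narr :: "vname \<Rightarrow> nat \<Rightarrow> nat"
  rvar :: "vname \<Rightarrow> real"
  rarr :: "vname \<Rightarrow> nat \<Rightarrow> real"

datatype nexp =
    NConst nat
  | NVar vname
  | NArr vname nexp
  | NAdd nexp nexp
  | NSub nexp nexp

datatype rexp =
    RConst int
  | RVar vname
  | RArr vname nexp
  | RAdd rexp rexp
  | RSub rexp rexp
  | RMul rexp rexp
  | RDiv rexp rexp

datatype bexp =
    NLess nexp nexp
  | NEq nexp nexp
  | RLess rexp rexp
  | REq rexp rexp
  | BNot bexp
  | BAnd bexp bexp

datatype com =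
    Skip
  | NAssign vname nexp
  | NStore vname nexp nexp
  | RAssign vname rexp
  | RStore vname nexp rexp
  | Seq com com
  | Cond bexp com com
  | While bexp com

primrec nval :: "nexp \<Rightarrow> state \<Rightarrow> nat" where
  "nval (NConst k) s = k"
| "nval (NVar v) s = nvar s v"
| "nval (NArr a e) s = narr s a (nval e s)"
| "nval (NAdd e1 e2) s = nval e1 s + nval e2 s"
| "nval (NSub e1 e2) s = nval e1 s - nval e2 s"

primrec rval :: "rexp \<Rightarrow> state \<Rightarrow> real" where
  "rval (RConst k) s = real_of_int k"
| "rval (RVar v) s = rvar s v"
| "rval (RArr a e) s = rarr s a (nval e s)"
| "rval (RAdd e1 e2) s = rval e1 s + rval e2 s"
| "rval (RSub e1 e2) s = rval e1 s - rval e2 s"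
| "rval (RMul e1 e2) s = rval e1 s * rval e2 s"
| "rval (RDiv e1 e2) s = rval e1 s / rval e2 s"

primrec bval :: "bexp \<Rightarrow> state \<Rightarrow> bool" where
  "bval (NLess e1 e2) s \<longleftrightarrow> nval e1 s < nval e2 s"
| "bval (NEq e1 e2) s \<longleftrightarrow> nval e1 s = nval e2 s"
| "bval (RLess e1 e2) s \<longleftrightarrow> rval e1 s < rval e2 s"
| "bval (REq e1 e2) s \<longleftrightarrow> rval e1 s = rval e2 s"
| "bval (BNot b) s \<longleftrightarrow> \<not> bval b s"
| "bval (BAnd b1 b2) s \<longleftrightarrow> bval b1 s \<and> bval b2 s"

text \<open>
  Every constant, memory access, arithmetic operation, comparison and Boolean connective costs one
  step, so an expression costs its number of nodes.
\<close>

primrec ncost :: "nexp \<Rightarrow> nat" where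
  "ncost (NConst k) = 1"
| "ncost (NVar v) = 1"
| "ncost (NArr a e) = 1 + ncost e"
| "ncost (NAdd e1 e2) = 1 + ncost e1 + ncost e2"
| "ncost (NSub e1 e2) = 1 + ncost e1 + ncost e2"

primrec rcost :: "rexp \<Rightarrow> nat" where
  "rcost (RConst k) = 1"
| "rcost (RVar v) = 1"
| "rcost (RArr a e) = 1 + ncost e"
| "rcost (RAdd e1 e2) = 1 + rcost e1 + rcost e2"
| "rcost (RSub e1 e2) = 1 + rcost e1 + rcost e2"
| "rcost (RMul e1 e2) = 1 + rcost e1 + rcost e2"
| "rcost (RDiv e1 e2) = 1 + rcost e1 + rcost e2"

primrec bcost :: "bexp \<Rightarrow> nat" where
  "bcost (NLess e1 e2) = 1 + ncost e1 + ncost e2"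
| "bcost (NEq e1 e2) = 1 + ncost e1 + ncost e2"
| "bcost (RLess e1 e2) = 1 + rcost e1 + rcost e2"
| "bcost (REq e1 e2) = 1 + rcost e1 + rcost e2"
| "bcost (BNot b) = 1 + bcost b"
| "bcost (BAnd b1 b2) = 1 + bcost b1 + bcost b2"

text \<open>
  \<open>exec P s t s'\<close>: started in \<open>s\<close>, the program \<open>P\<close> halts after exactly \<open>t\<close> steps in \<open>s'\<close>.
\<close>

inductive exec :: "com \<Rightarrow> state \<Rightarrow> nat \<Rightarrow> state \<Rightarrow> bool" where
  exec_Skip: "exec Skip s 1 s"
| exec_NAssign:
    "exec (NAssign v e) s (1 + ncost e) (s\<lparr>nvar := (nvar s)(v := nval e s)\<rparr>)"
| exec_NStore:
    "exec (NStore a i e) s (1 + ncost i + ncost e)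
       (s\<lparr>narr := (narr s)(a := (narr s a)(nval i s := nval e s))\<rparr>)"
| exec_RAssign:
    "exec (RAssign v e) s (1 + rcost e) (s\<lparr>rvar := (rvar s)(v := rval e s)\<rparr>)"
| exec_RStore:
    "exec (RStore a i e) s (1 + ncost i + rcost e)
       (s\<lparr>rarr := (rarr s)(a := (rarr s a)(nval i s := rval e s))\<rparr>)"
| exec_Seq:
    "exec P s t s' \<Longrightarrow> exec Q s' u s'' \<Longrightarrow> exec (Seq P Q) s (t + u) s''"
| exec_CondTrue:
    "bval b s \<Longrightarrow> exec P s t s' \<Longrightarrow> exec (Cond b P Q) s (1 + bcost b + t) s'"
| exec_CondFalse:
    "\<not> bval b s \<Longrightarrow> exec Q s t s' \<Longrightarrow> exec (Cond b P Q) s (1 + bcost b + t) s'"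
| exec_WhileFalse:
    "\<not> bval b s \<Longrightarrow> exec (While b P) s (1 + bcost b) s"
| exec_WhileTrue:
    "bval b s \<Longrightarrow> exec P s t s' \<Longrightarrow> exec (While b P) s' u s'' \<Longrightarrow>
     exec (While b P) s (1 + bcost b + t + u) s''"

inductive_cases exec_SkipE: "exec Skip s t s'"
inductive_cases exec_NAssignE: "exec (NAssign v e) s t s'"
inductive_cases exec_NStoreE: "exec (NStore a i e) s t s'"
inductive_cases exec_RAssignE: "exec (RAssign v e) s t s'"
inductive_cases exec_RStoreE: "exec (RStore a i e) s t s'"
inductive_cases exec_SeqE: "exec (Seq P Q) s t s'"
inductive_cases exec_CondE: "exec (Cond b P Q) s t s'"
inductive_cases exec_WhileE: "exec (While b P) s t s'"

lemma exec_deterministic: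
  "exec P s t s' \<Longrightarrow> exec P s u s'' \<Longrightarrow> t = u \<and> s' = s''"
proof (induction arbitrary: u s'' rule: exec.induct)
  case (exec_Seq P s t s' Q u' s2)
  from exec_Seq.prems obtain t1 s1 u1 where "u = t1 + u1" "exec P s t1 s1" "exec Q s1 u1 s''"
    by (rule exec_SeqE)
  with exec_Seq.IH show ?case by metis
next
  case (exec_CondTrue b s P t s' Q)
  from exec_CondTrue.prems exec_CondTrue.hyps obtain t1
    where "u = 1 + bcost b + t1" "exec P s t1 s''"
    by (auto elim: exec_CondE)
  with exec_CondTrue.IH show ?case by metis
next
  case (exec_CondFalse b s Q t s' P)
  from exec_CondFalse.prems exec_CondFalse.hyps obtain t1
    where "u = 1 + bcost b + t1" "exec Q s t1 s''"
    by (auto elim: exec_CondE)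
  with exec_CondFalse.IH show ?case by metis
next
  case (exec_WhileFalse b s P)
  from exec_WhileFalse.prems show ?case
    by (rule exec_WhileE) (use exec_WhileFalse.hyps in simp_all)
next
  case (exec_WhileTrue b s P t s' u' s2)
  from exec_WhileTrue.prems obtain t1 s1 u1
    where "u = 1 + bcost b + t1 + u1" "exec P s t1 s1" "exec (While b P) s1 u1 s''"
    by (rule exec_WhileE) (use exec_WhileTrue.hyps in simp_all)
  with exec_WhileTrue.IH show ?case by metis
qed (auto elim: exec_SkipE exec_NAssignE exec_NStoreE exec_RAssignE exec_RStoreE)


section \<open>Input and output of a program\<close>

text \<open>
  The vectors of the input are stored in arrays at positions \<open>1, \<dots>, n\<close>; the partition is stored as
  the array \<open>T\<close> whose entry at \<open>i\<close> is the index \<open>j\<close> of the part containing item \<open>i\<close>.  All other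
  memory cells are zero.
\<close>

definition part_index :: "rep_input \<Rightarrow> nat \<Rightarrow> nat" where
  "part_index I i = (THE j. j \<in> {1..num_parts I} \<and> i \<in> part_items I j)"

definition load :: "nat \<Rightarrow> (nat \<Rightarrow> 'a) \<Rightarrow> nat \<Rightarrow> 'a::zero" where
  "load n f = (\<lambda>i. if i \<in> {1..n} then f i else 0)"

definition input_state :: "rep_input \<Rightarrow> state" where
  "input_state I =
     \<lparr> nvar = (\<lambda>_. 0)(''n'' := num_items I, ''m'' := num_parts I),
       narr = (\<lambda>_ _. 0)(''T'' := load (num_items I) (part_index I)),
       rvar = (\<lambda>_. 0)(''Gamma'' := budget I),
       rarr = (\<lambda>_ _. 0)(''C'' := load (num_items I) (first_cost I),
                        ''c'' := load (num_items I) (base_cost I),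
                        ''d'' := load (num_items I) (deviation I)) \<rparr>"

text \<open>
  The optimal value is returned in the real scalar \<open>opt\<close> and an optimal first-stage solution in the
  entries \<open>1, \<dots>, n\<close> of the index array \<open>x\<close>.
\<close>

definition output_solution :: "rep_input \<Rightarrow> state \<Rightarrow> nat \<Rightarrow> nat" where
  "output_solution I s = restrict (narr s ''x'') {1..num_items I}"

definition correct_output :: "rep_input \<Rightarrow> state \<Rightarrow> bool" where
  "correct_output I s \<longleftrightarrow>
     rvar s ''opt'' = optimal_value I \<and>
     output_solution I s \<in> first_stage I \<and>
     robust_cost I (output_solution I s) = optimal_value I"

definition solves_in_time :: "com \<Rightarrow> (nat \<Rightarrow> nat) \<Rightarrow> bool" where
  "solves_in_time P \<tau> \<longleftrightarrow>
     (\<forall>I. valid_input I \<longrightarrow>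
        (\<exists>t s. exec P (input_state I) t s \<and> t \<le> \<tau> (num_items I) \<and> correct_output I s))"

end

(*
  Raising the cheapest cost of an uncovered part to a level t needs an amount of budget that is
  convex and piecewise linear in t, so the adversary solves a fractional knapsack problem over the
  linear pieces.  Dualizing its budget constraint with a multiplier pi and interchanging the two
  minima gives the value

    min over pi >= 0 of  budget * pi + (sum over parts j of min (B j) (h j pi)),

  where B j is the cheapest first-stage cost of part j and h j is convex, nonincreasing and piecewise
  linear.  As h j crosses B j at most once, min (B j) (h j pi) is a constant plus a sum of terms
  w * max 0 (q - pi) with at most two terms per item.  The minimum over pi is therefore attained at 0
  or at one of the 2n knots q: sorting the items by base cost and the knots by position leaves only
  linear scans, and part j is bought in the first stage if B j <= h j pi at the optimal pi.
*)
theory Submission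
  imports Defs "HOL-Library.Multiset" "HOL-Real_Asymp.Real_Asymp"
begin

section \<open>Weakest preconditions with running time\<close>

text \<open>For a fixed first-stage solution only the budget couples the parts, so one knapsack over
  the pieces of all open parts supplies a single multiplier. Its pieces may be filled in any order:
  charging each item with all pieces above its base cost turns arbitrary fractions into an
  admissible deviation. After dualization both remaining problems are minimizations, so they
  commute, and for fixed \<open>pi\<close> the choice of the bought parts separates. The point where
  \<open>h j\<close> meets \<open>B j\<close> is not searched for. Slopes increase along a part, so
  \<open>h j\<close> is the maximum of its starting level and of one affine function per prefix of
  pieces; the crossing is the largest of 0 and the points where these functions meet
  \<open>B j\<close>, a running maximum. Cutting at \<open>B j\<close> freezes \<open>h j\<close>
  below that point, which gives each piece a second hinge of opposite sign. The total need not be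
  convex, so the program evaluates every knot, each in constant time by suffix sums. Items with
  \<open>d i = 0\<close> fit in without case distinctions in the program: division by zero gives 0,
  and from such an item on all pieces of its part are empty.\<close>

definition wp :: "com \<Rightarrow> (nat \<Rightarrow> state \<Rightarrow> bool) \<Rightarrow> state \<Rightarrow> bool" where
  "wp P Q s \<longleftrightarrow> (\<exists>t s'. exec P s t s' \<and> Q t s')"

lemma wp_mono: "wp P Q s \<Longrightarrow> (\<And>t s'. Q t s' \<Longrightarrow> R t s') \<Longrightarrow> wp P R s"
  unfolding wp_def by blast

lemma wp_Skip [simp]: "wp Skip Q s \<longleftrightarrow> Q 1 s"
  unfolding wp_def by (metis exec_Skip exec_SkipE)

lemma wp_NAssign [simp]:
  "wp (NAssign v e) Q s \<longleftrightarrow> Q (1 + ncost e) (s\<lparr>nvar := (nvar s)(v := nval e s)\<rparr>)"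
  unfolding wp_def by (metis exec_NAssign exec_NAssignE)

lemma wp_NStore [simp]:
  "wp (NStore a i e) Q s \<longleftrightarrow>
     Q (1 + ncost i + ncost e) (s\<lparr>narr := (narr s)(a := (narr s a)(nval i s := nval e s))\<rparr>)"
  unfolding wp_def by (metis exec_NStore exec_NStoreE)

lemma wp_RAssign [simp]:
  "wp (RAssign v e) Q s \<longleftrightarrow> Q (1 + rcost e) (s\<lparr>rvar := (rvar s)(v := rval e s)\<rparr>)"
  unfolding wp_def by (metis exec_RAssign exec_RAssignE)

lemma wp_RStore [simp]:
  "wp (RStore a i e) Q s \<longleftrightarrow>
     Q (1 + ncost i + rcost e) (s\<lparr>rarr := (rarr s)(a := (rarr s a)(nval i s := rval e s))\<rparr>)"
  unfolding wp_def by (metis exec_RStore exec_RStoreE)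

lemma wp_Seq [simp]: "wp (Seq A B) Q s \<longleftrightarrow> wp A (\<lambda>t s'. wp B (\<lambda>u. Q (t + u)) s') s"
  unfolding wp_def by (blast intro: exec_Seq elim: exec_SeqE)

lemma wp_Cond [simp]:
  "wp (Cond b A B) Q s \<longleftrightarrow>
     (if bval b s then wp A (\<lambda>t. Q (1 + bcost b + t)) s else wp B (\<lambda>t. Q (1 + bcost b + t)) s)"
proof (cases "bval b s")
  case True
  have "(\<exists>t s'. exec (Cond b A B) s t s' \<and> Q t s') \<longleftrightarrow> (\<exists>t s'. exec A s t s' \<and> Q (1 + bcost b + t) s')"
  proof
    assume "\<exists>t s'. exec (Cond b A B) s t s' \<and> Q t s'"
    then obtain t s' where "exec (Cond b A B) s t s'" "Q t s'" by blast
    then show "\<exists>t s'. exec A s t s' \<and> Q (1 + bcost b + t) s'"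
      by (elim exec_CondE) (use True in auto)
  qed (use exec_CondTrue[OF True] in blast)
  with True show ?thesis unfolding wp_def by simp
next
  case False
  have "(\<exists>t s'. exec (Cond b A B) s t s' \<and> Q t s') \<longleftrightarrow> (\<exists>t s'. exec B s t s' \<and> Q (1 + bcost b + t) s')"
  proof
    assume "\<exists>t s'. exec (Cond b A B) s t s' \<and> Q t s'"
    then obtain t s' where "exec (Cond b A B) s t s'" "Q t s'" by blast
    then show "\<exists>t s'. exec B s t s' \<and> Q (1 + bcost b + t) s'"
      by (elim exec_CondE) (use False in auto)
  qed (use exec_CondFalse[OF False] in blast)
  with False show ?thesis unfolding wp_def by simp
qed

text \<open>The index of the invariant counts completed iterations. As it stays below
  \<open>L\<close> whenever the guard holds, \<open>L\<close> is at once the termination measure and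
  the bound on the number of charged iterations.\<close>

lemma wp_while:
  assumes step: "\<And>k s. I k s \<Longrightarrow> bval b s \<Longrightarrow> k < L \<and> wp body (\<lambda>t s'. t \<le> c \<and> I (Suc k) s') s"
    and "I k s" "k \<le> L"
  shows "wp (While b body)
    (\<lambda>t s'. t \<le> (L - k) * (c + 1 + bcost b) + 1 + bcost b \<and> \<not> bval b s' \<and> (\<exists>k\<le>L. I k s')) s"
  using assms(2,3)
proof (induction "L - k" arbitrary: k s)
  case 0
  then have "\<not> bval b s" using step by fastforce
  from exec_WhileFalse[OF this, of body] have "exec (While b body) s (1 + bcost b) s" .
  moreover have "1 + bcost b \<le> (L - k) * (c + 1 + bcost b) + 1 + bcost b" by simp
  ultimately show ?case using 0 \<open>\<not> bval b s\<close> unfolding wp_def by blast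
next
  case (Suc d)
  show ?case
  proof (cases "bval b s")
    case False
    from exec_WhileFalse[OF this, of body] have "exec (While b body) s (1 + bcost b) s" .
    moreover have "1 + bcost b \<le> (L - k) * (c + 1 + bcost b) + 1 + bcost b" by simp
    ultimately show ?thesis using Suc.prems False unfolding wp_def by blast
  next
    case True
    from step[OF Suc.prems(1) True] obtain t s' where
      t: "k < L" "exec body s t s'" "t \<le> c" "I (Suc k) s'" unfolding wp_def by blast
    obtain u s'' where u: "exec (While b body) s' u s''"
        "u \<le> (L - Suc k) * (c + 1 + bcost b) + 1 + bcost b" "\<not> bval b s''" "\<exists>k\<le>L. I k s''"
      using Suc.hyps(1)[OF _ t(4)] Suc.hyps(2) t(1) unfolding wp_def
      by (metis Suc_leI diff_Suc Suc_diff_Suc nat.inject)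
    have "L - k = Suc (L - Suc k)" using t(1) by simp
    then have "1 + bcost b + t + u \<le> (L - k) * (c + 1 + bcost b) + 1 + bcost b"
      using t(3) u(2) by (simp add: algebra_simps)
    with exec_WhileTrue[OF True t(2) u(1)] u(3,4) show ?thesis unfolding wp_def by blast
  qed
qed

section \<open>Frame property and counting loops\<close>

primrec writes :: "com \<Rightarrow> vname set" where
  "writes Skip = {}"
| "writes (NAssign v e) = {v}"
| "writes (NStore v i e) = {v}"
| "writes (RAssign v e) = {v}"
| "writes (RStore v i e) = {v}"
| "writes (Seq A B) = writes A \<union> writes B"
| "writes (Cond b A B) = writes A \<union> writes B"
| "writes (While b A) = writes A"

text \<open>One set of names stands for all four kinds of memory, so a write to an index variable
  also gives up the real array of that name. This coarse frame suffices when data that must survive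
  do not share a name with a written cell.\<close>

definition same_except :: "vname set \<Rightarrow> state \<Rightarrow> state \<Rightarrow> bool" where
  "same_except W s s' \<longleftrightarrow> (\<forall>v. v \<notin> W \<longrightarrow>
     nvar s' v = nvar s v \<and> narr s' v = narr s v \<and> rvar s' v = rvar s v \<and> rarr s' v = rarr s v)"

lemma same_exceptD:
  assumes "same_except W s s'" "v \<notin> W"
  shows "nvar s' v = nvar s v" "narr s' v = narr s v" "rvar s' v = rvar s v" "rarr s' v = rarr s v"
  using assms unfolding same_except_def by blast+

lemma same_except_trans:
  "same_except W s s' \<Longrightarrow> same_except W' s' s'' \<Longrightarrow> same_except (W \<union> W') s s''"
  unfolding same_except_def by auto

lemma exec_same_except: "exec P s t s' \<Longrightarrow> same_except (writes P) s s'"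
proof (induction rule: exec.induct)
  case exec_Seq
  then show ?case unfolding writes.simps by (blast intro: same_except_trans)
next
  case (exec_WhileTrue b s P t s' u s'')
  then show ?case using same_except_trans[of "writes P" s s' "writes P" s''] by simp
qed (auto simp: same_except_def)

lemma wp_frame:
  "wp P Q s \<Longrightarrow> wp P (\<lambda>t s'. Q t s' \<and> same_except (writes P) s s') s"
  unfolding wp_def using exec_same_except by blast

definition for_loop :: "vname \<Rightarrow> vname \<Rightarrow> com \<Rightarrow> com" where
  "for_loop v N body =
     Seq (NAssign v (NConst 0))
       (While (NLess (NVar v) (NVar N)) (Seq body (NAssign v (NAdd (NVar v) (NConst 1)))))"

lemma writes_for_loop [simp]: "writes (for_loop v N body) = insert v (writes body)"
  unfolding for_loop_def by auto

text \<open>The body may assume everything that \<open>same_except\<close> preserves from the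
  initial state, so \<open>I\<close> has to describe only data that the loop changes. The overhead
  of 8 per round is 4 for the guard and 4 for the increment; the 6 outside are the initial
  assignment and the last guard test.\<close>

lemma wp_for_loop:
  assumes fresh: "v \<notin> writes body" "N \<notin> writes body" "v \<noteq> N"
    and init: "I 0 (s\<lparr>nvar := (nvar s)(v := 0)\<rparr>)"
    and step: "\<And>k s'. k < nvar s N \<Longrightarrow> nvar s' v = k \<Longrightarrow>
       same_except (insert v (writes body)) s s' \<Longrightarrow> I k s' \<Longrightarrow>
       wp body (\<lambda>t s''. t \<le> c \<and> I (Suc k) (s''\<lparr>nvar := (nvar s'')(v := Suc k)\<rparr>)) s'"
  shows "wp (for_loop v N body) (\<lambda>t s'. t \<le> 6 + nvar s N * (c + 8) \<and> I (nvar s N) s' \<and>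
           same_except (insert v (writes body)) s s') s"
proof -
  let ?n = "nvar s N"
  let ?J = "\<lambda>k s'. k \<le> ?n \<and> nvar s' v = k \<and> same_except (insert v (writes body)) s s' \<and> I k s'"
  let ?b = "NLess (NVar v) (NVar N)"
  let ?body = "Seq body (NAssign v (NAdd (NVar v) (NConst 1)))"
  have N: "nvar s' N = ?n" if "same_except (insert v (writes body)) s s'" for s'
    using same_exceptD(1)[OF that, of N] fresh by simp
  have "wp (While ?b ?body) (\<lambda>t s'. t \<le> (?n - 0) * ((c + 4) + 1 + bcost ?b) + 1 + bcost ?b \<and>
      \<not> bval ?b s' \<and> (\<exists>k\<le>?n. ?J k s')) (s\<lparr>nvar := (nvar s)(v := 0)\<rparr>)"
  proof (rule wp_while)
    fix k s' assume J: "?J k s'" and b: "bval ?b s'"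
    have k: "k < ?n" using J b N by auto
    have "wp body (\<lambda>t s''. t \<le> c \<and> I (Suc k) (s''\<lparr>nvar := (nvar s'')(v := Suc k)\<rparr>)) s'"
      using step[OF k] J by blast
    from wp_frame[OF this]
    have "wp ?body (\<lambda>t s''. t \<le> c + 4 \<and> ?J (Suc k) s'') s'"
      unfolding wp_Seq
    proof (rule wp_mono)
      fix t s'' assume A: "(t \<le> c \<and> I (Suc k) (s''\<lparr>nvar := (nvar s'')(v := Suc k)\<rparr>)) \<and>
          same_except (writes body) s' s''"
      have "nvar s'' v = k" using same_exceptD(1)[of "writes body" s' s'' v] A fresh J by auto
      moreover have "same_except (insert v (writes body)) s (s''\<lparr>nvar := (nvar s'')(v := Suc k)\<rparr>)"
        using A J unfolding same_except_def by auto
      ultimately show "wp (NAssign v (NAdd (NVar v) (NConst 1))) (\<lambda>u s''. t + u \<le> c + 4 \<and> ?J (Suc k) s'') s''"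
        using A k by simp
    qed
    with k show "k < ?n \<and> wp ?body (\<lambda>t s''. t \<le> c + 4 \<and> ?J (Suc k) s'') s'" by blast
  qed (use init in \<open>auto simp: same_except_def\<close>)
  then show ?thesis
    unfolding for_loop_def wp_Seq wp_NAssign
  proof (simp, elim wp_mono, goal_cases)
    case (1 t s')
    then have "nvar s' v = ?n" using N by auto
    with 1 show ?case by (auto simp: algebra_simps)
  qed
qed


section \<open>Bottom-up merge sort\<close>

text \<open>Blocks are aligned at multiples of \<open>w\<close>, hence identified by the quotient; a
  shorter last block is covered as it stands, and once \<open>w\<close> reaches \<open>N\<close> the
  whole range is one block.\<close>

definition block_sorted :: "(nat \<Rightarrow> real) \<Rightarrow> (nat \<Rightarrow> nat) \<Rightarrow> nat \<Rightarrow> nat \<Rightarrow> bool" where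
  "block_sorted key P w N \<longleftrightarrow>
     (\<forall>a b. a \<le> b \<and> b < N \<and> a div w = b div w \<longrightarrow> key (P a) \<le> key (P b))"

text \<open>
  State of a pass before position \<open>k\<close> of \<open>Q\<close> is written: the runs \<open>{lo..<mid}\<close> and \<open>{mid..<hi}\<close> of \<open>P\<close>
  are being merged and have been consumed up to \<open>i\<close> and \<open>j\<close>.  A pass is one flat loop over \<open>k\<close> that
  opens the next pair of runs when \<open>k = hi\<close>, so each iteration has constant cost.
\<close>

definition merge_inv :: "(nat \<Rightarrow> real) \<Rightarrow> (nat \<Rightarrow> nat) \<Rightarrow> nat \<Rightarrow> nat \<Rightarrow> nat \<Rightarrow> nat \<Rightarrow> nat \<Rightarrow> nat \<Rightarrow>
    nat \<Rightarrow> nat \<Rightarrow> (nat \<Rightarrow> nat) \<Rightarrow> bool" where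
  "merge_inv key P w N k lo mid hi i j Q \<longleftrightarrow>
     lo \<le> i \<and> i \<le> mid \<and> mid \<le> j \<and> j \<le> hi \<and> hi \<le> N \<and> k \<le> hi \<and> i + j = k + mid \<and>
     2 * w dvd lo \<and> mid \<le> lo + w \<and> (mid = lo + w \<or> mid = hi) \<and> hi \<le> lo + 2 * w \<and>
     (2 * w dvd hi \<or> hi = N) \<and>
     mset (map Q [0..<k]) = mset (map P [0..<i]) + mset (map P [mid..<j]) \<and>
     block_sorted key Q (2 * w) k \<and>
     (\<forall>a b. lo \<le> a \<and> a < k \<and> (i \<le> b \<and> b < mid \<or> j \<le> b \<and> b < hi) \<longrightarrow> key (Q a) \<le> key (P b))"

lemma div_less_same_block:
  fixes a b lo w :: nat
  assumes "w dvd lo" "lo \<le> b" "b < lo + w" "a div w = b div w"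
  shows "lo \<le> a"
proof -
  obtain q where q: "lo = w * q" using assms(1) by blast
  have w: "w > 0" using assms by (cases w) auto
  have "q \<le> b div w" using assms(2) w unfolding q by (simp add: less_eq_div_iff_mult_less_eq mult.commute)
  then have "w * q \<le> w * (a div w)" using assms(4) by simp
  also have "\<dots> \<le> a" by simp
  finally show ?thesis using q by simp
qed

lemma same_block:
  fixes a b lo w :: nat
  assumes "w dvd lo" "lo \<le> a" "a \<le> b" "b < lo + w"
  shows "a div w = b div w"
proof -
  obtain q where q: "lo = w * q" using assms(1) by blast
  have "a div w = q" "b div w = q"
    using assms unfolding q by (auto intro!: div_nat_eqI simp: algebra_simps)
  then show ?thesis by simp
qed

lemma block_sorted_extend:
  assumes Q: "block_sorted key Q w k" and "w dvd lo" "lo \<le> k" "k < lo + w"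
    and le: "\<And>a. lo \<le> a \<Longrightarrow> a < k \<Longrightarrow> key (Q a) \<le> key v"
  shows "block_sorted key (Q(k := v)) w (Suc k)"
  unfolding block_sorted_def
proof (intro allI impI, elim conjE)
  fix a b assume ab: "a \<le> b" "b < Suc k" "a div w = b div w"
  show "key ((Q(k := v)) a) \<le> key ((Q(k := v)) b)"
  proof (cases "b = k")
    case True
    then have "lo \<le> a" using div_less_same_block[of w lo k a] assms(2-4) ab by simp
    then show ?thesis using le[of a] ab True by auto
  next
    case False
    then show ?thesis using Q ab unfolding block_sorted_def by auto
  qed
qed

lemma mset_map_upt_split:
  assumes "m \<le> h"
  shows "mset (map P [0..<m]) + mset (map P [m..<h]) = mset (map P [0..<h])"
proof -
  have "[0..<h] = [0..<m] @ [m..<h]" using assms upt_add_eq_append[of 0 m "h - m"] by simp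
  then show ?thesis by (simp only: map_append mset_append)
qed

text \<open>The chosen head is minimal among all unmerged elements of the pair: within its own run
  by sortedness, within the other run because it does not exceed that run's head.\<close>

lemma merge_inv_left:
  assumes inv: "merge_inv key P w N k lo mid hi i j Q" and P: "block_sorted key P w N"
    and i: "i < mid" and le: "j < hi \<Longrightarrow> key (P i) \<le> key (P j)"
  shows "merge_inv key P w N (Suc k) lo mid hi (Suc i) j (Q(k := P i))"
proof -
  note I = inv[unfolded merge_inv_def]
  have lo: "w dvd lo" "w dvd lo + w" using I by (auto dest: dvd_mult_right)
  have left: "key (P i) \<le> key (P b)" if "i \<le> b" "b < mid" for b
    using P that I lo same_block[of w lo i b] unfolding block_sorted_def by auto
  have right: "key (P i) \<le> key (P b)" if "j \<le> b" "b < hi" for b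
  proof -
    \<comment> \<open>A nonempty right run forces the left run to have full length, so the right run
      starts at a multiple of \<open>w\<close> and lies in one sorted block.\<close>
    have mid: "mid = lo + w" using that I by auto
    have "key (P j) \<le> key (P b)"
      using P that I lo same_block[of w "lo + w" j b] mid unfolding block_sorted_def by auto
    with le that show ?thesis by simp
  qed
  have "block_sorted key (Q(k := P i)) (2 * w) (Suc k)"
    by (rule block_sorted_extend[where lo = lo]) (use I i in auto)
  moreover have "mset (map (Q(k := P i)) [0..<Suc k]) = mset (map P [0..<Suc i]) + mset (map P [mid..<j])"
    using I by simp
  moreover have "key ((Q(k := P i)) a) \<le> key (P b)"
    if "lo \<le> a" "a < Suc k" "Suc i \<le> b \<and> b < mid \<or> j \<le> b \<and> b < hi" for a b
    using that left[of b] right[of b] I by (cases "a = k") auto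
  ultimately show ?thesis unfolding merge_inv_def using I i by auto
qed

lemma merge_inv_right:
  assumes inv: "merge_inv key P w N k lo mid hi i j Q" and P: "block_sorted key P w N"
    and j: "j < hi" and le: "i < mid \<Longrightarrow> key (P j) \<le> key (P i)"
  shows "merge_inv key P w N (Suc k) lo mid hi i (Suc j) (Q(k := P j))"
proof -
  note I = inv[unfolded merge_inv_def]
  have lo: "w dvd lo" "w dvd lo + w" using I by (auto dest: dvd_mult_right)
  have mid: "mid = lo + w" using j I by auto
  have left: "key (P j) \<le> key (P b)" if "i \<le> b" "b < mid" for b
  proof -
    have "key (P i) \<le> key (P b)"
      using P that I lo same_block[of w lo i b] unfolding block_sorted_def by auto
    with le that show ?thesis by simp
  qed
  have right: "key (P j) \<le> key (P b)" if "j \<le> b" "b < hi" for b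
    using P that I lo same_block[of w "lo + w" j b] mid unfolding block_sorted_def by auto
  have "block_sorted key (Q(k := P j)) (2 * w) (Suc k)"
    by (rule block_sorted_extend[where lo = lo]) (use I j in auto)
  moreover have "mset (map (Q(k := P j)) [0..<Suc k]) = mset (map P [0..<i]) + mset (map P [mid..<Suc j])"
    using I by simp
  moreover have "key ((Q(k := P j)) a) \<le> key (P b)"
    if "lo \<le> a" "a < Suc k" "i \<le> b \<and> b < mid \<or> Suc j \<le> b \<and> b < hi" for a b
    using that left[of b] right[of b] I by (cases "a = k") auto
  ultimately show ?thesis unfolding merge_inv_def using I j by auto
qed

text \<open>When \<open>k = hi\<close>, both runs are exhausted and their two multisets combine into
  that of a finished prefix. Clipping the new ends at \<open>N\<close> covers a missing or shortened
  last run.\<close>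

lemma merge_inv_next_block:
  assumes inv: "merge_inv key P w N k lo mid hi i j Q" and k: "k = hi" "k < N"
    and mid': "mid' = min (hi + w) N" and hi': "hi' = min (mid' + w) N"
  shows "merge_inv key P w N k hi mid' hi' hi mid' Q"
proof -
  note I = inv[unfolded merge_inv_def]
  have ij: "i = mid" "j = hi" using I k by auto
  have "mset (map P [0..<mid]) + mset (map P [mid..<hi]) = mset (map P [0..<hi])"
    using I by (intro mset_map_upt_split) auto
  moreover have "hi' = hi + 2 * w \<or> hi' = N" unfolding mid' hi' by (auto simp: min_def)
  then have "2 * w dvd hi' \<or> hi' = N" using I k by auto
  ultimately show ?thesis unfolding merge_inv_def using I ij k mid' hi' by (auto simp: min_def)
qed

text \<open>The all-zero state is an empty, already exhausted pair of runs, so the first iteration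
  opens the first real pair.\<close>

lemma merge_inv_init: "merge_inv key P w N 0 0 0 0 0 0 Q"
  unfolding merge_inv_def by (simp add: block_sorted_def)

lemma merge_inv_final:
  assumes "merge_inv key P w N N lo mid hi i j Q"
  shows "mset (map Q [0..<N]) = mset (map P [0..<N])" "block_sorted key Q (2 * w) N"
proof -
  note I = assms[unfolded merge_inv_def]
  have ij: "i = mid" "j = N" "hi = N" using I by auto
  have "mset (map P [0..<mid]) + mset (map P [mid..<N]) = mset (map P [0..<N])"
    using I ij by (intro mset_map_upt_split) auto
  then show "mset (map Q [0..<N]) = mset (map P [0..<N])" using I ij by simp
  show "block_sorted key Q (2 * w) N" using I by simp
qed

section \<open>The merge sort program and its running time\<close>

definition merge_step :: com where
  "merge_step =
     Seq (Cond (NEq (NVar ''k'') (NVar ''hi''))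
           (Seq (NAssign ''i'' (NVar ''hi''))
           (Seq (NAssign ''mid'' (NAdd (NVar ''hi'') (NVar ''w'')))
           (Seq (Cond (NLess (NVar ''N'') (NVar ''mid'')) (NAssign ''mid'' (NVar ''N'')) Skip)
           (Seq (NAssign ''j'' (NVar ''mid''))
           (Seq (NAssign ''hi'' (NAdd (NVar ''mid'') (NVar ''w'')))
                (Cond (NLess (NVar ''N'') (NVar ''hi'')) (NAssign ''hi'' (NVar ''N'')) Skip))))))
           Skip)
         (Cond (BAnd (NLess (NVar ''i'') (NVar ''mid''))
                 (BNot (BAnd (NLess (NVar ''j'') (NVar ''hi''))
                   (RLess (RArr ''key'' (NArr ''P'' (NVar ''j''))) (RArr ''key'' (NArr ''P'' (NVar ''i'')))))))
           (Seq (NStore ''Q'' (NVar ''k'') (NArr ''P'' (NVar ''i'')))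
                (NAssign ''i'' (NAdd (NVar ''i'') (NConst 1))))
           (Seq (NStore ''Q'' (NVar ''k'') (NArr ''P'' (NVar ''j'')))
                (NAssign ''j'' (NAdd (NVar ''j'') (NConst 1)))))"

definition merge_pass :: com where
  "merge_pass =
     Seq (NAssign ''i'' (NConst 0))
     (Seq (NAssign ''j'' (NConst 0))
     (Seq (NAssign ''mid'' (NConst 0))
     (Seq (NAssign ''hi'' (NConst 0))
     (Seq (for_loop ''k'' ''N'' merge_step)
          (for_loop ''k'' ''N'' (NStore ''P'' (NVar ''k'') (NArr ''Q'' (NVar ''k''))))))))"

definition merge_sort :: com where
  "merge_sort =
     Seq (NAssign ''w'' (NConst 1))
       (While (NLess (NVar ''w'') (NVar ''N''))
         (Seq merge_pass (NAssign ''w'' (NAdd (NVar ''w'') (NVar ''w'')))))"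

lemma writes_merge_step: "writes merge_step = {''i'', ''j'', ''mid'', ''hi'', ''Q''}"
  unfolding merge_step_def by auto

lemma writes_merge_pass: "writes merge_pass = {''i'', ''j'', ''mid'', ''hi'', ''Q'', ''k'', ''P''}"
  unfolding merge_pass_def by (auto simp: writes_merge_step)

lemma writes_merge_sort:
  "writes merge_sort = {''i'', ''j'', ''mid'', ''hi'', ''Q'', ''k'', ''P'', ''w''}"
  unfolding merge_sort_def by (auto simp: writes_merge_pass)

lemma wp_merge_step:
  assumes inv: "merge_inv (rarr s ''key'') (narr s ''P'') (nvar s ''w'') (nvar s ''N'') (nvar s ''k'') lo
      (nvar s ''mid'') (nvar s ''hi'') (nvar s ''i'') (nvar s ''j'') (narr s ''Q'')"
    and P: "block_sorted (rarr s ''key'') (narr s ''P'') (nvar s ''w'') (nvar s ''N'')"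
    and k: "nvar s ''k'' < nvar s ''N''" and w: "nvar s ''w'' > 0"
  shows "wp merge_step (\<lambda>t s'. t \<le> 60 \<and> (\<exists>lo.
      merge_inv (rarr s ''key'') (narr s ''P'') (nvar s ''w'') (nvar s ''N'') (Suc (nvar s ''k'')) lo
      (nvar s' ''mid'') (nvar s' ''hi'') (nvar s' ''i'') (nvar s' ''j'') (narr s' ''Q''))) s"
proof -
  \<comment> \<open>Stated for arbitrary run boundaries, so that it serves both a pair opened in
    this iteration and one already in progress.\<close>
  have step: "(if i < mid \<and> \<not> (j < hi \<and> rarr s ''key'' (narr s ''P'' j) < rarr s ''key'' (narr s ''P'' i))
     then merge_inv (rarr s ''key'') (narr s ''P'') (nvar s ''w'') (nvar s ''N'') (Suc (nvar s ''k'')) lo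
       mid hi (Suc i) j ((narr s ''Q'')(nvar s ''k'' := narr s ''P'' i))
     else merge_inv (rarr s ''key'') (narr s ''P'') (nvar s ''w'') (nvar s ''N'') (Suc (nvar s ''k'')) lo
       mid hi i (Suc j) ((narr s ''Q'')(nvar s ''k'' := narr s ''P'' j)))"
    if "merge_inv (rarr s ''key'') (narr s ''P'') (nvar s ''w'') (nvar s ''N'') (nvar s ''k'') lo
      mid hi i j (narr s ''Q'')" "nvar s ''k'' < hi" for lo mid hi i j
  proof (cases "i < mid \<and> \<not> (j < hi \<and> rarr s ''key'' (narr s ''P'' j) < rarr s ''key'' (narr s ''P'' i))")
    case True
    then show ?thesis using merge_inv_left[OF that(1) P] by auto
  next
    case False
    have "i + j = nvar s ''k'' + mid" "i \<le> mid" "j \<le> hi" using that(1) unfolding merge_inv_def by auto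
    \<comment> \<open>By \<open>i + j = k + mid\<close> and \<open>k < hi\<close>, an exhausted left
      run leaves the right run nonempty.\<close>
    then have "j < hi" using False that(2) by (cases "i < mid") auto
    then show ?thesis using False merge_inv_right[OF that(1) P] by auto
  qed
  show ?thesis
  proof (cases "nvar s ''k'' = nvar s ''hi''")
    case True
    let ?N = "nvar s ''N''" and ?w = "nvar s ''w''" and ?h = "nvar s ''hi''"
    define mid' where "mid' = min (?h + ?w) ?N"
    define hi' where "hi' = min (mid' + ?w) ?N"
    have "?h < hi'" using True k w unfolding mid'_def hi'_def by auto
    from step[OF merge_inv_next_block[OF inv True k mid'_def hi'_def]] this True
    show ?thesis unfolding merge_step_def mid'_def hi'_def
      by (auto simp: min_def split: if_splits intro: exI[of _ "nvar s ''hi''"])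
  next
    case False
    then have "nvar s ''k'' < nvar s ''hi''" using inv unfolding merge_inv_def by auto
    from step[OF inv this] False show ?thesis unfolding merge_step_def
      by (auto split: if_splits)
  qed
qed


text \<open>Merging costs at most 60 + 8 steps per position and copying back 4 + 8, which the factor
  90 covers.\<close>

lemma wp_merge_pass:
  assumes P: "block_sorted (rarr s ''key'') (narr s ''P'') (nvar s ''w'') (nvar s ''N'')"
    and w: "nvar s ''w'' > 0"
  shows "wp merge_pass (\<lambda>t s'. t \<le> 20 + 90 * nvar s ''N'' \<and>
      mset (map (narr s' ''P'') [0..<nvar s ''N'']) = mset (map (narr s ''P'') [0..<nvar s ''N'']) \<and>
      block_sorted (rarr s ''key'') (narr s' ''P'') (2 * nvar s ''w'') (nvar s ''N'')) s"
proof -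
  let ?N = "nvar s ''N''" and ?w = "nvar s ''w''" and ?P = "narr s ''P''" and ?key = "rarr s ''key''"
  let ?Q = "\<lambda>Q. mset (map Q [0..<?N]) = mset (map ?P [0..<?N]) \<and> block_sorted ?key Q (2 * ?w) ?N"
  define s0 where "s0 = s\<lparr>nvar := (nvar s)(''i'' := 0, ''j'' := 0, ''mid'' := 0, ''hi'' := 0)\<rparr>"
  have s0: "nvar s0 ''N'' = ?N" "nvar s0 ''w'' = ?w" "narr s0 ''P'' = ?P" "rarr s0 ''key'' = ?key"
    by (simp_all add: s0_def)
  let ?I = "\<lambda>k s'. \<exists>lo. merge_inv ?key ?P ?w ?N k lo
      (nvar s' ''mid'') (nvar s' ''hi'') (nvar s' ''i'') (nvar s' ''j'') (narr s' ''Q'')"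
  have "wp (for_loop ''k'' ''N'' merge_step) (\<lambda>t s'. t \<le> 6 + nvar s0 ''N'' * (60 + 8) \<and>
      ?I (nvar s0 ''N'') s' \<and> same_except (insert ''k'' (writes merge_step)) s0 s') s0"
  proof (rule wp_for_loop)
    show "?I 0 (s0\<lparr>nvar := (nvar s0)(''k'' := 0)\<rparr>)"
      by (simp add: s0_def merge_inv_init exI[of _ 0])
    fix k s' assume k: "k < nvar s0 ''N''" "nvar s' ''k'' = k" and
      same: "same_except (insert ''k'' (writes merge_step)) s0 s'" and I: "?I k s'"
    have eq: "rarr s' ''key'' = ?key" "narr s' ''P'' = ?P" "nvar s' ''w'' = ?w" "nvar s' ''N'' = ?N"
      using same_exceptD[OF same] s0 by (simp_all add: writes_merge_step)
    from I obtain lo where I': "merge_inv ?key ?P ?w ?N k lo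
      (nvar s' ''mid'') (nvar s' ''hi'') (nvar s' ''i'') (nvar s' ''j'') (narr s' ''Q'')" by blast
    show "wp merge_step (\<lambda>t s''. t \<le> 60 \<and> ?I (Suc k) (s''\<lparr>nvar := (nvar s'')(''k'' := Suc k)\<rparr>)) s'"
      using wp_merge_step[of s' lo, unfolded eq k(2), OF I' P] k(1) w s0 by simp
  qed (auto simp: writes_merge_step)
  then have *: "wp (for_loop ''k'' ''N'' merge_step) (\<lambda>t s'. t \<le> 6 + ?N * 68 \<and>
      ?Q (narr s' ''Q'') \<and> nvar s' ''N'' = ?N) s0"
    by (rule wp_mono) (use s0 merge_inv_final same_exceptD(1) in \<open>force simp: writes_merge_step\<close>)
  let ?copy = "NStore ''P'' (NVar ''k'') (NArr ''Q'' (NVar ''k''))"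
  have copy: "wp (for_loop ''k'' ''N'' ?copy) (\<lambda>t s'. t \<le> 6 + ?N * 12 \<and> ?Q (narr s' ''P'')) s1"
    if Q: "?Q (narr s1 ''Q'')" and N: "nvar s1 ''N'' = ?N" for s1
  proof -
    have "wp (for_loop ''k'' ''N'' ?copy) (\<lambda>t s'. t \<le> 6 + nvar s1 ''N'' * (4 + 8) \<and>
      (\<forall>a<nvar s1 ''N''. narr s' ''P'' a = narr s1 ''Q'' a) \<and> same_except (insert ''k'' (writes ?copy)) s1 s') s1"
      by (rule wp_for_loop) (auto simp: less_Suc_eq same_exceptD)
    then show ?thesis
    proof (rule wp_mono)
      fix t s' assume A: "t \<le> 6 + nvar s1 ''N'' * (4 + 8) \<and>
        (\<forall>a<nvar s1 ''N''. narr s' ''P'' a = narr s1 ''Q'' a) \<and> same_except (insert ''k'' (writes ?copy)) s1 s'"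
      then have "map (narr s' ''P'') [0..<?N] = map (narr s1 ''Q'') [0..<?N]"
        using N by (intro map_cong) auto
      then have "mset (map (narr s' ''P'') [0..<?N]) = mset (map ?P [0..<?N])" using Q by (simp only:)
      moreover have "block_sorted ?key (narr s' ''P'') (2 * ?w) ?N"
        using A N Q unfolding block_sorted_def by auto
      ultimately show "t \<le> 6 + ?N * 12 \<and> ?Q (narr s' ''P'')"
        using A N Q by simp
    qed
  qed
  show ?thesis unfolding merge_pass_def
  proof (simp flip: s0_def, rule wp_mono[OF *], goal_cases)
    case (1 t s')
    then show ?case by (elim conjE) (rule wp_mono[OF copy], auto)
  qed
qed

text \<open>Occurs only in the time bound: the program doubles \<open>w\<close> and never computes a
  logarithm.\<close>

definition log2_ceil :: "nat \<Rightarrow> nat" where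
  "log2_ceil N = (LEAST r. N \<le> 2 ^ r)"

lemma less_log2_ceil: "2 ^ k < N \<Longrightarrow> k < log2_ceil N"
proof (rule ccontr)
  assume "2 ^ k < N" "\<not> k < log2_ceil N"
  have "N \<le> 2 ^ N" using less_exp[of N] by simp
  then have "N \<le> 2 ^ log2_ceil N" unfolding log2_ceil_def by (rule LeastI)
  also have "(2::nat) ^ log2_ceil N \<le> 2 ^ k" using \<open>\<not> k < log2_ceil N\<close> by simp
  finally show False using \<open>2 ^ k < N\<close> by simp
qed

lemma wp_merge_sort:
  "wp merge_sort (\<lambda>t s'. t \<le> 10 + log2_ceil (nvar s ''N'') * (90 * nvar s ''N'' + 40) \<and>
      mset (map (narr s' ''P'') [0..<nvar s ''N'']) = mset (map (narr s ''P'') [0..<nvar s ''N'']) \<and>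
      (\<forall>a b. a \<le> b \<and> b < nvar s ''N'' \<longrightarrow> rarr s ''key'' (narr s' ''P'' a) \<le> rarr s ''key'' (narr s' ''P'' b)) \<and>
      same_except (writes merge_sort) s s') s"
proof -
  let ?N = "nvar s ''N''" and ?P = "narr s ''P''" and ?key = "rarr s ''key''"
  define W where "W = writes merge_sort"
  have W: "W = {''i'', ''j'', ''mid'', ''hi'', ''Q'', ''k'', ''P'', ''w''}"
    unfolding W_def writes_merge_sort ..
  let ?b = "NLess (NVar ''w'') (NVar ''N'')"
  let ?body = "Seq merge_pass (NAssign ''w'' (NAdd (NVar ''w'') (NVar ''w'')))"
  let ?I = "\<lambda>k s'. nvar s' ''w'' = 2 ^ k \<and> mset (map (narr s' ''P'') [0..<?N]) = mset (map ?P [0..<?N]) \<and>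
      block_sorted ?key (narr s' ''P'') (2 ^ k) ?N \<and> same_except (W) s s'"
  have eq: "rarr s' ''key'' = ?key" "nvar s' ''N'' = ?N" if "same_except (W) s s'" for s'
    using same_exceptD[OF that] by (simp_all add: W)
  have "wp (While ?b ?body) (\<lambda>t s'. t \<le> (log2_ceil ?N - 0) * ((90 * ?N + 30) + 1 + bcost ?b) + 1 + bcost ?b \<and>
      \<not> bval ?b s' \<and> (\<exists>k\<le>log2_ceil ?N. ?I k s')) (s\<lparr>nvar := (nvar s)(''w'' := 1)\<rparr>)"
  proof (rule wp_while)
    show "?I 0 (s\<lparr>nvar := (nvar s)(''w'' := 1)\<rparr>)"
      by (auto simp: block_sorted_def same_except_def W)
    fix k s' assume I: "?I k s'" and b: "bval ?b s'"
    have "k < log2_ceil ?N" using I b eq by (intro less_log2_ceil) auto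
    moreover have "wp merge_pass (\<lambda>t s''. t \<le> 20 + 90 * nvar s' ''N'' \<and>
      mset (map (narr s'' ''P'') [0..<nvar s' ''N'']) = mset (map (narr s' ''P'') [0..<nvar s' ''N'']) \<and>
      block_sorted (rarr s' ''key'') (narr s'' ''P'') (2 * nvar s' ''w'') (nvar s' ''N'')) s'"
      by (rule wp_merge_pass) (use I eq in auto)
    from wp_frame[OF this]
    have "wp ?body (\<lambda>t s''. t \<le> 90 * ?N + 30 \<and> ?I (Suc k) s'') s'"
      unfolding wp_Seq
    proof (rule wp_mono, goal_cases)
      case (1 t s'')
      have "nvar s'' ''w'' = 2 ^ k" using 1 I same_exceptD(1)[of "writes merge_pass" s' s'' "''w''"]
        by (simp add: writes_merge_pass)
      moreover have "same_except (W) s (s''\<lparr>nvar := (nvar s'')(''w'' := x)\<rparr>)" for x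
        using 1 I unfolding same_except_def by (auto simp: writes_merge_pass W)
      ultimately show ?case using 1 I eq by (auto simp: mult_2)
    qed
    ultimately show "k < log2_ceil ?N \<and> wp ?body (\<lambda>t s''. t \<le> 90 * ?N + 30 \<and> ?I (Suc k) s'') s'"
      by blast
  qed simp_all
  then show ?thesis unfolding W_def[symmetric] unfolding merge_sort_def
  proof (simp, elim wp_mono, goal_cases)
    case (1 t s')
    then obtain k where k: "?I k s'" and b: "\<not> bval ?b s'" by auto
    \<comment> \<open>The guard has failed, so \<open>w\<close> has reached \<open>N\<close> and all
      positions lie in block 0.\<close>
    then have N: "?N \<le> 2 ^ k" using eq by auto
    have "?key (narr s' ''P'' a) \<le> ?key (narr s' ''P'' b)" if "a \<le> b" "b < ?N" for a b
      using k N that unfolding block_sorted_def by auto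
    with k 1 show ?case by (auto simp: algebra_simps)
  qed
qed


section \<open>Lagrangian duality for one part\<close>

text \<open>
  The last conjunct is only there for the induction: an item of larger slope does not contribute to
  the dual objective once the budget is exhausted.
\<close>

lemma fractional_knapsack:
  fixes L G :: "'a \<Rightarrow> real"
  assumes "finite K" "\<And>k. k \<in> K \<Longrightarrow> 0 \<le> L k" "\<And>k. k \<in> K \<Longrightarrow> 0 \<le> G k" "0 \<le> \<Gamma>"
  shows "\<exists>\<pi> f. 0 \<le> \<pi> \<and> (\<forall>k\<in>K. 0 \<le> f k \<and> f k \<le> 1) \<and> (\<Sum>k\<in>K. f k * (L k * G k)) \<le> \<Gamma> \<and>
     (\<Sum>k\<in>K. f k * L k) = \<pi> * \<Gamma> + (\<Sum>k\<in>K. L k * max 0 (1 - \<pi> * G k)) \<and>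
     (\<Gamma> < (\<Sum>k\<in>K. L k * G k) \<longrightarrow> (\<exists>k\<in>K. 1 \<le> \<pi> * G k))"
  using assms(1-3)
proof (induction K rule: finite_ranking_induct[where f = G])
  case empty
  show ?case by (rule exI[of _ 0]) (use assms(4) in auto)
next
  case (insert m K)
  show ?case
  proof (cases "m \<in> K")
    case True
    then show ?thesis using insert.IH insert.prems by (simp add: insert_absorb)
  next
    case m: False
    let ?S = "\<Sum>k\<in>K. L k * G k"
    have nonneg: "0 \<le> L m" "0 \<le> G m" using insert.prems by auto
    consider "?S + L m * G m \<le> \<Gamma>" | "?S \<le> \<Gamma>" "\<Gamma> < ?S + L m * G m" | "\<Gamma> < ?S"
      by linarith
    then show ?thesis
    proof cases
      case 1
      then show ?thesis using m insert by (intro exI[of _ 0] exI[of _ "\<lambda>_. 1"]) auto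
    next
      case 2
      then have pos: "0 < L m * G m" by linarith
      then have Gm: "0 < G m" and Lm: "0 < L m" using nonneg by (auto simp: zero_less_mult_iff)
      \<comment> \<open>\<open>m\<close> has the largest slope and is the item that breaks: it
        receives the fraction that exhausts the budget, and the multiplier becomes
        \<open>1 / G m\<close>.\<close>
      define \<phi> where "\<phi> = (\<Gamma> - ?S) / (L m * G m)"
      define f where "f = (\<lambda>k. if k = m then \<phi> else 1)"
      have \<phi>: "0 \<le> \<phi>" "\<phi> \<le> 1" "\<phi> * (L m * G m) = \<Gamma> - ?S"
        using 2 pos unfolding \<phi>_def by (auto simp: divide_le_eq)
      have fK: "f k = 1" if "k \<in> K" for k using that m by (auto simp: f_def)
      have fsum: "(\<Sum>k\<in>K. f k * u k) = (\<Sum>k\<in>K. u k)" for u :: "'a \<Rightarrow> real"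
        by (rule sum.cong) (auto simp: fK)
      \<comment> \<open>Every other slope is at most \<open>G m\<close>, so none of these hinges is
        truncated, while the hinge of \<open>m\<close> itself vanishes.\<close>
      have hinge: "max 0 (1 - 1 / G m * G k) = 1 - G k / G m" if "k \<in> K" for k
        using insert.hyps(2)[OF that] Gm by (simp add: max_def)
      have "(\<Sum>k\<in>K. L k * max 0 (1 - 1 / G m * G k)) = (\<Sum>k\<in>K. L k - L k * G k / G m)"
        by (intro sum.cong refl) (simp only: hinge, simp add: algebra_simps)
      also have "\<dots> = (\<Sum>k\<in>K. L k) - ?S / G m"
        by (simp add: sum_subtractf sum_divide_distrib)
      finally have "1 / G m * \<Gamma> + (\<Sum>k\<in>insert m K. L k * max 0 (1 - 1 / G m * G k)) =
          (\<Sum>k\<in>K. L k) + (\<Gamma> - ?S) / G m"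
        using insert.hyps(1) m Gm by (simp add: diff_divide_distrib)
      also have "(\<Gamma> - ?S) / G m = \<phi> * L m" using \<phi>(3) Gm by (simp add: field_simps)
      also have "(\<Sum>k\<in>K. L k) + \<phi> * L m = (\<Sum>k\<in>insert m K. f k * L k)"
        using insert.hyps(1) m fsum[of L] by (simp add: f_def)
      finally have eq: "(\<Sum>k\<in>insert m K. f k * L k) =
          1 / G m * \<Gamma> + (\<Sum>k\<in>insert m K. L k * max 0 (1 - 1 / G m * G k))" ..
      have "(\<Sum>k\<in>insert m K. f k * (L k * G k)) = \<Gamma>"
        using insert.hyps(1) m \<phi>(3) fsum[of "\<lambda>k. L k * G k"] by (simp add: f_def)
      then show ?thesis using eq \<phi>(1,2) Gm
        by (intro exI[of _ "1 / G m"] exI[of _ f]) (auto simp: f_def)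
    next
      case 3
      from insert.IH insert.prems 3 obtain \<pi> f k where *: "0 \<le> \<pi>" "\<forall>k\<in>K. 0 \<le> f k \<and> f k \<le> 1"
        "(\<Sum>k\<in>K. f k * (L k * G k)) \<le> \<Gamma>"
        "(\<Sum>k\<in>K. f k * L k) = \<pi> * \<Gamma> + (\<Sum>k\<in>K. L k * max 0 (1 - \<pi> * G k))"
        and k: "k \<in> K" "1 \<le> \<pi> * G k" by auto
      have "1 \<le> \<pi> * G m" using k insert.hyps(2)[OF k(1)] *(1) mult_left_mono[of "G k" "G m" \<pi>] by linarith
      moreover have "(\<Sum>k\<in>K. (f(m := 0)) k * u k) = (\<Sum>k\<in>K. f k * u k)" for u :: "'a \<Rightarrow> real"
        by (rule sum.cong) (use m in auto)
      ultimately show ?thesis using * k insert.hyps(1) m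
        by (intro exI[of _ \<pi>] exI[of _ "f(m := 0)"]) auto
    qed
  qed
qed

lemma hinge_sum_ge:
  fixes q w :: "'a \<Rightarrow> real"
  assumes "finite K" "\<And>k. k \<in> K \<Longrightarrow> 0 \<le> q k" "0 \<le> \<Gamma>" "0 \<le> \<pi>"
    and F: "\<And>\<pi>. F \<pi> = \<pi> * \<Gamma> + a + (\<Sum>k\<in>K. w k * max 0 (q k - \<pi>))"
    and zero: "v \<le> F 0" and knots: "\<And>k. k \<in> K \<Longrightarrow> v \<le> F (q k)"
  shows "v \<le> F \<pi>"
proof -
  \<comment> \<open>Including 0 provides a left neighbour when \<open>\<pi>\<close> lies below every
    knot.\<close>
  define A where "A = insert 0 {x \<in> q ` K. x \<le> \<pi>}"
  define p where "p = Max A"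
  have finA: "finite A" using assms(1) by (simp add: A_def)
  have "p \<in> A" unfolding p_def using finA by (intro Max_in) (auto simp: A_def)
  then have p: "0 \<le> p" "p \<le> \<pi>" "v \<le> F p"
    using assms(2,4) zero knots by (auto simp: A_def)
  have below: "q k \<le> p" if "k \<in> K" "q k \<le> \<pi>" for k
    unfolding p_def using finA that by (intro Max_ge) (auto simp: A_def)
  define D where "D = {x \<in> q ` K. \<pi> < x}"
  have finD: "finite D" using assms(1) by (simp add: D_def)
  show ?thesis
  proof (cases "D = {}")
    case True
    have "max 0 (q k - \<pi>) = max 0 (q k - p)" if "k \<in> K" for k
    proof -
      have "q k \<le> \<pi>" using True that by (force simp: D_def)
      with below[OF that] show ?thesis by simp
    qed
    then have "F \<pi> - F p = (\<pi> - p) * \<Gamma>" unfolding F by (simp add: algebra_simps)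
    moreover have "0 \<le> (\<pi> - p) * \<Gamma>" using p assms(3) by simp
    ultimately show ?thesis using p by linarith
  next
    case False
    define r where "r = Min D"
    have "r \<in> D" unfolding r_def using finD False by (intro Min_in) auto
    then have r: "\<pi> < r" "v \<le> F r" using knots by (auto simp: D_def)
    have above: "r \<le> q k" if "k \<in> K" "\<not> q k \<le> \<pi>" for k
      unfolding r_def using finD that by (intro Min_le) (auto simp: D_def)
    define t where "t = (\<pi> - p) / (r - p)"
    have t: "0 \<le> t" "t \<le> 1" "\<pi> = (1 - t) * p + t * r"
    proof -
      have rp: "0 < r - p" using p r by simp
      show "0 \<le> t" "t \<le> 1" using p r rp by (auto simp: t_def divide_le_eq)
      have "t * (r - p) = \<pi> - p" using rp by (simp add: t_def)
      then show "\<pi> = (1 - t) * p + t * r" by (simp add: algebra_simps)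
    qed
    have "max 0 (q k - \<pi>) = (1 - t) * max 0 (q k - p) + t * max 0 (q k - r)" if "k \<in> K" for k
    proof (cases "q k \<le> \<pi>")
      case True
      with below[OF that] r p show ?thesis by simp
    next
      case False
      with above[OF that] r p have "max 0 (q k - \<pi>) = q k - \<pi>" "max 0 (q k - p) = q k - p"
        "max 0 (q k - r) = q k - r" by auto
      then show ?thesis using t(3) by (simp add: algebra_simps)
    qed
    then have "(\<Sum>k\<in>K. w k * max 0 (q k - \<pi>)) =
        (\<Sum>k\<in>K. (1 - t) * (w k * max 0 (q k - p)) + t * (w k * max 0 (q k - r)))"
      by (intro sum.cong refl) (simp only: distrib_left mult.left_commute)
    also have "\<dots> = (1 - t) * (\<Sum>k\<in>K. w k * max 0 (q k - p)) + t * (\<Sum>k\<in>K. w k * max 0 (q k - r))"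
      by (simp add: sum.distrib sum_distrib_left)
    finally have hinges: "(\<Sum>k\<in>K. w k * max 0 (q k - \<pi>)) = \<dots>" .
    have "\<pi> * \<Gamma> = ((1 - t) * p + t * r) * \<Gamma>" using t(3) by simp
    then have "F \<pi> = (1 - t) * F p + t * F r"
      unfolding F[of \<pi>] F[of p] F[of r] hinges by (simp add: algebra_simps)
    moreover have "(1 - t) * v + t * v \<le> (1 - t) * F p + t * F r"
      using t p r by (intro add_mono mult_left_mono) auto
    ultimately show ?thesis by (simp add: algebra_simps)
  qed
qed

text \<open>
  The positions \<open>K\<close> of one part, ordered by base cost.  Position \<open>k\<close> carries the interval of length
  \<open>len k\<close> from \<open>min (c k) V\<close> to the corresponding value of the next position (to \<open>V\<close> for the last
  one); raising the cheapest cost of the part within this interval costs \<open>slope k\<close> units of budget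
  per unit.  An item with \<open>d k = 0\<close> has \<open>V \<le> c k\<close>, so every interval from \<open>k\<close> on is empty and the
  value of \<open>1 / d k\<close> does not matter.
\<close>

locale part_levels =
  fixes K :: "nat set" and c d :: "nat \<Rightarrow> real" and V :: real and len slope :: "nat \<Rightarrow> real"
  assumes finite_K: "finite K" and nonempty_K: "K \<noteq> {}"
    and d_nonneg: "k \<in> K \<Longrightarrow> 0 \<le> d k"
    and c_mono: "k \<in> K \<Longrightarrow> k' \<in> K \<Longrightarrow> k \<le> k' \<Longrightarrow> c k \<le> c k'"
    and V_le: "k \<in> K \<Longrightarrow> V \<le> c k + d k" and V_attained: "\<exists>k\<in>K. V = c k + d k"
    and len_tail: "k \<in> K \<Longrightarrow> (\<Sum>i\<in>{i\<in>K. k \<le> i}. len i) = V - min (c k) V"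
    and slope_eq: "k \<in> K \<Longrightarrow> slope k = (\<Sum>i\<in>{i\<in>K. i \<le> k}. 1 / d i)"
begin

definition low :: real where "low = V - (\<Sum>k\<in>K. len k)"

text \<open>The Lagrangian of one part: the largest value of a level minus \<open>\<pi>\<close>
  times the budget that reaching it takes. Raising interval \<open>k\<close> pays off exactly while
  its unit price \<open>\<pi> * slope k\<close> is below 1.\<close>

definition level_value :: "real \<Rightarrow> real" where
  "level_value \<pi> = low + (\<Sum>k\<in>K. len k * max 0 (1 - \<pi> * slope k))"

abbreviation left_end :: "nat \<Rightarrow> real" where "left_end k \<equiv> min (c k) V"

text \<open>The locale knows the lengths only through tail sums, the form in which a descending scan
  produces them. Subtracting the sums at two consecutive positions recovers that an interval ends
  where the next one begins.\<close>

lemma next_position: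
  assumes "k \<in> K"
  obtains "left_end k + len k = V" "{i\<in>K. k \<le> i} = {k}"
  | k' where "k' \<in> K" "k < k'" "{i\<in>K. k \<le> i} = insert k {i\<in>K. k' \<le> i}" "left_end k + len k = left_end k'"
proof (cases "{i\<in>K. k < i} = {}")
  case True
  then have "{i\<in>K. k \<le> i} = {k}" using assms by (auto simp: order_le_less)
  with len_tail[OF assms] that(1) show thesis by simp
next
  case False
  define k' where "k' = Min {i\<in>K. k < i}"
  have "k' \<in> {i\<in>K. k < i}" unfolding k'_def using False finite_K by (intro Min_in) auto
  then have k': "k' \<in> K" "k < k'" by auto
  have "k' \<le> i" if "i \<in> K" "k < i" for i unfolding k'_def using that finite_K by (intro Min_le) auto
  then have eq: "{i\<in>K. k \<le> i} = insert k {i\<in>K. k' \<le> i}" using assms k' by (auto simp: order_le_less)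
  have "(\<Sum>i\<in>{i\<in>K. k \<le> i}. len i) = len k + (\<Sum>i\<in>{i\<in>K. k' \<le> i}. len i)"
    unfolding eq using finite_K k' by (subst sum.insert) auto
  with len_tail[OF assms] len_tail[OF k'(1)] have "left_end k + len k = left_end k'" by linarith
  from that(2)[OF k' eq this] show thesis .
qed

text \<open>The function \<open>g\<close> is kept general for the choice \<open>min t\<close>, which
  measures the portion of each interval below a level \<open>t\<close>.\<close>

lemma telescope:
  fixes g :: "real \<Rightarrow> real"
  assumes "k \<in> K"
  shows "(\<Sum>i\<in>{i\<in>K. k \<le> i}. g (left_end i + len i) - g (left_end i)) = g V - g (left_end k)"
  using assms
proof (induction "Max K - k" arbitrary: k rule: less_induct)
  case less
  show ?case using less.prems
  proof (cases rule: next_position)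
    case 1
    then show ?thesis by simp
  next
    case (2 k')
    have "k' \<le> Max K" using 2 finite_K by simp
    then have "(\<Sum>i\<in>{i\<in>K. k' \<le> i}. g (left_end i + len i) - g (left_end i)) = g V - g (left_end k')"
      using less.hyps[of k'] 2 by simp
    then show ?thesis unfolding 2(3) using finite_K 2 by (subst sum.insert) auto
  qed
qed

lemma len_nonneg:
  assumes "k \<in> K"
  shows "0 \<le> len k"
  using assms
proof (cases rule: next_position)
  case (2 k')
  then show ?thesis using c_mono[OF assms 2(1)] by (simp add: min_def split: if_splits)
qed (auto simp: min_def split: if_splits)

lemma slope_nonneg: "k \<in> K \<Longrightarrow> 0 \<le> slope k"
  using slope_eq d_nonneg by (auto intro!: sum_nonneg)

lemma slope_mono: "k \<in> K \<Longrightarrow> k' \<in> K \<Longrightarrow> k \<le> k' \<Longrightarrow> slope k \<le> slope k'"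
  using slope_eq[of k] slope_eq[of k'] finite_K d_nonneg by (auto intro!: sum_mono2)

lemma Min_K: "Min K \<in> K" "K = {i\<in>K. Min K \<le> i}"
  using finite_K nonempty_K by auto

lemma low_eq: "low = left_end (Min K)"
  using len_tail[OF Min_K(1)] Min_K(2) unfolding low_def by simp

lemma len_zero_if_d_zero:
  assumes "k \<in> K" "d k = 0" "i \<in> K" "k \<le> i"
  shows "len i = 0"
proof -
  have "left_end k = V" using V_le[OF assms(1)] assms(2) by simp
  then have "(\<Sum>i\<in>{i\<in>K. k \<le> i}. len i) = 0" using len_tail[OF assms(1)] by simp
  then have "\<forall>i\<in>{i\<in>K. k \<le> i}. len i = 0"
    using finite_K len_nonneg by (subst (asm) sum_nonneg_eq_0_iff) auto
  with assms show ?thesis by blast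
qed

lemma slope_pos:
  assumes "k \<in> K" "len k \<noteq> 0"
  shows "0 < slope k"
proof -
  have "0 < d k" using len_zero_if_d_zero[OF assms(1) _ assms(1)] assms d_nonneg[OF assms(1)] by force
  then have "0 < 1 / d k" by simp
  also have "\<dots> \<le> slope k" unfolding slope_eq[OF assms(1)]
    using assms finite_K d_nonneg by (intro member_le_sum) auto
  finally show ?thesis .
qed

text \<open>Passes between two ways of counting budget: per item, which pays for all intervals from
  its position on, and per interval, whose price collects all items up to it.\<close>

lemma sum_swap_le:
  "(\<Sum>k\<in>K. u k * (\<Sum>i\<in>{i\<in>K. k \<le> i}. g i)) = (\<Sum>i\<in>K. (\<Sum>k\<in>{k\<in>K. k \<le> i}. u k) * g i)"
  for u g :: "nat \<Rightarrow> real"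
  using sum.swap_restrict[OF finite_K finite_K, of "\<lambda>k i. u k * g i" "\<lambda>k i. k \<le> i"]
  by (simp add: sum_distrib_left sum_distrib_right)

text \<open>Every item has to reach \<open>t\<close>, so \<open>\<delta> k\<close> pays for the
  portions \<open>g i\<close> below \<open>t\<close> of all intervals from \<open>k\<close> on.
  Exchanging the sums shows that these portions cost at most the budget of the part; priced at
  \<open>\<pi>\<close>, each leaves a gain \<open>g k * (1 - \<pi> * slope k)\<close>, which the
  hinge term bounds.\<close>

lemma weak_duality:
  assumes \<delta>: "\<And>k. k \<in> K \<Longrightarrow> 0 \<le> \<delta> k \<and> \<delta> k \<le> 1" and t: "\<And>k. k \<in> K \<Longrightarrow> t \<le> c k + d k * \<delta> k" and "0 \<le> \<pi>"
  shows "t \<le> \<pi> * (\<Sum>k\<in>K. \<delta> k) + level_value \<pi>"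
proof -
  define g where "g k = min t (left_end k + len k) - min t (left_end k)" for k
  \<comment> \<open>The item attaining \<open>V\<close> cannot be raised beyond it.\<close>
  have tV: "t \<le> V"
  proof -
    obtain k where k: "k \<in> K" "V = c k + d k" using V_attained by blast
    have "d k * \<delta> k \<le> d k * 1" using k \<delta> d_nonneg by (intro mult_left_mono) auto
    with t[OF k(1)] k(2) show ?thesis by simp
  qed
  have tail: "(\<Sum>i\<in>{i\<in>K. k \<le> i}. g i) = t - min t (left_end k)" if "k \<in> K" for k
    using telescope[OF that, of "min t"] tV by (simp add: g_def)
  have g: "0 \<le> g k" "g k \<le> len k" if "k \<in> K" for k
    using len_nonneg[OF that] by (auto simp: g_def min_def)
  have \<delta>_ge: "1 / d k * (\<Sum>i\<in>{i\<in>K. k \<le> i}. g i) \<le> \<delta> k" if k: "k \<in> K" for k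
  proof (cases "d k = 0 \<or> t \<le> left_end k")
    case True
    then show ?thesis using tail[OF k] \<delta>[OF k] by auto
  next
    case False
    then have "0 < d k" "left_end k = c k" using d_nonneg[OF k] tV by (auto simp: min_def split: if_splits)
    then show ?thesis using tail[OF k] t[OF k] False by (auto simp: field_simps)
  qed
  have "(\<Sum>i\<in>K. slope i * g i) = (\<Sum>i\<in>K. (\<Sum>k\<in>{k\<in>K. k \<le> i}. 1 / d k) * g i)"
    by (rule sum.cong) (auto simp: slope_eq)
  also have "\<dots> = (\<Sum>k\<in>K. 1 / d k * (\<Sum>i\<in>{i\<in>K. k \<le> i}. g i))" by (rule sum_swap_le[symmetric])
  also have "\<dots> \<le> (\<Sum>k\<in>K. \<delta> k)" by (intro sum_mono \<delta>_ge)
  finally have budget: "\<pi> * (\<Sum>i\<in>K. slope i * g i) \<le> \<pi> * (\<Sum>k\<in>K. \<delta> k)"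
    using assms(3) by (rule mult_left_mono)
  \<comment> \<open>The minimum covers a level \<open>t\<close> below \<open>low\<close>, where
    every \<open>g k\<close> is 0.\<close>
  have "(\<Sum>k\<in>K. g k) = t - min t low"
    using tail[OF Min_K(1)] Min_K(2) by (simp add: low_eq)
  then have "t \<le> low + (\<Sum>k\<in>K. g k)" by (simp add: min_def)
  also have "(\<Sum>k\<in>K. g k) = \<pi> * (\<Sum>i\<in>K. slope i * g i) + (\<Sum>k\<in>K. g k * (1 - \<pi> * slope k))"
    by (simp add: sum_distrib_left sum_subtractf algebra_simps)
  also have "(\<Sum>k\<in>K. g k * (1 - \<pi> * slope k)) \<le> (\<Sum>k\<in>K. len k * max 0 (1 - \<pi> * slope k))"
    using g by (intro sum_mono order_trans[OF mult_left_mono mult_right_mono]) auto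
  finally show ?thesis using budget unfolding level_value_def by linarith
qed

text \<open>
  The fractions \<open>f\<close> need not exhaust the intervals in order: each item is charged with the fractions
  of all intervals above it, which uses the same budget and raises it at least as far.
\<close>

lemma strong_duality:
  assumes f: "\<And>k. k \<in> K \<Longrightarrow> 0 \<le> f k \<and> f k \<le> 1"
  obtains \<delta> where "\<And>k. k \<in> K \<Longrightarrow> 0 \<le> \<delta> k \<and> \<delta> k \<le> 1"
    "(\<Sum>k\<in>K. \<delta> k) = (\<Sum>k\<in>K. f k * (len k * slope k))"
    "\<And>k. k \<in> K \<Longrightarrow> low + (\<Sum>k\<in>K. f k * len k) \<le> c k + d k * \<delta> k"
proof -
  define \<delta> where "\<delta> k = 1 / d k * (\<Sum>i\<in>{i\<in>K. k \<le> i}. f i * len i)" for k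
  have part: "0 \<le> f i * len i" "f i * len i \<le> len i" if "i \<in> K" for i
    using f[OF that] len_nonneg[OF that] by (auto simp: mult_left_le_one_le)
  have tail: "0 \<le> (\<Sum>i\<in>{i\<in>K. k \<le> i}. f i * len i)"
      "(\<Sum>i\<in>{i\<in>K. k \<le> i}. f i * len i) \<le> V - left_end k" if "k \<in> K" for k
    unfolding len_tail[OF that, symmetric] using part by (auto intro!: sum_nonneg sum_mono)
  \<comment> \<open>If \<open>d k = 0\<close>, then \<open>left_end k = V\<close> and the tail is
    squeezed to 0, so the equation survives the division by zero.\<close>
  have d: "d k * \<delta> k = (\<Sum>i\<in>{i\<in>K. k \<le> i}. f i * len i)" if "k \<in> K" for k
    using tail[OF that] V_le[OF that] by (cases "d k = 0") (auto simp: \<delta>_def)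
  have "0 \<le> \<delta> k \<and> \<delta> k \<le> 1" if k: "k \<in> K" for k
  proof
    show "0 \<le> \<delta> k" using tail(1)[OF k] d_nonneg[OF k] by (simp add: \<delta>_def)
    have "V - left_end k \<le> d k" using V_le[OF k] d_nonneg[OF k] by (simp add: min_def)
    then have "d k * \<delta> k \<le> d k" using tail(2)[OF k] d[OF k] by linarith
    then show "\<delta> k \<le> 1" using d_nonneg[OF k] by (cases "d k = 0") (auto simp: \<delta>_def)
  qed
  moreover have "(\<Sum>k\<in>K. \<delta> k) = (\<Sum>k\<in>K. f k * (len k * slope k))"
    unfolding \<delta>_def sum_swap_le by (rule sum.cong) (auto simp: slope_eq)
  moreover have "low + (\<Sum>k\<in>K. f k * len k) \<le> c k + d k * \<delta> k" if k: "k \<in> K" for k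
  proof -
    have split: "(\<Sum>i\<in>K. u i) = (\<Sum>i\<in>{i\<in>K. i < k}. u i) + (\<Sum>i\<in>{i\<in>K. k \<le> i}. u i)" for u :: "nat \<Rightarrow> real"
    proof -
      have "K = {i\<in>K. i < k} \<union> {i\<in>K. k \<le> i}" by auto
      then have "(\<Sum>i\<in>K. u i) = (\<Sum>i\<in>{i\<in>K. i < k} \<union> {i\<in>K. k \<le> i}. u i)" by simp
      also have "\<dots> = (\<Sum>i\<in>{i\<in>K. i < k}. u i) + (\<Sum>i\<in>{i\<in>K. k \<le> i}. u i)"
        using finite_K by (intro sum.union_disjoint) auto
      finally show ?thesis .
    qed
    \<comment> \<open>The intervals before \<open>k\<close> lift the level at most to
      \<open>left_end k\<close>; the intervals from \<open>k\<close> on are matched exactly by the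
      raise \<open>d k * \<delta> k\<close>.\<close>
    have "(\<Sum>i\<in>{i\<in>K. i < k}. f i * len i) \<le> (\<Sum>i\<in>{i\<in>K. i < k}. len i)"
      using part by (intro sum_mono) auto
    also have "\<dots> = left_end k - low"
      using split[of len] len_tail[OF k] unfolding low_def by simp
    finally show ?thesis using split[of "\<lambda>i. f i * len i"] d[OF k] by (simp add: min_def split: if_splits)
  qed
  ultimately show thesis using that by blast
qed

text \<open>Slopes increase along the positions, so the intervals with a positive hinge at
  \<open>\<pi>\<close> form a prefix, and \<open>level_value \<pi>\<close> is the affine function of
  that prefix. The ratio bound for its last position says that this function is at most
  \<open>B\<close> at \<open>\<pi>\<close>.\<close>

lemma level_value_le:
  assumes "0 \<le> \<pi>" "low \<le> B"
    and "\<And>k. k \<in> K \<Longrightarrow> (low + (\<Sum>i\<in>{i\<in>K. i \<le> k}. len i) - B) / (\<Sum>i\<in>{i\<in>K. i \<le> k}. len i * slope i) \<le> \<pi>"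
  shows "level_value \<pi> \<le> B"
proof -
  define A where "A = {k\<in>K. 0 < 1 - \<pi> * slope k}"
  have level: "level_value \<pi> = low + (\<Sum>k\<in>A. len k * (1 - \<pi> * slope k))"
    unfolding level_value_def A_def using finite_K
    by (auto intro!: sum.mono_neutral_cong_right simp: max_def split: if_splits)
  show ?thesis
  proof (cases "A = {}")
    case True
    with level assms(2) show ?thesis by simp
  next
    case False
    define k where "k = Max A"
    have finA: "finite A" using finite_K by (simp add: A_def)
    have k: "k \<in> A" unfolding k_def using finA False by (rule Max_in)
    have "A = {i\<in>K. i \<le> k}"
    proof (intro equalityI subsetI)
      fix i assume "i \<in> A"
      then show "i \<in> {i\<in>K. i \<le> k}" using finA by (auto simp: k_def A_def)
    next
      fix i assume i: "i \<in> {i\<in>K. i \<le> k}"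
      then have "\<pi> * slope i \<le> \<pi> * slope k"
        using k assms(1) by (intro mult_left_mono slope_mono) (auto simp: A_def)
      with i k show "i \<in> A" by (auto simp: A_def)
    qed
    define g where "g = (\<Sum>i\<in>A. len i * slope i)"
    have v: "level_value \<pi> = low + (\<Sum>i\<in>A. len i) - \<pi> * g"
      unfolding level g_def by (simp add: sum_subtractf sum_distrib_left algebra_simps)
    have nonneg: "0 \<le> len i * slope i" if "i \<in> A" for i
      using that len_nonneg slope_nonneg by (auto simp: A_def)
    have bound: "(low + (\<Sum>i\<in>A. len i) - B) / g \<le> \<pi>"
      using assms(3)[of k] k \<open>A = {i\<in>K. i \<le> k}\<close> by (simp add: A_def g_def)
    show ?thesis
    proof (cases "g = 0")
      \<comment> \<open>A zero denominator makes the ratio 0 and its bound void, but then all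
        intervals of the prefix are empty and the value is \<open>low\<close>.\<close>
      case True
      then have "\<forall>i\<in>A. len i * slope i = 0"
        unfolding g_def using finA nonneg by (subst (asm) sum_nonneg_eq_0_iff) auto
      then have "\<forall>i\<in>A. len i = 0" using slope_pos by (force simp: A_def)
      then show ?thesis using v True assms(2) by simp
    next
      case False
      then have "0 < g" using sum_nonneg[of A "\<lambda>i. len i * slope i"] nonneg unfolding g_def by force
      with bound v show ?thesis by (simp add: divide_le_eq)
    qed
  qed
qed

text \<open>\<open>level_value\<close> dominates the affine function of every prefix, and
  \<open>p\<close> is the point where that of the prefix ending at \<open>k\<close> equals
  \<open>B\<close>. Positivity of \<open>p\<close> excludes a zero denominator, for which the ratio
  would be 0.\<close>

lemma level_value_ge:
  assumes "k \<in> K" "0 \<le> \<pi>" "\<pi> \<le> p" "0 < p"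
    and p: "p = (low + (\<Sum>i\<in>{i\<in>K. i \<le> k}. len i) - B) / (\<Sum>i\<in>{i\<in>K. i \<le> k}. len i * slope i)"
  shows "B \<le> level_value \<pi>"
proof -
  let ?A = "{i\<in>K. i \<le> k}"
  define g where "g = (\<Sum>i\<in>?A. len i * slope i)"
  have "0 \<le> g" unfolding g_def using len_nonneg slope_nonneg by (auto intro!: sum_nonneg)
  moreover have "g \<noteq> 0" using p assms(4) by (auto simp: g_def)
  ultimately have g: "0 < g" by simp
  have "p * g = low + (\<Sum>i\<in>?A. len i) - B" using p g by (simp flip: g_def)
  moreover have "\<pi> * g \<le> p * g" using assms(3) g by simp
  ultimately have "B \<le> low + (\<Sum>i\<in>?A. len i) - \<pi> * g" by linarith
  also have "\<dots> = low + (\<Sum>i\<in>?A. len i * (1 - \<pi> * slope i))"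
    unfolding g_def by (simp add: sum_subtractf sum_distrib_left algebra_simps)
  also have "\<dots> \<le> low + (\<Sum>i\<in>?A. len i * max 0 (1 - \<pi> * slope i))"
    using len_nonneg by (intro add_left_mono sum_mono mult_left_mono) auto
  also have "\<dots> \<le> level_value \<pi>" unfolding level_value_def
    using finite_K len_nonneg by (intro add_left_mono sum_mono2) auto
  finally show ?thesis .
qed

lemma low_le_level_value: "low \<le> level_value \<pi>"
  unfolding level_value_def using len_nonneg by (auto intro!: sum_nonneg)

text \<open>Moves the kinks onto the multiplier axis, where the knots of all parts can be sorted
  together. A slope 0 occurs only with length 0, so the reciprocal is harmless.\<close>

lemma level_value_hinges:
  "level_value \<pi> = low + (\<Sum>k\<in>K. len k * slope k * max 0 (1 / slope k - \<pi>))"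
proof -
  have "len k * max 0 (1 - \<pi> * slope k) = len k * slope k * max 0 (1 / slope k - \<pi>)" if k: "k \<in> K" for k
  proof (cases "len k = 0")
    case False
    then have "0 < slope k" using slope_pos[OF k] by simp
    then show ?thesis by (auto simp: max_def field_simps)
  qed simp
  then show ?thesis unfolding level_value_def by (intro arg_cong2[where f = "(+)"] refl sum.cong)
qed

text \<open>
  The threshold \<open>p\<close> is the multiplier at which the value of the part drops to the first-stage
  cost \<open>B\<close>.
\<close>

definition is_threshold :: "real \<Rightarrow> real \<Rightarrow> bool" where
  "is_threshold B p \<longleftrightarrow> 0 \<le> p \<and>
     (\<forall>k\<in>K. (low + (\<Sum>i\<in>{i\<in>K. i \<le> k}. len i) - B) / (\<Sum>i\<in>{i\<in>K. i \<le> k}. len i * slope i) \<le> p) \<and>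
     (p = 0 \<or> (\<exists>k\<in>K. p = (low + (\<Sum>i\<in>{i\<in>K. i \<le> k}. len i) - B) / (\<Sum>i\<in>{i\<in>K. i \<le> k}. len i * slope i)))"

lemma level_value_le_threshold:
  assumes "is_threshold B p" "low \<le> B" "p \<le> \<pi>"
  shows "level_value \<pi> \<le> B"
  by (rule level_value_le) (use assms in \<open>force simp: is_threshold_def\<close>)+

lemma level_value_ge_threshold:
  assumes "is_threshold B p" "0 \<le> \<pi>" "\<pi> \<le> p" "0 < p"
  shows "B \<le> level_value \<pi>"
  using assms level_value_ge[of _ \<pi> p B] unfolding is_threshold_def by auto

text \<open>The value of the part is at least \<open>B\<close> up to a positive threshold and at
  most \<open>B\<close> after it, so cutting at \<open>B\<close> replaces \<open>\<pi>\<close> by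
  \<open>max \<pi> p\<close>. Each hinge then splits by \<open>max 0 (q - max \<pi> p) = max 0 (q -
  \<pi>) - max 0 (min q p - \<pi>)\<close>. If \<open>low\<close> is not below \<open>B\<close>, the
  minimum is constantly \<open>B\<close> and all weights are 0.\<close>

lemma min_level_value:
  assumes p: "is_threshold B p" and "0 \<le> \<pi>"
  shows "min B (level_value \<pi>) = min B low + (\<Sum>k\<in>K. (if low < B then len k * slope k else 0) *
      (max 0 (1 / slope k - \<pi>) - max 0 (min (1 / slope k) p - \<pi>)))"
proof (cases "low < B")
  case True
  have "min B (level_value \<pi>) = level_value (max \<pi> p)"
  proof (cases "p \<le> \<pi>")
    case True
    with level_value_le_threshold[OF p _ True] \<open>low < B\<close> show ?thesis by (simp add: max_def)
  next
    case False
    then have "level_value p = B" "B \<le> level_value \<pi>"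
      using level_value_le_threshold[OF p, of p] level_value_ge_threshold[OF p, of p]
        level_value_ge_threshold[OF p, of \<pi>] \<open>low < B\<close> assms(2) by auto
    with False show ?thesis by (simp add: max_def)
  qed
  also have "\<dots> = low + (\<Sum>k\<in>K. len k * slope k *
      (max 0 (1 / slope k - \<pi>) - max 0 (min (1 / slope k) p - \<pi>)))"
    unfolding level_value_hinges
    by (intro arg_cong2[where f = "(+)"] refl sum.cong arg_cong2[where f = "(*)"])
       (auto simp: max_def min_def)
  finally show ?thesis using True by simp
next
  case False
  then show ?thesis using low_le_level_value[of \<pi>] by simp
qed

end


section \<open>Lagrangian duality for the robust problem\<close>

lemma part_index_eq:
  assumes "valid_input I" "j \<in> {1..num_parts I}" "i \<in> part_items I j"
  shows "part_index I i = j"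
  unfolding part_index_def
proof (rule the_equality)
  fix k assume "k \<in> {1..num_parts I} \<and> i \<in> part_items I k"
  then show "k = j" using assms unfolding valid_input_def disjoint_family_on_def by blast
qed (use assms in auto)

lemma part_index_mem:
  assumes "valid_input I" "i \<in> {1..num_items I}"
  shows "part_index I i \<in> {1..num_parts I}" "i \<in> part_items I (part_index I i)"
proof -
  obtain j where "j \<in> {1..num_parts I}" "i \<in> part_items I j"
    using assms unfolding valid_input_def by blast
  with part_index_eq[OF assms(1) this]
  show "part_index I i \<in> {1..num_parts I}" "i \<in> part_items I (part_index I i)" by simp_all
qed

lemma finite_part: "valid_input I \<Longrightarrow> j \<in> {1..num_parts I} \<Longrightarrow> finite (part_items I j)"
  using part_subset finite_subset by blast

lemma sum_parts:
  fixes f :: "nat \<Rightarrow> 'b::comm_monoid_add"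
  assumes "valid_input I"
  shows "(\<Sum>i=1..num_items I. f i) = (\<Sum>j=1..num_parts I. \<Sum>i\<in>part_items I j. f i)"
proof -
  have "{1..num_items I} = (\<Union>j\<in>{1..num_parts I}. part_items I j)"
    using assms by (simp add: valid_input_def)
  then show ?thesis
    using assms finite_part[OF assms]
    by (subst sum.UNION_disjoint[symmetric]) (auto simp: valid_input_def disjoint_family_on_def)
qed

text \<open>Lets the loops over the parts be charged to the number of items.\<close>

lemma num_parts_le:
  assumes I: "valid_input I"
  shows "num_parts I \<le> num_items I"
proof -
  have "(\<Sum>j=1..num_parts I. 1) \<le> (\<Sum>j=1..num_parts I. \<Sum>i\<in>part_items I j. 1::nat)"
    using I finite_part[OF I] by (intro sum_mono) (auto simp: valid_input_def Suc_le_eq card_gt_0_iff)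
  then show ?thesis using sum_parts[OF I, of "\<lambda>_. 1::nat"] by simp
qed

section \<open>The second stage as a choice of one representative per open part\<close>

definition open_parts :: "rep_input \<Rightarrow> (nat \<Rightarrow> nat) \<Rightarrow> nat set" where
  "open_parts I x = {j \<in> {1..num_parts I}. (\<Sum>i\<in>part_items I j. x i) = 0}"

text \<open>Together with \<open>recourse_cost_le\<close> this replaces a formula for the recourse
  cost as a sum of minima: strong duality delivers common levels \<open>t j\<close>, weak duality
  starts from representatives.\<close>

lemma recourse_cost_ge:
  assumes I: "valid_input I" and x: "x \<in> first_stage I"
    and t: "\<And>j i. j \<in> open_parts I x \<Longrightarrow> i \<in> part_items I j \<Longrightarrow> t j \<le> c i"
  shows "(\<Sum>j\<in>open_parts I x. t j) \<le> recourse_cost I x c"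
  unfolding recourse_cost_def
proof (subst Min_ge_iff)
  show "finite ((\<lambda>y. \<Sum>i=1..num_items I. c i * real (y i)) ` second_stage I x)"
    by (simp add: finite_second_stage)
  show "(\<lambda>y. \<Sum>i=1..num_items I. c i * real (y i)) ` second_stage I x \<noteq> {}"
    using second_stage_nonempty[OF I x] by simp
  have "(\<Sum>j\<in>open_parts I x. t j) \<le> (\<Sum>i=1..num_items I. c i * real (y i))"
    if y: "y \<in> second_stage I x" for y
  proof -
    have sumy: "(\<Sum>i\<in>part_items I j. y i) = (if j \<in> open_parts I x then 1 else 0)"
      if j: "j \<in> {1..num_parts I}" for j
    proof -
      have "(\<Sum>i\<in>part_items I j. x i + y i) = 1" using y j by (simp add: second_stage_def)
      then show ?thesis using j by (auto simp: sum.distrib open_parts_def)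
    qed
    have part: "(if j \<in> open_parts I x then t j else 0) \<le> (\<Sum>i\<in>part_items I j. c i * real (y i))"
      if j: "j \<in> {1..num_parts I}" for j
    proof (cases "j \<in> open_parts I x")
      case True
      have "t j = (\<Sum>i\<in>part_items I j. t j * real (y i))"
        using sumy[OF j] True by (simp flip: sum_distrib_left of_nat_sum)
      also have "\<dots> \<le> (\<Sum>i\<in>part_items I j. c i * real (y i))"
        using t True by (intro sum_mono mult_right_mono) auto
      finally show ?thesis using True by simp
    next
      case False
      then have "\<forall>i\<in>part_items I j. y i = 0" using sumy[OF j] finite_part[OF I j] by simp
      then show ?thesis using False by simp
    qed
    have "(\<Sum>j\<in>open_parts I x. t j) = (\<Sum>j=1..num_parts I. if j \<in> open_parts I x then t j else 0)"
      by (simp add: sum.If_cases open_parts_def Int_def)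
    also have "\<dots> \<le> (\<Sum>i=1..num_items I. c i * real (y i))"
      unfolding sum_parts[OF I] by (intro sum_mono part)
    finally show ?thesis .
  qed
  then show "\<forall>a\<in>(\<lambda>y. \<Sum>i=1..num_items I. c i * real (y i)) ` second_stage I x.
      (\<Sum>j\<in>open_parts I x. t j) \<le> a" by blast
qed

text \<open>Serves both stages: as a response of the second stage and as the first-stage solution
  returned by the program.\<close>

definition choose_items :: "rep_input \<Rightarrow> nat set \<Rightarrow> (nat \<Rightarrow> nat) \<Rightarrow> nat \<Rightarrow> nat" where
  "choose_items I J r = restrict (\<lambda>i. if \<exists>j\<in>J. i = r j then 1 else 0) {1..num_items I}"

lemma choose_items_part:
  assumes I: "valid_input I" and J: "J \<subseteq> {1..num_parts I}" and r: "\<And>j. j \<in> J \<Longrightarrow> r j \<in> part_items I j"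
    and j: "j \<in> {1..num_parts I}" and i: "i \<in> part_items I j"
  shows "choose_items I J r i = (if j \<in> J \<and> i = r j then 1 else 0)"
proof -
  have "(\<exists>k\<in>J. i = r k) \<longleftrightarrow> j \<in> J \<and> i = r j"
    using part_index_eq[OF I j i] part_index_eq[OF I _ r] J by auto
  moreover have "i \<in> {1..num_items I}" using part_subset[OF I j] i by blast
  ultimately show ?thesis by (simp add: choose_items_def)
qed

lemma sum_choose_items:
  fixes u :: "nat \<Rightarrow> 'b::comm_semiring_1"
  assumes I: "valid_input I" and J: "J \<subseteq> {1..num_parts I}" and r: "\<And>j. j \<in> J \<Longrightarrow> r j \<in> part_items I j"
    and j: "j \<in> {1..num_parts I}"
  shows "(\<Sum>i\<in>part_items I j. u i * of_nat (choose_items I J r i)) = (if j \<in> J then u (r j) else 0)"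
proof -
  have "(\<Sum>i\<in>part_items I j. u i * of_nat (choose_items I J r i)) =
      (\<Sum>i\<in>part_items I j. if i = r j then (if j \<in> J then u i else 0) else 0)"
    by (rule sum.cong) (auto simp: choose_items_part[OF I J r j])
  also have "\<dots> = (if j \<in> J then u (r j) else 0)"
    using finite_part[OF I j] r[of j] by (auto simp: sum.delta)
  finally show ?thesis .
qed

lemma sum_choose_items_all:
  fixes u :: "nat \<Rightarrow> 'b::comm_semiring_1"
  assumes I: "valid_input I" and J: "J \<subseteq> {1..num_parts I}" and r: "\<And>j. j \<in> J \<Longrightarrow> r j \<in> part_items I j"
  shows "(\<Sum>i=1..num_items I. u i * of_nat (choose_items I J r i)) = (\<Sum>j\<in>J. u (r j))"
proof -
  have "(\<Sum>i=1..num_items I. u i * of_nat (choose_items I J r i)) =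
      (\<Sum>j=1..num_parts I. if j \<in> J then u (r j) else 0)"
    unfolding sum_parts[OF I] by (rule sum.cong[OF refl]) (rule sum_choose_items[OF I J r])
  also have "\<dots> = (\<Sum>j\<in>J. u (r j))"
    using J by (simp add: sum.If_cases Int_absorb1)
  finally show ?thesis .
qed

lemma choose_items_extensional: "choose_items I J r \<in> {1..num_items I} \<rightarrow>\<^sub>E {0, 1}"
  by (auto simp: choose_items_def)

lemma recourse_cost_le:
  assumes I: "valid_input I" and x: "x \<in> first_stage I"
    and r: "\<And>j. j \<in> open_parts I x \<Longrightarrow> r j \<in> part_items I j"
  shows "recourse_cost I x c \<le> (\<Sum>j\<in>open_parts I x. c (r j))"
proof -
  let ?y = "choose_items I (open_parts I x) r"
  have J: "open_parts I x \<subseteq> {1..num_parts I}" by (auto simp: open_parts_def)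
  have tot: "(\<Sum>i\<in>part_items I j. x i + ?y i) = 1" if j: "j \<in> {1..num_parts I}" for j
  proof -
    have "(\<Sum>i\<in>part_items I j. x i) \<le> 1" using x j by (simp add: first_stage_def)
    then show ?thesis
      using sum_choose_items[OF I J r j, of "\<lambda>_. 1::nat"] j by (auto simp: sum.distrib open_parts_def)
  qed
  have "x i + ?y i \<le> 1" if i: "i \<in> {1..num_items I}" for i
  proof -
    note j = part_index_mem[OF I i]
    have "x i + ?y i \<le> (\<Sum>i\<in>part_items I (part_index I i). x i + ?y i)"
      using finite_part[OF I j(1)] j(2) by (intro member_le_sum) auto
    with tot[OF j(1)] show ?thesis by simp
  qed
  with tot choose_items_extensional have "?y \<in> second_stage I x"
    by (auto simp: second_stage_def)
  then have "recourse_cost I x c \<le> (\<Sum>i=1..num_items I. c i * real (?y i))"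
    unfolding recourse_cost_def by (intro Min_le) (auto simp: finite_second_stage)
  also have "\<dots> = (\<Sum>j\<in>open_parts I x. c (r j))" by (rule sum_choose_items_all[OF I J r])
  finally show ?thesis .
qed

text \<open>One global order is enough: each part is a subsequence of it, so its positions form a
  set with gaps, for which \<open>part_levels\<close> is general enough. Positions count from 0,
  items from 1.\<close>

locale sorted_instance =
  fixes I :: rep_input and P :: "nat \<Rightarrow> nat" and V len slope
  assumes valid: "valid_input I"
    and bij_P: "bij_betw P {..<num_items I} {1..num_items I}"
    and sorted_P: "k \<le> k' \<Longrightarrow> k' < num_items I \<Longrightarrow> base_cost I (P k) \<le> base_cost I (P k')"
    and V_le: "j \<in> {1..num_parts I} \<Longrightarrow> i \<in> part_items I j \<Longrightarrow> V j \<le> base_cost I i + deviation I i"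
    and V_attained: "j \<in> {1..num_parts I} \<Longrightarrow> \<exists>i\<in>part_items I j. V j = base_cost I i + deviation I i"
    and len_tail: "k < num_items I \<Longrightarrow> part_index I (P k) = j \<Longrightarrow>
      (\<Sum>i\<in>{i. i < num_items I \<and> part_index I (P i) = j \<and> k \<le> i}. len i) = V j - min (base_cost I (P k)) (V j)"
    and slope_eq: "k < num_items I \<Longrightarrow> part_index I (P k) = j \<Longrightarrow>
      slope k = (\<Sum>i\<in>{i. i < num_items I \<and> part_index I (P i) = j \<and> i \<le> k}. 1 / deviation I (P i))"
begin

definition positions :: "nat \<Rightarrow> nat set" where
  "positions j = {k. k < num_items I \<and> part_index I (P k) = j}"

lemma P_mem: "k < num_items I \<Longrightarrow> P k \<in> {1..num_items I}"
  using bij_P by (auto dest: bij_betwE)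

lemma bij_positions:
  assumes j: "j \<in> {1..num_parts I}"
  shows "bij_betw P (positions j) (part_items I j)"
  unfolding bij_betw_def
proof
  show "inj_on P (positions j)"
    using bij_P by (auto simp: bij_betw_def positions_def intro: inj_on_subset)
  show "P ` positions j = part_items I j"
  proof (intro equalityI subsetI)
    fix i assume "i \<in> P ` positions j"
    then show "i \<in> part_items I j" using part_index_mem(2)[OF valid P_mem] by (auto simp: positions_def)
  next
    fix i assume i: "i \<in> part_items I j"
    then have "i \<in> {1..num_items I}" using part_subset[OF valid j] by blast
    then have "i \<in> P ` {..<num_items I}" using bij_P by (simp add: bij_betw_def)
    then obtain k where "k < num_items I" "i = P k" by auto
    then show "i \<in> P ` positions j" using part_index_eq[OF valid j i] by (auto simp: positions_def)
  qed
qed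

lemma positions_part: "j \<in> {1..num_parts I} \<Longrightarrow> k \<in> positions j \<Longrightarrow> P k \<in> part_items I j"
  using bij_positions by (auto dest: bij_betwE)

lemma part_obtain:
  assumes "j \<in> {1..num_parts I}" "i \<in> part_items I j"
  obtains k where "k \<in> positions j" "i = P k"
  using bij_positions[OF assms(1)] assms(2) by (auto simp: bij_betw_def)

lemma sum_positions:
  "j \<in> {1..num_parts I} \<Longrightarrow> (\<Sum>k\<in>positions j. f (P k)) = (\<Sum>i\<in>part_items I j. f i)"
  by (rule sum.reindex_bij_betw[OF bij_positions])

lemma levels:
  assumes j: "j \<in> {1..num_parts I}"
  shows "part_levels (positions j) (\<lambda>k. base_cost I (P k)) (\<lambda>k. deviation I (P k)) (V j) len slope"
proof
  show "finite (positions j)" by (simp add: positions_def)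
  show "positions j \<noteq> {}"
  proof -
    have "part_items I j \<noteq> {}" using valid j by (simp add: valid_input_def)
    then show ?thesis using bij_betw_imp_surj_on[OF bij_positions[OF j]] by force
  qed
  show "\<exists>k\<in>positions j. V j = base_cost I (P k) + deviation I (P k)"
    using V_attained[OF j] part_obtain[OF j] by metis
next
  fix k assume k: "k \<in> positions j"
  show "0 \<le> deviation I (P k)" using k P_mem valid by (auto simp: positions_def valid_input_def)
  show "V j \<le> base_cost I (P k) + deviation I (P k)" using V_le[OF j positions_part[OF j k]] .
  show "(\<Sum>i\<in>{i\<in>positions j. k \<le> i}. len i) = V j - min (base_cost I (P k)) (V j)"
    using len_tail[of k j] k by (simp add: positions_def conj_assoc)
  show "slope k = (\<Sum>i\<in>{i\<in>positions j. i \<le> k}. 1 / deviation I (P i))"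
    using slope_eq[of k j] k by (simp add: positions_def conj_assoc)
next
  fix k k' assume "k \<in> positions j" "k' \<in> positions j" "k \<le> k'"
  then show "base_cost I (P k) \<le> base_cost I (P k')" using sorted_P by (simp add: positions_def)
qed

section \<open>Lagrangian bounds on the robust cost and optimality\<close>

definition level :: "nat \<Rightarrow> real \<Rightarrow> real" where
  "level j = part_levels.level_value (positions j) (V j) len slope"

text \<open>Under a worst scenario the cheapest cost in an open part is a level reached by all its
  items. Weak duality bounds these levels with any common \<open>\<pi>\<close>, and the deviations
  of all parts share one budget.\<close>

lemma robust_cost_le:
  assumes x: "x \<in> first_stage I" and \<pi>: "0 \<le> \<pi>"
  shows "robust_cost I x \<le> (\<Sum>i=1..num_items I. first_cost I i * real (x i)) + \<pi> * budget I +
    (\<Sum>j\<in>open_parts I x. level j \<pi>)"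
proof -
  let ?J = "open_parts I x"
  obtain c where c: "c \<in> uncertainty_set I"
      "(SUP c\<in>uncertainty_set I. recourse_cost I x c) = recourse_cost I x c"
    using worst_case_attained[OF valid x] by blast
  then obtain \<delta> where \<delta>: "\<delta> \<in> {1..num_items I} \<rightarrow>\<^sub>E {0..1}"
      "\<And>i. i \<in> {1..num_items I} \<Longrightarrow> c i = base_cost I i + deviation I i * \<delta> i"
      "(\<Sum>i=1..num_items I. \<delta> i) \<le> budget I"
    unfolding uncertainty_set_def by blast
  have \<delta>01: "0 \<le> \<delta> i \<and> \<delta> i \<le> 1" if "i \<in> {1..num_items I}" for i
    using PiE_mem[OF \<delta>(1) that] by simp
  have "\<exists>i\<in>part_items I j. \<forall>i'\<in>part_items I j. c i \<le> c i'" if "j \<in> {1..num_parts I}" for j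
  proof -
    have "finite (c ` part_items I j)" "c ` part_items I j \<noteq> {}"
      using finite_part[OF valid that] valid that by (auto simp: valid_input_def)
    then have "Min (c ` part_items I j) \<in> c ` part_items I j" by (rule Min_in)
    then obtain i where "i \<in> part_items I j" "c i = Min (c ` part_items I j)" by force
    then show ?thesis using \<open>finite (c ` part_items I j)\<close> by (intro bexI[of _ i]) auto
  qed
  then obtain r where r: "\<And>j. j \<in> {1..num_parts I} \<Longrightarrow> r j \<in> part_items I j"
      "\<And>j i. j \<in> {1..num_parts I} \<Longrightarrow> i \<in> part_items I j \<Longrightarrow> c (r j) \<le> c i" by metis
  have part: "c (r j) \<le> \<pi> * (\<Sum>i\<in>part_items I j. \<delta> i) + level j \<pi>" if j: "j \<in> {1..num_parts I}" for j
    unfolding level_def sum_positions[OF j, symmetric]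
  proof (rule part_levels.weak_duality[OF levels[OF j] _ _ \<pi>])
    fix k assume k: "k \<in> positions j"
    then have "P k \<in> {1..num_items I}" using P_mem by (simp add: positions_def)
    then show "0 \<le> \<delta> (P k) \<and> \<delta> (P k) \<le> 1" "c (r j) \<le> base_cost I (P k) + deviation I (P k) * \<delta> (P k)"
      using \<delta>01 \<delta>(2) r(2)[OF j positions_part[OF j k]] by simp_all
  qed
  have "recourse_cost I x c \<le> (\<Sum>j\<in>?J. c (r j))"
    by (rule recourse_cost_le[OF valid x r(1)]) (simp add: open_parts_def)
  also have "\<dots> \<le> (\<Sum>j\<in>?J. \<pi> * (\<Sum>i\<in>part_items I j. \<delta> i) + level j \<pi>)"
    using part by (intro sum_mono) (simp add: open_parts_def)
  also have "\<dots> = \<pi> * (\<Sum>j\<in>?J. \<Sum>i\<in>part_items I j. \<delta> i) + (\<Sum>j\<in>?J. level j \<pi>)"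
    by (simp add: sum.distrib sum_distrib_left)
  \<comment> \<open>Deviation spent outside the open parts is nonnegative, so the open parts receive
    at most the whole budget.\<close>
  also have "(\<Sum>j\<in>?J. \<Sum>i\<in>part_items I j. \<delta> i) \<le> (\<Sum>j=1..num_parts I. \<Sum>i\<in>part_items I j. \<delta> i)"
  proof (intro sum_mono2 sum_nonneg)
    fix j i assume "j \<in> {1..num_parts I} - ?J" "i \<in> part_items I j"
    then show "0 \<le> \<delta> i" using \<delta>01 part_subset[OF valid] by blast
  qed (auto simp: open_parts_def)
  also have "\<dots> \<le> budget I" using \<delta>(3) unfolding sum_parts[OF valid] .
  finally show ?thesis unfolding robust_cost_def c(2) using \<pi> by (simp add: mult_left_mono)
qed

text \<open>The pieces of all open parts enter one common knapsack, with value \<open>len k\<close>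
  and weight \<open>len k * slope k\<close>; this yields the multiplier.
  \<open>strong_duality\<close> turns the fractions of each part into a deviation, and the assembled
  scenario is one admissible choice of the adversary.\<close>

lemma robust_cost_ge:
  assumes x: "x \<in> first_stage I"
  obtains \<pi> where "0 \<le> \<pi>" "(\<Sum>i=1..num_items I. first_cost I i * real (x i)) + \<pi> * budget I +
    (\<Sum>j\<in>open_parts I x. level j \<pi>) \<le> robust_cost I x"
proof -
  let ?J = "open_parts I x"
  have J: "j \<in> {1..num_parts I}" if "j \<in> ?J" for j using that by (simp add: open_parts_def)
  define K where "K = (\<Union>j\<in>?J. positions j)"
  have finK: "finite K" by (auto simp: K_def open_parts_def positions_def)
  have sumK: "(\<Sum>k\<in>K. u k) = (\<Sum>j\<in>?J. \<Sum>k\<in>positions j. u k)" for u :: "nat \<Rightarrow> real"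
    unfolding K_def by (rule sum.UNION_disjoint) (auto simp: open_parts_def positions_def)
  have nonneg: "0 \<le> len k" "0 \<le> slope k" if kK: "k \<in> K" for k
  proof -
    obtain j where j: "j \<in> ?J" "k \<in> positions j" using kK unfolding K_def by blast
    show "0 \<le> len k" by (rule part_levels.len_nonneg[OF levels[OF J[OF j(1)]] j(2)])
    show "0 \<le> slope k" by (rule part_levels.slope_nonneg[OF levels[OF J[OF j(1)]] j(2)])
  qed
  have budget_nonneg: "0 \<le> budget I" using valid by (simp add: valid_input_def)
  have "\<exists>\<pi> f. 0 \<le> \<pi> \<and> (\<forall>k\<in>K. 0 \<le> f k \<and> f k \<le> 1) \<and> (\<Sum>k\<in>K. f k * (len k * slope k)) \<le> budget I \<and>
      (\<Sum>k\<in>K. f k * len k) = \<pi> * budget I + (\<Sum>k\<in>K. len k * max 0 (1 - \<pi> * slope k)) \<and>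
      (budget I < (\<Sum>k\<in>K. len k * slope k) \<longrightarrow> (\<exists>k\<in>K. 1 \<le> \<pi> * slope k))"
    by (rule fractional_knapsack[OF finK _ _ budget_nonneg]) (erule nonneg)+
  then obtain \<pi> f where \<pi>: "0 \<le> \<pi>" and f01: "\<forall>k\<in>K. 0 \<le> f k \<and> f k \<le> 1"
    and f: "(\<Sum>k\<in>K. f k * (len k * slope k)) \<le> budget I"
      "(\<Sum>k\<in>K. f k * len k) = \<pi> * budget I + (\<Sum>k\<in>K. len k * max 0 (1 - \<pi> * slope k))"
    by (elim exE conjE) (rule that; assumption)
  \<comment> \<open>The conclusion of \<open>strong_duality\<close> as one predicate, so that a
    deviation can be chosen for all open parts at once.\<close>
  define good where "good j \<delta> \<longleftrightarrow> (\<forall>k\<in>positions j. 0 \<le> \<delta> k \<and> \<delta> k \<le> 1) \<and>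
      (\<Sum>k\<in>positions j. \<delta> k) = (\<Sum>k\<in>positions j. f k * (len k * slope k)) \<and>
      (\<forall>k\<in>positions j. part_levels.low (positions j) (V j) len + (\<Sum>k\<in>positions j. f k * len k)
        \<le> base_cost I (P k) + deviation I (P k) * \<delta> k)" for j and \<delta> :: "nat \<Rightarrow> real"
  have "\<exists>\<delta>. good j \<delta>" if j: "j \<in> ?J" for j
  proof -
    have "0 \<le> f k \<and> f k \<le> 1" if "k \<in> positions j" for k using f01 j that by (auto simp: K_def)
    then show ?thesis
    proof (rule part_levels.strong_duality[OF levels[OF J[OF j]]])
      fix \<delta> assume "\<And>k. k \<in> positions j \<Longrightarrow> 0 \<le> \<delta> k \<and> \<delta> k \<le> 1"
        "(\<Sum>k\<in>positions j. \<delta> k) = (\<Sum>k\<in>positions j. f k * (len k * slope k))"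
        "\<And>k. k \<in> positions j \<Longrightarrow> part_levels.low (positions j) (V j) len + (\<Sum>k\<in>positions j. f k * len k)
          \<le> base_cost I (P k) + deviation I (P k) * \<delta> k"
      then have "good j \<delta>" unfolding good_def by blast
      then show "\<exists>\<delta>. good j \<delta>" by (rule exI[where x = \<delta>])
    qed
  qed
  then have "\<forall>j\<in>?J. \<exists>\<delta>. good j \<delta>" ..
  then obtain \<Delta> where \<Delta>': "\<And>j. j \<in> ?J \<Longrightarrow> good j (\<Delta> j)" by (blast dest: bchoice)
  note \<Delta> = conjunct1[OF \<Delta>'[unfolded good_def], rule_format]
    conjunct1[OF conjunct2[OF \<Delta>'[unfolded good_def]]]
    conjunct2[OF conjunct2[OF \<Delta>'[unfolded good_def]], rule_format]
  define pos where "pos = inv_into {..<num_items I} P"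
  have pos: "pos (P k) = k" if "k < num_items I" for k
    unfolding pos_def using bij_P that by (auto simp: bij_betw_def)
  \<comment> \<open>\<open>pos\<close> translates items back to positions; parts that are not open
    receive no deviation.\<close>
  define \<delta> where "\<delta> = restrict (\<lambda>i. if part_index I i \<in> ?J then \<Delta> (part_index I i) (pos i) else 0) {1..num_items I}"
  define c where "c = restrict (\<lambda>i. base_cost I i + deviation I i * \<delta> i) {1..num_items I}"
  have \<delta>P: "\<delta> (P k) = (if j \<in> ?J then \<Delta> j k else 0)" if "k \<in> positions j" for j k
    using that P_mem[of k] pos[of k] by (simp add: \<delta>_def positions_def)
  have \<delta>01: "0 \<le> \<delta> i \<and> \<delta> i \<le> 1" if i: "i \<in> {1..num_items I}" for i
  proof -
    obtain k where "k \<in> positions (part_index I i)" "i = P k"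
      using part_obtain part_index_mem[OF valid i] by blast
    then show ?thesis using \<delta>P \<Delta>(1) by auto
  qed
  have "(\<Sum>i=1..num_items I. \<delta> i) = (\<Sum>j=1..num_parts I. \<Sum>k\<in>positions j. \<delta> (P k))"
    unfolding sum_parts[OF valid] by (rule sum.cong) (auto simp: sum_positions)
  also have "\<dots> = (\<Sum>j=1..num_parts I. if j \<in> ?J then \<Sum>k\<in>positions j. \<Delta> j k else 0)"
    by (rule sum.cong) (auto simp: \<delta>P)
  also have "\<dots> = (\<Sum>j\<in>?J. \<Sum>k\<in>positions j. \<Delta> j k)"
    by (simp add: sum.If_cases open_parts_def Int_def)
  also have "\<dots> = (\<Sum>k\<in>K. f k * (len k * slope k))" unfolding sumK by (rule sum.cong) (auto simp: \<Delta>(2))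
  finally have "(\<Sum>i=1..num_items I. \<delta> i) \<le> budget I" using f(1) by simp
  moreover have "\<delta> \<in> {1..num_items I} \<rightarrow>\<^sub>E {0..1}"
    using \<delta>01 by (auto simp: PiE_iff \<delta>_def)
  moreover have "c \<in> {1..num_items I} \<rightarrow>\<^sub>E {0..}"
    using \<delta>01 valid by (auto simp: PiE_iff c_def valid_input_def)
  ultimately have cU: "c \<in> uncertainty_set I"
    unfolding uncertainty_set_def by (auto simp: c_def)
  have "(\<Sum>j\<in>?J. part_levels.low (positions j) (V j) len + (\<Sum>k\<in>positions j. f k * len k)) \<le> recourse_cost I x c"
  proof (rule recourse_cost_ge[OF valid x])
    fix j i assume j: "j \<in> ?J" and i: "i \<in> part_items I j"
    then obtain k where k: "k \<in> positions j" "i = P k" using part_obtain[OF J] by blast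
    have "i \<in> {1..num_items I}" using part_subset[OF valid J[OF j]] i by blast
    then show "part_levels.low (positions j) (V j) len + (\<Sum>k\<in>positions j. f k * len k) \<le> c i"
      using \<Delta>(3)[OF j k(1)] \<delta>P[OF k(1)] j k(2) by (simp add: c_def)
  qed
  also have "\<dots> \<le> (SUP c\<in>uncertainty_set I. recourse_cost I x c)"
    using worst_case_attained[OF valid x] cU by metis
  finally have "(\<Sum>j\<in>?J. part_levels.low (positions j) (V j) len) + (\<Sum>k\<in>K. f k * len k)
      \<le> (SUP c\<in>uncertainty_set I. recourse_cost I x c)" by (simp add: sum.distrib sumK)
  moreover have "(\<Sum>j\<in>?J. level j \<pi>) = (\<Sum>j\<in>?J. part_levels.low (positions j) (V j) len) +
      (\<Sum>k\<in>K. len k * max 0 (1 - \<pi> * slope k))"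
    using J by (simp add: level_def part_levels.level_value_def[OF levels] sum.distrib sumK)
  ultimately show thesis using that[OF \<pi>] f(2) unfolding robust_cost_def by simp
qed

text \<open>With \<open>\<pi>\<close> fixed the objective separates: a bought part pays at least
  \<open>B j\<close>, an open one \<open>level j \<pi>\<close>. So any first-stage solution costs at
  least \<open>F\<close> at the multiplier that \<open>robust_cost_ge\<close> finds for it, hence at
  least \<open>F p\<close>. Buying exactly \<open>J\<close> takes the smaller option of every part
  at \<open>p\<close> and stays within \<open>F p\<close> by \<open>robust_cost_le\<close>.\<close>

lemma optimality:
  assumes A: "\<And>j. j \<in> {1..num_parts I} \<Longrightarrow> A j \<in> part_items I j \<and> first_cost I (A j) = B j"
    and B: "\<And>j i. j \<in> {1..num_parts I} \<Longrightarrow> i \<in> part_items I j \<Longrightarrow> B j \<le> first_cost I i"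
    and F: "\<And>\<pi>. F \<pi> = \<pi> * budget I + (\<Sum>j=1..num_parts I. min (B j) (level j \<pi>))"
    and p: "0 \<le> p" "\<And>\<pi>. 0 \<le> \<pi> \<Longrightarrow> F p \<le> F \<pi>"
    and J: "J \<subseteq> {1..num_parts I}" "\<And>j. j \<in> J \<Longrightarrow> B j \<le> level j p"
      "\<And>j. j \<in> {1..num_parts I} - J \<Longrightarrow> level j p \<le> B j"
  shows "choose_items I J A \<in> first_stage I" "robust_cost I (choose_items I J A) = optimal_value I"
    "optimal_value I = F p"
proof -
  let ?x = "choose_items I J A"
  have AJ: "A j \<in> part_items I j" if "j \<in> J" for j using A J(1) that by blast
  have ones: "(\<Sum>i\<in>part_items I j. ?x i) = (if j \<in> J then 1 else 0)" if "j \<in> {1..num_parts I}" for j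
    using sum_choose_items[OF valid J(1) AJ that, of "\<lambda>_. 1::nat"] by simp
  show x: "?x \<in> first_stage I"
    unfolding first_stage_def using ones choose_items_extensional by auto
  have opened: "open_parts I ?x = {1..num_parts I} - J"
    using ones by (auto simp: open_parts_def split: if_splits)
  have ge: "F p \<le> robust_cost I x" if x: "x \<in> first_stage I" for x
  proof -
    obtain \<pi> where \<pi>: "0 \<le> \<pi>" "(\<Sum>i=1..num_items I. first_cost I i * real (x i)) + \<pi> * budget I +
        (\<Sum>j\<in>open_parts I x. level j \<pi>) \<le> robust_cost I x" using robust_cost_ge[OF x] .
    have part: "min (B j) (level j \<pi>) \<le> (\<Sum>i\<in>part_items I j. first_cost I i * real (x i)) +
        (if j \<in> open_parts I x then level j \<pi> else 0)" if j: "j \<in> {1..num_parts I}" for j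
    proof (cases "j \<in> open_parts I x")
      case True
      have "0 \<le> (\<Sum>i\<in>part_items I j. first_cost I i * real (x i))"
        using valid part_subset[OF valid j] by (intro sum_nonneg) (auto simp: valid_input_def)
      then show ?thesis using True by simp
    next
      case False
      have "(\<Sum>i\<in>part_items I j. x i) \<le> 1" using x j by (simp add: first_stage_def)
      then have "(\<Sum>i\<in>part_items I j. x i) = 1" using False j by (auto simp: open_parts_def)
      then have "B j = (\<Sum>i\<in>part_items I j. B j * real (x i))"
        by (simp flip: sum_distrib_left of_nat_sum)
      also have "\<dots> \<le> (\<Sum>i\<in>part_items I j. first_cost I i * real (x i))"
        using B[OF j] by (intro sum_mono mult_right_mono) auto
      finally show ?thesis using False by simp
    qed
    have "F p \<le> F \<pi>" using p(2) \<pi>(1) .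
    also have "\<dots> \<le> \<pi> * budget I + (\<Sum>j=1..num_parts I. (\<Sum>i\<in>part_items I j. first_cost I i * real (x i)) +
        (if j \<in> open_parts I x then level j \<pi> else 0))"
      unfolding F by (intro add_left_mono sum_mono part)
    also have "\<dots> = (\<Sum>i=1..num_items I. first_cost I i * real (x i)) + \<pi> * budget I +
        (\<Sum>j\<in>open_parts I x. level j \<pi>)"
      unfolding sum_parts[OF valid] by (simp add: sum.distrib sum.If_cases open_parts_def Int_def)
    finally show ?thesis using \<pi>(2) by simp
  qed
  have "robust_cost I ?x \<le> (\<Sum>i=1..num_items I. first_cost I i * real (?x i)) + p * budget I +
      (\<Sum>j\<in>open_parts I ?x. level j p)" by (rule robust_cost_le[OF x p(1)])
  also have "(\<Sum>i=1..num_items I. first_cost I i * real (?x i)) = (\<Sum>j\<in>J. first_cost I (A j))"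
    by (rule sum_choose_items_all[OF valid J(1) AJ])
  also have "\<dots> = (\<Sum>j\<in>J. min (B j) (level j p))"
  proof (rule sum.cong[OF refl])
    fix j assume "j \<in> J"
    then show "first_cost I (A j) = min (B j) (level j p)" using A[of j] J(1,2) by (auto simp: min_def)
  qed
  also have "(\<Sum>j\<in>open_parts I ?x. level j p) = (\<Sum>j\<in>{1..num_parts I} - J. min (B j) (level j p))"
    unfolding opened using J(3) by (intro sum.cong) auto
  also have "(\<Sum>j\<in>J. min (B j) (level j p)) + p * budget I + (\<Sum>j\<in>{1..num_parts I} - J. min (B j) (level j p)) = F p"
    unfolding F using sum.subset_diff[OF J(1), of "\<lambda>j. min (B j) (level j p)"] by simp
  finally have eq: "robust_cost I ?x = F p" using ge[OF x] by simp
  have "optimal_value I = F p" unfolding optimal_value_def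
  proof (rule Min_eqI)
    show "finite (robust_cost I ` first_stage I)" by (simp add: finite_first_stage)
    show "F p \<in> robust_cost I ` first_stage I" using eq x by (metis imageI)
  qed (use ge in auto)
  with eq show "robust_cost I ?x = optimal_value I" "optimal_value I = F p" by simp_all
qed

end


section \<open>The algorithm\<close>

text \<open>Merging preserves multisets; starting from an injective enumeration, this makes the
  sorted order a bijection.\<close>

lemma bij_betw_if_mset_map_eq:
  fixes P Q :: "nat \<Rightarrow> 'a"
  assumes eq: "mset (map P [0..<N]) = mset (map Q [0..<N])" and inj: "inj_on Q {..<N}"
  shows "bij_betw P {..<N} (Q ` {..<N})"
proof -
  have "distinct (map Q [0..<N])" using inj by (simp add: distinct_map atLeast0LessThan)
  then have "distinct (map P [0..<N])" using mset_eq_imp_distinct_iff[OF eq] by simp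
  then have "inj_on P {..<N}" by (simp add: distinct_map atLeast0LessThan)
  moreover have "set (map P [0..<N]) = set (map Q [0..<N])" using eq by (rule mset_eq_setD)
  then have "P ` {..<N} = Q ` {..<N}" by (simp add: atLeast0LessThan)
  ultimately show ?thesis by (simp add: bij_betw_def)
qed

section \<open>Highest level and cheapest first-stage item of each part\<close>

definition minima_inv :: "(nat \<Rightarrow> nat) \<Rightarrow> (nat \<Rightarrow> real) \<Rightarrow> (nat \<Rightarrow> real) \<Rightarrow> nat \<Rightarrow>
    (nat \<Rightarrow> nat) \<Rightarrow> (nat \<Rightarrow> real) \<Rightarrow> (nat \<Rightarrow> real) \<Rightarrow> bool" where
  "minima_inv T C u k A B V \<longleftrightarrow>
     (\<forall>i\<in>{1..k}. V (T i) \<le> u i \<and> B (T i) \<le> C i \<and> A (T i) \<noteq> 0) \<and>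
     (\<forall>j. A j \<noteq> 0 \<longrightarrow> A j \<in> {1..k} \<and> T (A j) = j \<and> B j = C (A j) \<and> (\<exists>i\<in>{1..k}. T i = j \<and> V j = u i))"

lemma minima_inv_init: "minima_inv T C u 0 (\<lambda>_. 0) B V"
  by (simp add: minima_inv_def)

text \<open>Items are numbered from 1, so \<open>A j = 0\<close> marks a part not met so far; its
  entries in \<open>B\<close> and \<open>V\<close> are arbitrary and get overwritten without
  comparison.\<close>

lemma minima_inv_step:
  assumes inv: "minima_inv T C u k A B V"
    and A': "A' = (if A (T (Suc k)) \<noteq> 0 \<and> \<not> C (Suc k) < B (T (Suc k)) then A else A(T (Suc k) := Suc k))"
    and B': "B' = (if A (T (Suc k)) \<noteq> 0 \<and> \<not> C (Suc k) < B (T (Suc k)) then B else B(T (Suc k) := C (Suc k)))"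
    and V': "V' = (if A (T (Suc k)) \<noteq> 0 \<and> \<not> u (Suc k) < V (T (Suc k)) then V else V(T (Suc k) := u (Suc k)))"
  shows "minima_inv T C u (Suc k) A' B' V'"
proof -
  let ?i = "Suc k" and ?j = "T (Suc k)"
  have I1: "V (T i) \<le> u i" "B (T i) \<le> C i" "A (T i) \<noteq> 0" if "i \<in> {1..k}" for i
    using inv that unfolding minima_inv_def by blast+
  have I2: "A j \<in> {1..k}" "T (A j) = j" "B j = C (A j)" "\<exists>i\<in>{1..k}. T i = j \<and> V j = u i" if "A j \<noteq> 0" for j
    using inv that unfolding minima_inv_def by blast+
  have "V' (T i) \<le> u i \<and> B' (T i) \<le> C i \<and> A' (T i) \<noteq> 0" if "i \<in> {1..Suc k}" for i
  proof (cases "i = ?i")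
    case True
    then show ?thesis by (auto simp: A' B' V')
  next
    case False
    then have "i \<in> {1..k}" using that by auto
    from I1[OF this] show ?thesis by (auto simp: A' B' V')
  qed
  moreover have "A' j \<in> {1..?i} \<and> T (A' j) = j \<and> B' j = C (A' j) \<and> (\<exists>i\<in>{1..?i}. T i = j \<and> V' j = u i)"
    if "A' j \<noteq> 0" for j
  proof (cases "j = ?j")
    case True
    show ?thesis
    proof (cases "A ?j = 0")
      case True
      with \<open>j = ?j\<close> show ?thesis by (auto simp: A' B' V')
    next
      case False
      from I2[OF this] \<open>j = ?j\<close> show ?thesis by (auto simp: A' B' V' intro: bexI[of _ ?i])
    qed
  next
    case False
    then have "A' j = A j" "B' j = B j" "V' j = V j" by (auto simp: A' B' V')
    with that I2[of j] show ?thesis by auto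
  qed
  ultimately show ?thesis unfolding minima_inv_def by blast
qed

definition minima_step :: com where
  "minima_step =
     Seq (NAssign ''i'' (NAdd (NVar ''k'') (NConst 1)))
     (Seq (NAssign ''j'' (NArr ''T'' (NVar ''i'')))
     (Seq (Cond (BAnd (BNot (NEq (NArr ''A'' (NVar ''j'')) (NConst 0)))
                  (BNot (RLess (RAdd (RArr ''c'' (NVar ''i'')) (RArr ''d'' (NVar ''i''))) (RArr ''V'' (NVar ''j'')))))
            Skip
            (RStore ''V'' (NVar ''j'') (RAdd (RArr ''c'' (NVar ''i'')) (RArr ''d'' (NVar ''i'')))))
     (Seq (Cond (BAnd (BNot (NEq (NArr ''A'' (NVar ''j'')) (NConst 0)))
                  (BNot (RLess (RArr ''C'' (NVar ''i'')) (RArr ''B'' (NVar ''j'')))))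
            Skip
            (Seq (RStore ''B'' (NVar ''j'') (RArr ''C'' (NVar ''i''))) (NStore ''A'' (NVar ''j'') (NVar ''i''))))
     (Seq (NStore ''P'' (NVar ''k'') (NVar ''i''))
          (RStore ''key'' (NVar ''i'') (RArr ''c'' (NVar ''i'')))))))"

lemma writes_minima_step: "writes minima_step = {''i'', ''j'', ''V'', ''B'', ''A'', ''P'', ''key''}"
  unfolding minima_step_def by auto

lemma wp_minima:
  assumes "narr s ''A'' = (\<lambda>_. 0)"
  shows "wp (for_loop ''k'' ''n'' minima_step) (\<lambda>t s'. t \<le> 6 + nvar s ''n'' * 108 \<and>
    minima_inv (narr s ''T'') (rarr s ''C'') (\<lambda>i. rarr s ''c'' i + rarr s ''d'' i) (nvar s ''n'')
      (narr s' ''A'') (rarr s' ''B'') (rarr s' ''V'') \<and>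
    (\<forall>a<nvar s ''n''. narr s' ''P'' a = Suc a \<and> rarr s' ''key'' (Suc a) = rarr s ''c'' (Suc a)) \<and>
    same_except (insert ''k'' (writes minima_step)) s s') s"
proof -
  let ?T = "narr s ''T''" and ?C = "rarr s ''C''" and ?u = "\<lambda>i. rarr s ''c'' i + rarr s ''d'' i"
  let ?I = "\<lambda>k s'. minima_inv ?T ?C ?u k (narr s' ''A'') (rarr s' ''B'') (rarr s' ''V'') \<and>
    (\<forall>a<k. narr s' ''P'' a = Suc a \<and> rarr s' ''key'' (Suc a) = rarr s ''c'' (Suc a))"
  have "wp (for_loop ''k'' ''n'' minima_step) (\<lambda>t s'. t \<le> 6 + nvar s ''n'' * (100 + 8) \<and>
    ?I (nvar s ''n'') s' \<and> same_except (insert ''k'' (writes minima_step)) s s') s"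
  proof (rule wp_for_loop[where I = ?I])
    show "?I 0 (s\<lparr>nvar := (nvar s)(''k'' := 0)\<rparr>)" using assms by (simp add: minima_inv_init)
    fix k s' assume k: "k < nvar s ''n''" "nvar s' ''k'' = k"
      and same: "same_except (insert ''k'' (writes minima_step)) s s'" and I: "?I k s'"
    have eq: "narr s' ''T'' = ?T" "rarr s' ''C'' = ?C" "rarr s' ''c'' = rarr s ''c''" "rarr s' ''d'' = rarr s ''d''"
      using same_exceptD[OF same] by (simp_all add: writes_minima_step)
    have step: "minima_inv ?T ?C ?u k (narr s' ''A'') (rarr s' ''B'') (rarr s' ''V'')" using I by blast
    show "wp minima_step (\<lambda>t s''. t \<le> 100 \<and> ?I (Suc k) (s''\<lparr>nvar := (nvar s'')(''k'' := Suc k)\<rparr>)) s'"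
      using I by (auto simp: minima_step_def eq k(2) less_Suc_eq intro!: minima_inv_step[OF step])
  qed (auto simp: writes_minima_step)
  then show ?thesis by (rule wp_mono) simp
qed

section \<open>Interval lengths by a descending scan\<close>

definition intervals_inv :: "(nat \<Rightarrow> nat) \<Rightarrow> (nat \<Rightarrow> real) \<Rightarrow> (nat \<Rightarrow> real) \<Rightarrow> nat set \<Rightarrow> nat \<Rightarrow> nat \<Rightarrow>
    (nat \<Rightarrow> real) \<Rightarrow> (nat \<Rightarrow> real) \<Rightarrow> bool" where
  "intervals_inv T c V J n k nxt len \<longleftrightarrow>
     (\<forall>j\<in>J. nxt j = V j - (\<Sum>q\<in>{k..<n}. if T q = j then len q else 0)) \<and>
     (\<forall>p\<in>{k..<n}. (\<Sum>q\<in>{p..<n}. if T q = T p then len q else 0) = V (T p) - min (c p) (V (T p)))"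

text \<open>\<open>nxt j\<close> is the left end of the interval cut last from part
  \<open>j\<close>. Expressing it as \<open>V j\<close> minus the lengths found so far makes the
  required tail sum at \<open>p\<close> immediate.\<close>

lemma intervals_inv_step:
  assumes inv: "intervals_inv T c V J n (Suc p) nxt len" and p: "p < n" "T p \<in> J"
  shows "intervals_inv T c V J n p (nxt(T p := min (c p) (V (T p))))
    (len(p := nxt (T p) - min (c p) (V (T p))))"
proof -
  let ?len = "len(p := nxt (T p) - min (c p) (V (T p)))"
  have later: "(\<Sum>q\<in>{r..<n}. if T q = j then ?len q else 0) = (\<Sum>q\<in>{r..<n}. if T q = j then len q else 0)"
    if "p < r" for r j using that by (intro sum.cong) auto
  have now: "(\<Sum>q\<in>{p..<n}. if T q = j then ?len q else 0) = (if T p = j then ?len p else 0) +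
      (\<Sum>q\<in>{Suc p..<n}. if T q = j then len q else 0)" for j
    using p(1) later[of "Suc p" j] by (simp add: sum.atLeast_Suc_lessThan)
  have nxt: "nxt j = V j - (\<Sum>q\<in>{Suc p..<n}. if T q = j then len q else 0)" if "j \<in> J" for j
    using inv that unfolding intervals_inv_def by blast
  show ?thesis
    unfolding intervals_inv_def
  proof (intro conjI ballI)
    fix j assume "j \<in> J"
    then show "(nxt(T p := min (c p) (V (T p)))) j = V j - (\<Sum>q\<in>{p..<n}. if T q = j then ?len q else 0)"
      using nxt[of j] unfolding now by auto
  next
    fix r assume "r \<in> {p..<n}"
    then consider "r = p" | "r \<in> {Suc p..<n}" by fastforce
    then show "(\<Sum>q\<in>{r..<n}. if T q = T r then ?len q else 0) = V (T r) - min (c r) (V (T r))"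
    proof cases
      case 1
      then show ?thesis using nxt[OF p(2)] unfolding 1 now by simp
    next
      case 2
      then show ?thesis using inv later[of r "T r"] unfolding intervals_inv_def by auto
    qed
  qed
qed

text \<open>\<open>for_loop\<close> only counts upwards, so the position is
  \<open>n - 1 - k\<close>; the subtraction is never truncated because \<open>k < n\<close>.\<close>

definition intervals_step :: com where
  "intervals_step =
     Seq (NAssign ''p'' (NSub (NSub (NVar ''n'') (NConst 1)) (NVar ''k'')))
     (Seq (NAssign ''i'' (NArr ''P'' (NVar ''p'')))
     (Seq (NAssign ''j'' (NArr ''T'' (NVar ''i'')))
     (Seq (RAssign ''l'' (RArr ''c'' (NVar ''i'')))
     (Seq (Cond (RLess (RArr ''V'' (NVar ''j'')) (RVar ''l'')) (RAssign ''l'' (RArr ''V'' (NVar ''j''))) Skip)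
     (Seq (RStore ''len'' (NVar ''p'') (RSub (RArr ''nxt'' (NVar ''j'')) (RVar ''l'')))
          (RStore ''nxt'' (NVar ''j'') (RVar ''l'')))))))"

lemma writes_intervals_step: "writes intervals_step = {''p'', ''i'', ''j'', ''l'', ''len'', ''nxt''}"
  unfolding intervals_step_def by auto

lemma wp_intervals:
  fixes s defines "T \<equiv> \<lambda>p. narr s ''T'' (narr s ''P'' p)"
  assumes T: "\<And>p. p < nvar s ''n'' \<Longrightarrow> T p \<in> J" and nxt: "\<And>j. j \<in> J \<Longrightarrow> rarr s ''nxt'' j = rarr s ''V'' j"
  shows "wp (for_loop ''k'' ''n'' intervals_step) (\<lambda>t s'. t \<le> 6 + nvar s ''n'' * 108 \<and>
    intervals_inv T (\<lambda>p. rarr s ''c'' (narr s ''P'' p)) (rarr s ''V'') J (nvar s ''n'') 0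
      (rarr s' ''nxt'') (rarr s' ''len'') \<and>
    same_except (insert ''k'' (writes intervals_step)) s s') s"
proof -
  let ?n = "nvar s ''n''" and ?V = "rarr s ''V''" and ?c = "\<lambda>p. rarr s ''c'' (narr s ''P'' p)"
  let ?I = "\<lambda>k s'. intervals_inv T ?c ?V J ?n (?n - k) (rarr s' ''nxt'') (rarr s' ''len'')"
  have "wp (for_loop ''k'' ''n'' intervals_step) (\<lambda>t s'. t \<le> 6 + nvar s ''n'' * (100 + 8) \<and>
    ?I (nvar s ''n'') s' \<and> same_except (insert ''k'' (writes intervals_step)) s s') s"
  proof (rule wp_for_loop[where I = ?I])
    show "?I 0 (s\<lparr>nvar := (nvar s)(''k'' := 0)\<rparr>)" using nxt by (simp add: intervals_inv_def)
    fix k s' assume k: "k < ?n" "nvar s' ''k'' = k"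
      and same: "same_except (insert ''k'' (writes intervals_step)) s s'" and I: "?I k s'"
    have eq: "narr s' ''T'' = narr s ''T''" "narr s' ''P'' = narr s ''P''" "rarr s' ''c'' = rarr s ''c''"
        "rarr s' ''V'' = ?V" "nvar s' ''n'' = ?n"
      using same_exceptD[OF same] by (simp_all add: writes_intervals_step)
    define p where "p = ?n - Suc k"
    have p: "p < ?n" "?n - k = Suc p" "?n - Suc k = p" using k by (auto simp: p_def)
    have "intervals_inv T ?c ?V J ?n p ((rarr s' ''nxt'')(T p := min (?c p) (?V (T p))))
        ((rarr s' ''len'')(p := rarr s' ''nxt'' (T p) - min (?c p) (?V (T p))))"
      using I unfolding p(2) by (rule intervals_inv_step) (intro p(1) T)+
    then show "wp intervals_step (\<lambda>t s''. t \<le> 100 \<and> ?I (Suc k) (s''\<lparr>nvar := (nvar s'')(''k'' := Suc k)\<rparr>)) s'"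
      by (auto simp: intervals_step_def eq k(2) p(3) T_def min_def)
  qed (auto simp: writes_intervals_step)
  then show ?thesis by (rule wp_mono) simp
qed


text \<open>
  Blocks rewriting below the postcondition, so that the simplifier executes programs forwards.
\<close>

lemma wp_cong: "s = s' \<Longrightarrow> wp P Q s = wp P Q s'"
  by simp

section \<open>Thresholds as running maxima\<close>

definition part_sum :: "(nat \<Rightarrow> nat) \<Rightarrow> (nat \<Rightarrow> real) \<Rightarrow> nat \<Rightarrow> nat \<Rightarrow> real" where
  "part_sum T f j k = (\<Sum>q<k. if T q = j then f q else 0)"

lemma part_sum_simps [simp]:
  "part_sum T f j 0 = 0"
  "part_sum T f j (Suc k) = part_sum T f j k + (if T k = j then f k else 0)"
  by (simp_all add: part_sum_def)

lemma part_sum_eq: "part_sum T f j k = (\<Sum>q\<in>{q. q < k \<and> T q = j}. f q)"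
  unfolding part_sum_def using sum.inter_filter[of "{..<k}" f "\<lambda>q. T q = j"] by simp

definition cum_slope :: "(nat \<Rightarrow> nat) \<Rightarrow> (nat \<Rightarrow> real) \<Rightarrow> nat \<Rightarrow> real" where
  "cum_slope T d p = part_sum T (\<lambda>q. 1 / d q) (T p) (Suc p)"

text \<open>The multiplier at which the affine function of the prefix ending at \<open>p\<close>
  takes the value \<open>B (T p)\<close>.\<close>

definition crossing :: "(nat \<Rightarrow> nat) \<Rightarrow> (nat \<Rightarrow> real) \<Rightarrow> (nat \<Rightarrow> real) \<Rightarrow> (nat \<Rightarrow> real) \<Rightarrow>
    (nat \<Rightarrow> real) \<Rightarrow> nat \<Rightarrow> real" where
  "crossing T d len low B p = (low (T p) + part_sum T len (T p) (Suc p) - B (T p)) /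
     part_sum T (\<lambda>q. len q * cum_slope T d q) (T p) (Suc p)"

definition thresholds_inv :: "(nat \<Rightarrow> nat) \<Rightarrow> (nat \<Rightarrow> real) \<Rightarrow> (nat \<Rightarrow> real) \<Rightarrow> (nat \<Rightarrow> real) \<Rightarrow>
    (nat \<Rightarrow> real) \<Rightarrow> nat \<Rightarrow> (nat \<Rightarrow> real) \<Rightarrow> (nat \<Rightarrow> real) \<Rightarrow> (nat \<Rightarrow> real) \<Rightarrow> (nat \<Rightarrow> real) \<Rightarrow>
    (nat \<Rightarrow> real) \<Rightarrow> bool" where
  "thresholds_inv T d len low B k slope sig g lev ps \<longleftrightarrow>
     (\<forall>j. sig j = part_sum T (\<lambda>q. 1 / d q) j k \<and> lev j = part_sum T len j k \<and>
          g j = part_sum T (\<lambda>q. len q * cum_slope T d q) j k \<and> 0 \<le> ps j \<and>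
          (ps j = 0 \<or> (\<exists>p<k. T p = j \<and> ps j = crossing T d len low B p))) \<and>
     (\<forall>p<k. slope p = cum_slope T d p \<and> crossing T d len low B p \<le> ps (T p))"

lemma thresholds_inv_init:
  "thresholds_inv T d len low B 0 slope (\<lambda>_. 0) (\<lambda>_. 0) (\<lambda>_. 0) (\<lambda>_. 0)"
  by (simp add: thresholds_inv_def)

text \<open>The scan is global but its accumulators are indexed by part, so position
  \<open>k\<close> touches only the entry \<open>T k\<close>. Since \<open>ps\<close> starts at 0,
  it holds the maximum of 0 and the crossings seen so far.\<close>

lemma thresholds_inv_step:
  assumes inv: "thresholds_inv T d len low B k slope sig g lev ps"
    and s': "s' = sig (T k) + 1 / d k" and g': "g' = g (T k) + len k * s'" and l': "l' = lev (T k) + len k"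
    and r: "r = (low (T k) + l' - B (T k)) / g'"
  shows "thresholds_inv T d len low B (Suc k) (slope(k := s')) (sig(T k := s')) (g(T k := g'))
    (lev(T k := l')) (if ps (T k) < r then ps(T k := r) else ps)"
proof -
  have I: "sig j = part_sum T (\<lambda>q. 1 / d q) j k" "lev j = part_sum T len j k"
      "g j = part_sum T (\<lambda>q. len q * cum_slope T d q) j k" "0 \<le> ps j"
      "ps j = 0 \<or> (\<exists>p<k. T p = j \<and> ps j = crossing T d len low B p)" for j
    using inv unfolding thresholds_inv_def by blast+
  have I2: "slope p = cum_slope T d p" "crossing T d len low B p \<le> ps (T p)" if "p < k" for p
    using inv that unfolding thresholds_inv_def by blast+
  have s: "s' = cum_slope T d k" unfolding s' I(1) cum_slope_def by simp
  have r_eq: "r = crossing T d len low B k"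
    unfolding r crossing_def g' l' I(2,3) s by simp
  let ?ps = "if ps (T k) < r then ps(T k := r) else ps"
  have ps_ge: "ps j \<le> ?ps j" for j by auto
  have "0 \<le> ?ps j \<and> (?ps j = 0 \<or> (\<exists>p<Suc k. T p = j \<and> ?ps j = crossing T d len low B p))" for j
  proof (cases "ps (T k) < r \<and> j = T k")
    case True
    moreover have "0 \<le> r" using True I(4)[of "T k"] by simp
    ultimately show ?thesis using r_eq by auto
  next
    case False
    then have "?ps j = ps j" by auto
    then show ?thesis using I(4)[of j] I(5)[of j] less_SucI by metis
  qed
  moreover have "crossing T d len low B p \<le> ?ps (T p)" if "p < Suc k" for p
  proof (cases "p = k")
    case True
    then show ?thesis using r_eq by auto
  next
    case False
    then show ?thesis using I2(2)[of p] ps_ge[of "T p"] that by linarith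
  qed
  moreover have "(slope(k := s')) p = cum_slope T d p" if "p < Suc k" for p
    using that I2(1)[of p] s by (cases "p = k") auto
  moreover have "(sig(T k := s')) j = part_sum T (\<lambda>q. 1 / d q) j (Suc k)" for j
    using I(1) s' by simp
  moreover have "(lev(T k := l')) j = part_sum T len j (Suc k)" for j
    using I(2) l' by simp
  moreover have "(g(T k := g')) j = part_sum T (\<lambda>q. len q * cum_slope T d q) j (Suc k)" for j
    using I(3) g' s by simp
  ultimately show ?thesis unfolding thresholds_inv_def by blast
qed

definition thresholds_step :: com where
  "thresholds_step =
     Seq (NAssign ''i'' (NArr ''P'' (NVar ''k'')))
     (Seq (NAssign ''j'' (NArr ''T'' (NVar ''i'')))
     (Seq (RStore ''sig'' (NVar ''j'') (RAdd (RArr ''sig'' (NVar ''j'')) (RDiv (RConst 1) (RArr ''d'' (NVar ''i'')))))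
     (Seq (RStore ''slope'' (NVar ''k'') (RArr ''sig'' (NVar ''j'')))
     (Seq (RStore ''g'' (NVar ''j'') (RAdd (RArr ''g'' (NVar ''j''))
            (RMul (RArr ''len'' (NVar ''k'')) (RArr ''sig'' (NVar ''j'')))))
     (Seq (RStore ''lev'' (NVar ''j'') (RAdd (RArr ''lev'' (NVar ''j'')) (RArr ''len'' (NVar ''k''))))
     (Seq (RAssign ''r'' (RDiv (RSub (RAdd (RArr ''nxt'' (NVar ''j'')) (RArr ''lev'' (NVar ''j'')))
            (RArr ''B'' (NVar ''j''))) (RArr ''g'' (NVar ''j''))))
          (Cond (RLess (RArr ''ps'' (NVar ''j'')) (RVar ''r'')) (RStore ''ps'' (NVar ''j'') (RVar ''r'')) Skip)))))))"

lemma writes_thresholds_step: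
  "writes thresholds_step = {''i'', ''j'', ''sig'', ''slope'', ''g'', ''lev'', ''r'', ''ps''}"
  unfolding thresholds_step_def by auto

lemma wp_thresholds:
  fixes s defines "T \<equiv> \<lambda>p. narr s ''T'' (narr s ''P'' p)" and "d \<equiv> \<lambda>p. rarr s ''d'' (narr s ''P'' p)"
  assumes "rarr s ''sig'' = (\<lambda>_. 0)" "rarr s ''g'' = (\<lambda>_. 0)" "rarr s ''lev'' = (\<lambda>_. 0)" "rarr s ''ps'' = (\<lambda>_. 0)"
  shows "wp (for_loop ''k'' ''n'' thresholds_step) (\<lambda>t s'. t \<le> 6 + nvar s ''n'' * 108 \<and>
    thresholds_inv T d (rarr s ''len'') (rarr s ''nxt'') (rarr s ''B'') (nvar s ''n'')
      (rarr s' ''slope'') (rarr s' ''sig'') (rarr s' ''g'') (rarr s' ''lev'') (rarr s' ''ps'') \<and>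
    same_except (insert ''k'' (writes thresholds_step)) s s') s"
proof -
  let ?n = "nvar s ''n''"
  let ?I = "\<lambda>k s'. thresholds_inv T d (rarr s ''len'') (rarr s ''nxt'') (rarr s ''B'') k
      (rarr s' ''slope'') (rarr s' ''sig'') (rarr s' ''g'') (rarr s' ''lev'') (rarr s' ''ps'')"
  have "wp (for_loop ''k'' ''n'' thresholds_step) (\<lambda>t s'. t \<le> 6 + nvar s ''n'' * (100 + 8) \<and>
    ?I (nvar s ''n'') s' \<and> same_except (insert ''k'' (writes thresholds_step)) s s') s"
  proof (rule wp_for_loop[where I = ?I])
    show "?I 0 (s\<lparr>nvar := (nvar s)(''k'' := 0)\<rparr>)" using assms by (simp add: thresholds_inv_init)
    fix k s' assume k: "k < ?n" "nvar s' ''k'' = k"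
      and same: "same_except (insert ''k'' (writes thresholds_step)) s s'" and I: "?I k s'"
    have eq: "narr s' ''T'' = narr s ''T''" "narr s' ''P'' = narr s ''P''" "rarr s' ''d'' = rarr s ''d''"
        "rarr s' ''len'' = rarr s ''len''" "rarr s' ''nxt'' = rarr s ''nxt''" "rarr s' ''B'' = rarr s ''B''"
      using same_exceptD[OF same] by (simp_all add: writes_thresholds_step)
    show "wp thresholds_step (\<lambda>t s''. t \<le> 100 \<and> ?I (Suc k) (s''\<lparr>nvar := (nvar s'')(''k'' := Suc k)\<rparr>)) s'"
      using thresholds_inv_step[OF I refl refl refl refl] unfolding T_def d_def thresholds_step_def
      by (simp add: eq k(2) cong: wp_cong split: if_split_asm)
  qed (auto simp: writes_thresholds_step)
  then show ?thesis by (rule wp_mono) simp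
qed

section \<open>Remaining scans: start values, constant term and hinges\<close>

definition start_levels_step :: com where
  "start_levels_step =
     RStore ''nxt'' (NAdd (NVar ''k'') (NConst 1)) (RArr ''V'' (NAdd (NVar ''k'') (NConst 1)))"

lemma wp_start_levels:
  "wp (for_loop ''k'' ''m'' start_levels_step) (\<lambda>t s'. t \<le> 6 + nvar s ''m'' * 108 \<and>
    (\<forall>j\<in>{1..nvar s ''m''}. rarr s' ''nxt'' j = rarr s ''V'' j) \<and> same_except {''k'', ''nxt''} s s') s"
proof -
  let ?I = "\<lambda>k s'. \<forall>j\<in>{1..k}. rarr s' ''nxt'' j = rarr s ''V'' j"
  have "wp (for_loop ''k'' ''m'' start_levels_step) (\<lambda>t s'. t \<le> 6 + nvar s ''m'' * (100 + 8) \<and>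
    ?I (nvar s ''m'') s' \<and> same_except (insert ''k'' (writes start_levels_step)) s s') s"
    by (rule wp_for_loop[where I = ?I])
       (auto simp: start_levels_step_def atLeastAtMostSuc_conv same_exceptD)
  then show ?thesis by (rule wp_mono) (simp add: start_levels_step_def)
qed

definition constant_step :: com where
  "constant_step =
     Seq (NAssign ''j'' (NAdd (NVar ''k'') (NConst 1)))
       (Cond (RLess (RArr ''B'' (NVar ''j'')) (RArr ''nxt'' (NVar ''j'')))
         (RAssign ''a'' (RAdd (RVar ''a'') (RArr ''B'' (NVar ''j''))))
         (RAssign ''a'' (RAdd (RVar ''a'') (RArr ''nxt'' (NVar ''j'')))))"

lemma wp_constant:
  assumes "rvar s ''a'' = 0"
  shows "wp (for_loop ''k'' ''m'' constant_step) (\<lambda>t s'. t \<le> 6 + nvar s ''m'' * 108 \<and>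
    rvar s' ''a'' = (\<Sum>j=1..nvar s ''m''. min (rarr s ''B'' j) (rarr s ''nxt'' j)) \<and>
    same_except {''k'', ''j'', ''a''} s s') s"
proof -
  let ?I = "\<lambda>k s'. rvar s' ''a'' = (\<Sum>j=1..k. min (rarr s ''B'' j) (rarr s ''nxt'' j))"
  have "wp (for_loop ''k'' ''m'' constant_step) (\<lambda>t s'. t \<le> 6 + nvar s ''m'' * (100 + 8) \<and>
    ?I (nvar s ''m'') s' \<and> same_except (insert ''k'' (writes constant_step)) s s') s"
    by (rule wp_for_loop[where I = ?I]) (auto simp: constant_step_def same_exceptD assms)
  then show ?thesis by (rule wp_mono) (simp add: constant_step_def insert_commute)
qed

text \<open>
  Position \<open>k\<close> contributes the hinges \<open>key k\<close> and \<open>key (n + k)\<close>, whose difference is the hinge of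
  its interval cut off at the threshold of its part.
\<close>

definition hinges_step :: com where
  "hinges_step =
     Seq (NAssign ''i'' (NArr ''P'' (NVar ''k'')))
     (Seq (NAssign ''j'' (NArr ''T'' (NVar ''i'')))
     (Seq (RAssign ''wt'' (RMul (RArr ''len'' (NVar ''k'')) (RArr ''slope'' (NVar ''k''))))
     (Seq (Cond (RLess (RArr ''nxt'' (NVar ''j'')) (RArr ''B'' (NVar ''j''))) Skip (RAssign ''wt'' (RConst 0)))
     (Seq (RAssign ''q'' (RDiv (RConst 1) (RArr ''slope'' (NVar ''k''))))
     (Seq (RStore ''key'' (NVar ''k'') (RVar ''q''))
     (Seq (RStore ''hw'' (NVar ''k'') (RVar ''wt''))
     (Seq (Cond (RLess (RArr ''ps'' (NVar ''j'')) (RVar ''q'')) (RAssign ''q'' (RArr ''ps'' (NVar ''j''))) Skip)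
     (Seq (RStore ''key'' (NAdd (NVar ''n'') (NVar ''k'')) (RVar ''q''))
          (RStore ''hw'' (NAdd (NVar ''n'') (NVar ''k'')) (RSub (RConst 0) (RVar ''wt'')))))))))))"

lemma writes_hinges_step: "writes hinges_step = {''i'', ''j'', ''wt'', ''q'', ''key'', ''hw''}"
  unfolding hinges_step_def by auto

lemma wp_hinges:
  fixes s defines "T \<equiv> \<lambda>p. narr s ''T'' (narr s ''P'' p)" and "n \<equiv> nvar s ''n''"
  shows "wp (for_loop ''k'' ''n'' hinges_step) (\<lambda>t s'. t \<le> 6 + nvar s ''n'' * 108 \<and>
    (\<forall>p<n. rarr s' ''key'' p = 1 / rarr s ''slope'' p \<and>
       rarr s' ''key'' (n + p) = min (1 / rarr s ''slope'' p) (rarr s ''ps'' (T p)) \<and>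
       rarr s' ''hw'' p = (if rarr s ''nxt'' (T p) < rarr s ''B'' (T p) then rarr s ''len'' p * rarr s ''slope'' p else 0) \<and>
       rarr s' ''hw'' (n + p) = - rarr s' ''hw'' p) \<and>
    same_except (insert ''k'' (writes hinges_step)) s s') s"
proof -
  let ?I = "\<lambda>k s'. \<forall>p<k. rarr s' ''key'' p = 1 / rarr s ''slope'' p \<and>
       rarr s' ''key'' (n + p) = min (1 / rarr s ''slope'' p) (rarr s ''ps'' (T p)) \<and>
       rarr s' ''hw'' p = (if rarr s ''nxt'' (T p) < rarr s ''B'' (T p) then rarr s ''len'' p * rarr s ''slope'' p else 0) \<and>
       rarr s' ''hw'' (n + p) = - rarr s' ''hw'' p"
  have "wp (for_loop ''k'' ''n'' hinges_step) (\<lambda>t s'. t \<le> 6 + nvar s ''n'' * (100 + 8) \<and>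
    ?I (nvar s ''n'') s' \<and> same_except (insert ''k'' (writes hinges_step)) s s') s"
  proof (rule wp_for_loop[where I = ?I])
    fix k s' assume k: "k < nvar s ''n''" "nvar s' ''k'' = k"
      and same: "same_except (insert ''k'' (writes hinges_step)) s s'" and I: "?I k s'"
    have eq: "narr s' ''T'' = narr s ''T''" "narr s' ''P'' = narr s ''P''" "rarr s' ''slope'' = rarr s ''slope''"
        "rarr s' ''len'' = rarr s ''len''" "rarr s' ''nxt'' = rarr s ''nxt''" "rarr s' ''B'' = rarr s ''B''"
        "rarr s' ''ps'' = rarr s ''ps''" "nvar s' ''n'' = n"
      using same_exceptD[OF same] by (simp_all add: writes_hinges_step n_def)
    show "wp hinges_step (\<lambda>t s''. t \<le> 100 \<and> ?I (Suc k) (s''\<lparr>nvar := (nvar s'')(''k'' := Suc k)\<rparr>)) s'"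
      using I k unfolding hinges_step_def by (auto simp: eq T_def less_Suc_eq n_def[symmetric] min_def cong: wp_cong)
  qed (auto simp: writes_hinges_step)
  then show ?thesis unfolding n_def by (rule wp_mono) simp
qed

section \<open>Sweep over the sorted knots\<close>

definition totals_step :: com where
  "totals_step =
     Seq (NStore ''P'' (NVar ''k'') (NVar ''k''))
     (Seq (RAssign ''W'' (RAdd (RVar ''W'') (RArr ''hw'' (NVar ''k''))))
          (RAssign ''S'' (RAdd (RVar ''S'') (RMul (RArr ''hw'' (NVar ''k'')) (RArr ''key'' (NVar ''k''))))))"

lemma wp_totals:
  assumes "rvar s ''W'' = 0" "rvar s ''S'' = 0"
  shows "wp (for_loop ''k'' ''N'' totals_step) (\<lambda>t s'. t \<le> 6 + nvar s ''N'' * 108 \<and>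
    (\<forall>p<nvar s ''N''. narr s' ''P'' p = p) \<and> rvar s' ''W'' = (\<Sum>p<nvar s ''N''. rarr s ''hw'' p) \<and>
    rvar s' ''S'' = (\<Sum>p<nvar s ''N''. rarr s ''hw'' p * rarr s ''key'' p) \<and>
    same_except {''k'', ''P'', ''W'', ''S''} s s') s"
proof -
  let ?I = "\<lambda>k s'. (\<forall>p<k. narr s' ''P'' p = p) \<and> rvar s' ''W'' = (\<Sum>p<k. rarr s ''hw'' p) \<and>
    rvar s' ''S'' = (\<Sum>p<k. rarr s ''hw'' p * rarr s ''key'' p)"
  have "wp (for_loop ''k'' ''N'' totals_step) (\<lambda>t s'. t \<le> 6 + nvar s ''N'' * (100 + 8) \<and>
    ?I (nvar s ''N'') s' \<and> same_except (insert ''k'' (writes totals_step)) s s') s"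
    by (rule wp_for_loop[where I = ?I]) (auto simp: totals_step_def same_exceptD assms less_Suc_eq)
  then show ?thesis by (rule wp_mono) (simp add: totals_step_def insert_commute)
qed


definition sweep_step :: com where
  "sweep_step =
     Seq (NAssign ''i'' (NArr ''P'' (NVar ''k'')))
     (Seq (RAssign ''q'' (RArr ''key'' (NVar ''i'')))
     (Seq (RAssign ''v'' (RAdd (RAdd (RMul (RVar ''q'') (RVar ''Gamma'')) (RVar ''a''))
            (RSub (RVar ''S'') (RMul (RVar ''W'') (RVar ''q'')))))
     (Seq (Cond (RLess (RVar ''v'') (RVar ''opt''))
            (Seq (RAssign ''opt'' (RVar ''v'')) (RAssign ''pi'' (RVar ''q''))) Skip)
     (Seq (RAssign ''W'' (RSub (RVar ''W'') (RArr ''hw'' (NVar ''i''))))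
          (RAssign ''S'' (RSub (RVar ''S'') (RMul (RArr ''hw'' (NVar ''i'')) (RVar ''q''))))))))"

lemma writes_sweep_step: "writes sweep_step = {''i'', ''q'', ''v'', ''opt'', ''pi'', ''W'', ''S''}"
  unfolding sweep_step_def by auto

lemma hinge_sum_at_knot:
  fixes key hw :: "nat \<Rightarrow> real"
  assumes bij: "bij_betw P {..<N} {..<N}" and sorted: "\<And>a b. a \<le> b \<Longrightarrow> b < N \<Longrightarrow> key (P a) \<le> key (P b)"
    and k: "k < N"
  shows "(\<Sum>p<N. hw p * max 0 (key p - key (P k))) =
    (\<Sum>b\<in>{k..<N}. hw (P b) * key (P b)) - (\<Sum>b\<in>{k..<N}. hw (P b)) * key (P k)"
proof -
  have "(\<Sum>p<N. hw p * max 0 (key p - key (P k))) = (\<Sum>b<N. hw (P b) * max 0 (key (P b) - key (P k)))"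
    using bij by (rule sum.reindex_bij_betw[symmetric])
  also have "\<dots> = (\<Sum>b\<in>{k..<N}. hw (P b) * (key (P b) - key (P k)))"
    using sorted k by (intro sum.mono_neutral_cong_right) (auto simp: not_le max_def intro: antisym)
  also have "\<dots> = (\<Sum>b\<in>{k..<N}. hw (P b) * key (P b)) - (\<Sum>b\<in>{k..<N}. hw (P b)) * key (P k)"
    by (simp add: right_diff_distrib sum_subtractf sum_distrib_right)
  finally show ?thesis .
qed

text \<open>The candidate 0 is evaluated before the loop: the knots are nonnegative, so
  \<open>F 0\<close> is \<open>a + S\<close>. The loop tries every knot, and
  \<open>hinge_sum_ge\<close> extends the comparison to all nonnegative multipliers.\<close>

lemma wp_sweep:
  fixes s defines "N \<equiv> nvar s ''N''" and "P \<equiv> narr s ''P''" and "key \<equiv> rarr s ''key''" and "hw \<equiv> rarr s ''hw''"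
  defines "F \<equiv> \<lambda>\<pi>. \<pi> * rvar s ''Gamma'' + rvar s ''a'' + (\<Sum>p<N. hw p * max 0 (key p - \<pi>))"
  assumes bij: "bij_betw P {..<N} {..<N}" and sorted: "\<And>a b. a \<le> b \<Longrightarrow> b < N \<Longrightarrow> key (P a) \<le> key (P b)"
    and key: "\<And>p. p < N \<Longrightarrow> 0 \<le> key p" and Gamma: "0 \<le> rvar s ''Gamma''"
    and W: "rvar s ''W'' = (\<Sum>p<N. hw p)" and S: "rvar s ''S'' = (\<Sum>p<N. hw p * key p)"
    and opt: "rvar s ''opt'' = rvar s ''a'' + rvar s ''S''" and pi: "rvar s ''pi'' = 0"
  shows "wp (for_loop ''k'' ''N'' sweep_step) (\<lambda>t s'. t \<le> 6 + N * 108 \<and>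
    rvar s' ''opt'' = F (rvar s' ''pi'') \<and> 0 \<le> rvar s' ''pi'' \<and>
    (\<forall>\<pi>\<ge>0. F (rvar s' ''pi'') \<le> F \<pi>) \<and>
    same_except (insert ''k'' (writes sweep_step)) s s') s"
proof -
  let ?I = "\<lambda>k s'. rvar s' ''W'' = (\<Sum>b\<in>{k..<N}. hw (P b)) \<and>
    rvar s' ''S'' = (\<Sum>b\<in>{k..<N}. hw (P b) * key (P b)) \<and>
    rvar s' ''opt'' = F (rvar s' ''pi'') \<and> 0 \<le> rvar s' ''pi'' \<and> rvar s' ''opt'' \<le> F 0 \<and>
    (\<forall>b<k. rvar s' ''opt'' \<le> F (key (P b)))"
  have "wp (for_loop ''k'' ''N'' sweep_step) (\<lambda>t s'. t \<le> 6 + nvar s ''N'' * (100 + 8) \<and>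
    ?I (nvar s ''N'') s' \<and> same_except (insert ''k'' (writes sweep_step)) s s') s"
  proof (rule wp_for_loop[where I = ?I])
    have "F 0 = rvar s ''opt''" unfolding F_def opt S using key by simp
    moreover have "(\<Sum>p<N. u p) = (\<Sum>b\<in>{0..<N}. u (P b))" for u :: "nat \<Rightarrow> real"
      using sum.reindex_bij_betw[OF bij, of u] by (simp add: atLeast0LessThan)
    ultimately show "?I 0 (s\<lparr>nvar := (nvar s)(''k'' := 0)\<rparr>)" using W S pi by simp
    fix k s' assume k: "k < nvar s ''N''" "nvar s' ''k'' = k"
      and same: "same_except (insert ''k'' (writes sweep_step)) s s'" and I: "?I k s'"
    have eq: "narr s' ''P'' = P" "rarr s' ''key'' = key" "rarr s' ''hw'' = hw"
        "rvar s' ''Gamma'' = rvar s ''Gamma''" "rvar s' ''a'' = rvar s ''a''"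
      using same_exceptD[OF same] by (simp_all add: writes_sweep_step P_def key_def hw_def)
    have kN: "k < N" using k(1) by (simp add: N_def)
    have v: "key (P k) * rvar s ''Gamma'' + rvar s ''a'' + ((\<Sum>b\<in>{k..<N}. hw (P b) * key (P b)) -
        (\<Sum>b\<in>{k..<N}. hw (P b)) * key (P k)) = F (key (P k))"
      using hinge_sum_at_knot[of P N key k hw, OF bij sorted kN] by (simp add: F_def)
    have suffix: "(\<Sum>b\<in>{Suc k..<N}. u b) = (\<Sum>b\<in>{k..<N}. u b) - u k" for u :: "nat \<Rightarrow> real"
      using kN by (simp add: sum.atLeast_Suc_lessThan)
    have "P k < N" using bij_betwE[OF bij] kN by auto
    then have "0 \<le> key (P k)" by (rule key)
    then show "wp sweep_step (\<lambda>t s''. t \<le> 100 \<and> ?I (Suc k) (s''\<lparr>nvar := (nvar s'')(''k'' := Suc k)\<rparr>)) s'"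
      using I unfolding sweep_step_def
      by (auto simp: eq k(2) v suffix less_Suc_eq cong: wp_cong intro: order_trans less_imp_le)
  qed (auto simp: writes_sweep_step)
  then show ?thesis
  proof (rule wp_mono, goal_cases)
    case (1 t s')
    then have I: "?I N s'" unfolding N_def by blast
    have "F (rvar s' ''pi'') \<le> F (key p)" if "p < N" for p
    proof -
      have "p \<in> P ` {..<N}" using bij that by (simp add: bij_betw_def)
      then obtain b where "b < N" "p = P b" by auto
      then have "rvar s' ''opt'' \<le> F (key p)" using I by blast
      then show ?thesis using I by metis
    qed
    then have "F (rvar s' ''pi'') \<le> F \<pi>" if "0 \<le> \<pi>" for \<pi>
      using hinge_sum_ge[of "{..<N}" key "rvar s ''Gamma''" \<pi> F "rvar s ''a''" hw "F (rvar s' ''pi'')"]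
        key Gamma that I by (simp add: F_def)
    with 1 I show ?case by (simp add: N_def)
  qed
qed

text \<open>Comparing \<open>pi\<close> with the threshold decides on which side of
  \<open>B j\<close> the level lies, so no level value is ever computed. At equality the part stays
  open.\<close>

definition select_step :: com where
  "select_step =
     Seq (NAssign ''j'' (NAdd (NVar ''k'') (NConst 1)))
       (Cond (BAnd (RLess (RArr ''nxt'' (NVar ''j'')) (RArr ''B'' (NVar ''j'')))
                   (BNot (RLess (RVar ''pi'') (RArr ''ps'' (NVar ''j'')))))
         Skip
         (NStore ''x'' (NArr ''A'' (NVar ''j'')) (NConst 1)))"

lemma wp_select:
  fixes s defines "J \<equiv> {j. rarr s ''nxt'' j < rarr s ''B'' j \<longrightarrow> rvar s ''pi'' < rarr s ''ps'' j}"
  assumes x: "narr s ''x'' = (\<lambda>_. 0)"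
  shows "wp (for_loop ''k'' ''m'' select_step) (\<lambda>t s'. t \<le> 6 + nvar s ''m'' * 108 \<and>
    (\<forall>i. narr s' ''x'' i = (if \<exists>j\<in>{1..nvar s ''m''} \<inter> J. i = narr s ''A'' j then 1 else 0)) \<and>
    same_except {''k'', ''j'', ''x''} s s') s"
proof -
  let ?I = "\<lambda>k s'. \<forall>i. narr s' ''x'' i = (if \<exists>j\<in>{1..k} \<inter> J. i = narr s ''A'' j then 1 else 0)"
  have "wp (for_loop ''k'' ''m'' select_step) (\<lambda>t s'. t \<le> 6 + nvar s ''m'' * (100 + 8) \<and>
    ?I (nvar s ''m'') s' \<and> same_except (insert ''k'' (writes select_step)) s s') s"
  proof (rule wp_for_loop[where I = ?I])
    fix k s' assume k: "k < nvar s ''m''" "nvar s' ''k'' = k"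
      and same: "same_except (insert ''k'' (writes select_step)) s s'" and I: "?I k s'"
    have eq: "narr s' ''A'' = narr s ''A''" "rarr s' ''nxt'' = rarr s ''nxt''" "rarr s' ''B'' = rarr s ''B''"
        "rarr s' ''ps'' = rarr s ''ps''" "rvar s' ''pi'' = rvar s ''pi''"
      using same_exceptD[OF same] by (simp_all add: select_step_def)
    have ex: "(\<exists>j\<in>{1..Suc k} \<inter> J. i = narr s ''A'' j) \<longleftrightarrow>
        Suc k \<in> J \<and> i = narr s ''A'' (Suc k) \<or> (\<exists>j\<in>{1..k} \<inter> J. i = narr s ''A'' j)" for i
      by (auto simp: atLeastAtMostSuc_conv)
    have J: "Suc k \<in> J \<longleftrightarrow> (rarr s ''nxt'' (Suc k) < rarr s ''B'' (Suc k) \<longrightarrow> rvar s ''pi'' < rarr s ''ps'' (Suc k))"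
      by (simp add: J_def)
    show "wp select_step (\<lambda>t s''. t \<le> 100 \<and> ?I (Suc k) (s''\<lparr>nvar := (nvar s'')(''k'' := Suc k)\<rparr>)) s'"
      unfolding ex using I by (auto simp: select_step_def eq k(2) J)
  qed (use x in \<open>auto simp: select_step_def\<close>)
  then show ?thesis by (rule wp_mono) (simp add: select_step_def insert_commute)
qed

section \<open>From the computed arrays to an optimal solution\<close>

context
  fixes I :: rep_input and P T :: "nat \<Rightarrow> nat" and c d C u V B nxt len slope sig g lev ps :: "nat \<Rightarrow> real" and A L :: "nat \<Rightarrow> nat"
  assumes valid: "valid_input I"
    and bij: "bij_betw P {..<num_items I} {1..num_items I}"
    and c: "\<And>p. p < num_items I \<Longrightarrow> c p = base_cost I (P p)"
    and d: "\<And>p. p < num_items I \<Longrightarrow> d p = deviation I (P p)"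
    and T: "\<And>p. p < num_items I \<Longrightarrow> T p = part_index I (P p)"
    and sorted: "\<And>p q. p \<le> q \<Longrightarrow> q < num_items I \<Longrightarrow> c p \<le> c q"
    and load: "\<And>i. i \<in> {1..num_items I} \<Longrightarrow> L i = part_index I i \<and> C i = first_cost I i \<and> u i = base_cost I i + deviation I i"
    and minima: "minima_inv L C u (num_items I) A B V"
    and intervals: "intervals_inv T c V {1..num_parts I} (num_items I) 0 nxt len"
    and thresholds: "thresholds_inv T d len nxt B (num_items I) slope sig g lev ps"
begin

lemma part_minima:
  assumes j: "j \<in> {1..num_parts I}"
  shows "A j \<in> part_items I j" "first_cost I (A j) = B j"
    "i \<in> part_items I j \<Longrightarrow> B j \<le> first_cost I i"
    "i \<in> part_items I j \<Longrightarrow> V j \<le> base_cost I i + deviation I i"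
    "\<exists>i\<in>part_items I j. V j = base_cost I i + deviation I i"
proof -
  have item: "i \<in> {1..num_items I}" "L i = j" "C i = first_cost I i" "u i = base_cost I i + deviation I i"
    if "i \<in> part_items I j" for i
  proof -
    show "i \<in> {1..num_items I}" using part_subset[OF valid j] that by blast
    from load[OF this] part_index_eq[OF valid j that]
    show "L i = j" "C i = first_cost I i" "u i = base_cost I i + deviation I i" by simp_all
  qed
  have member: "i \<in> part_items I j" if "i \<in> {1..num_items I}" "L i = j" for i
    using part_index_mem[OF valid that(1)] load[OF that(1)] that(2) by simp
  have M: "V j \<le> u i" "B j \<le> C i" "A j \<noteq> 0" if "i \<in> part_items I j" for i
    using minima item[OF that] unfolding minima_inv_def by blast+
  show "i \<in> part_items I j \<Longrightarrow> B j \<le> first_cost I i"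
    "i \<in> part_items I j \<Longrightarrow> V j \<le> base_cost I i + deviation I i" using M item by auto
  obtain i where "i \<in> part_items I j" using valid j unfolding valid_input_def by blast
  then have "A j \<noteq> 0" by (rule M)
  then have A: "A j \<in> {1..num_items I}" "L (A j) = j" "B j = C (A j)"
      "\<exists>i\<in>{1..num_items I}. L i = j \<and> V j = u i"
    using minima unfolding minima_inv_def by blast+
  show "A j \<in> part_items I j" using member A by blast
  then show "first_cost I (A j) = B j" using item A(3) by simp
  show "\<exists>i\<in>part_items I j. V j = base_cost I i + deviation I i"
    using A(4) member item by metis
qed

lemma sum_tail:
  "(\<Sum>q\<in>{k..<num_items I}. if T q = j then f q else 0) =
    (\<Sum>i\<in>{i. i < num_items I \<and> part_index I (P i) = j \<and> k \<le> i}. f i)" for f :: "nat \<Rightarrow> real"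
proof -
  have "(\<Sum>q\<in>{k..<num_items I}. if T q = j then f q else 0) = (\<Sum>q\<in>{q\<in>{k..<num_items I}. T q = j}. f q)"
    by (rule sum.inter_filter[symmetric]) simp
  also have "{q\<in>{k..<num_items I}. T q = j} = {i. i < num_items I \<and> part_index I (P i) = j \<and> k \<le> i}"
    using T by auto
  finally show ?thesis .
qed

lemma sum_head:
  assumes "k < num_items I"
  shows "part_sum T f j (Suc k) = (\<Sum>i\<in>{i. i < num_items I \<and> part_index I (P i) = j \<and> i \<le> k}. f i)"
proof -
  have "{q. q < Suc k \<and> T q = j} = {i. i < num_items I \<and> part_index I (P i) = j \<and> i \<le> k}"
    using T assms by auto
  then show ?thesis unfolding part_sum_eq by simp
qed

lemma slope_cum: "k < num_items I \<Longrightarrow> slope k = cum_slope T d k"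
  using thresholds unfolding thresholds_inv_def by blast

lemma is_sorted_instance: "sorted_instance I P V len slope"
proof
  fix k k' assume "k \<le> k'" "k' < num_items I"
  then show "base_cost I (P k) \<le> base_cost I (P k')" using sorted[of k k'] c by simp
next
  fix k j assume k: "k < num_items I" "part_index I (P k) = j"
  have "T k = j" "c k = base_cost I (P k)" using k T c by auto
  moreover have "(\<Sum>q\<in>{k..<num_items I}. if T q = T k then len q else 0) = V (T k) - min (c k) (V (T k))"
    using intervals k(1) unfolding intervals_inv_def by simp
  ultimately show "(\<Sum>i\<in>{i. i < num_items I \<and> part_index I (P i) = j \<and> k \<le> i}. len i) =
      V j - min (base_cost I (P k)) (V j)" by (simp add: sum_tail)
  show "slope k = (\<Sum>i\<in>{i. i < num_items I \<and> part_index I (P i) = j \<and> i \<le> k}. 1 / deviation I (P i))"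
    using slope_cum[OF k(1)] \<open>T k = j\<close> d unfolding cum_slope_def sum_head[OF k(1)] by simp
qed (use valid bij part_minima in auto)

interpretation sorted_instance I P V len slope
  by (rule is_sorted_instance)

text \<open>After the complete descending scan \<open>nxt\<close> has come down to the lowest left
  end, which is why the later loops read it as the starting level.\<close>

lemma low_eq:
  assumes j: "j \<in> {1..num_parts I}"
  shows "part_levels.low (positions j) (V j) len = nxt j"
proof -
  have "nxt j = V j - (\<Sum>q\<in>{0..<num_items I}. if T q = j then len q else 0)"
    using intervals j unfolding intervals_inv_def by blast
  then show ?thesis
    unfolding part_levels.low_def[OF levels[OF j]] sum_tail by (simp add: positions_def)
qed

lemma threshold:
  assumes j: "j \<in> {1..num_parts I}"
  shows "part_levels.is_threshold (positions j) (V j) len slope (B j) (ps j)"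
proof -
  have cross: "(part_levels.low (positions j) (V j) len + (\<Sum>i\<in>{i\<in>positions j. i \<le> k}. len i) - B j) /
      (\<Sum>i\<in>{i\<in>positions j. i \<le> k}. len i * slope i) = crossing T d len nxt B k" if k: "k \<in> positions j" for k
  proof -
    have k': "k < num_items I" "T k = j" using k T by (auto simp: positions_def)
    have set: "{i. i < num_items I \<and> part_index I (P i) = j \<and> i \<le> k} = {i\<in>positions j. i \<le> k}"
      by (auto simp: positions_def)
    have "(\<Sum>i\<in>{i\<in>positions j. i \<le> k}. len i * cum_slope T d i) = (\<Sum>i\<in>{i\<in>positions j. i \<le> k}. len i * slope i)"
      by (rule sum.cong) (auto simp: positions_def slope_cum)
    then show ?thesis unfolding crossing_def k'(2) sum_head[OF k'(1)] set low_eq[OF j] by simp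
  qed
  have "0 \<le> ps j" "ps j = 0 \<or> (\<exists>p<num_items I. T p = j \<and> ps j = crossing T d len nxt B p)"
    using thresholds unfolding thresholds_inv_def by blast+
  moreover have "crossing T d len nxt B k \<le> ps j" if "k \<in> positions j" for k
    using thresholds that T unfolding thresholds_inv_def positions_def by auto
  moreover have "p \<in> positions j" if "p < num_items I" "T p = j" for p
    using that T by (simp add: positions_def)
  ultimately show ?thesis
    unfolding part_levels.is_threshold_def[OF levels[OF j]] using cross by fastforce
qed

text \<open>Every position belongs to exactly one part, so the hinges of all parts regroup into one
  sum over positions, the form that the sweep evaluates.\<close>

lemma hinge_expansion:
  assumes "0 \<le> \<pi>"
  shows "(\<Sum>j=1..num_parts I. min (B j) (level j \<pi>)) = (\<Sum>j=1..num_parts I. min (B j) (nxt j)) +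
    (\<Sum>p<num_items I. (if nxt (T p) < B (T p) then len p * slope p else 0) *
      (max 0 (1 / slope p - \<pi>) - max 0 (min (1 / slope p) (ps (T p)) - \<pi>)))"
proof -
  let ?h = "\<lambda>p. (if nxt (T p) < B (T p) then len p * slope p else 0) *
      (max 0 (1 / slope p - \<pi>) - max 0 (min (1 / slope p) (ps (T p)) - \<pi>))"
  have "min (B j) (level j \<pi>) = min (B j) (nxt j) + (\<Sum>p\<in>positions j. ?h p)" if j: "j \<in> {1..num_parts I}" for j
  proof -
    have "(\<Sum>p\<in>positions j. (if nxt j < B j then len p * slope p else 0) *
      (max 0 (1 / slope p - \<pi>) - max 0 (min (1 / slope p) (ps j) - \<pi>))) = (\<Sum>p\<in>positions j. ?h p)"
      by (rule sum.cong) (auto simp: positions_def T)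
    then show ?thesis
      using part_levels.min_level_value[OF levels[OF j] threshold[OF j] assms]
      unfolding level_def low_eq[OF j] by simp
  qed
  then have "(\<Sum>j=1..num_parts I. min (B j) (level j \<pi>)) =
      (\<Sum>j=1..num_parts I. min (B j) (nxt j)) + (\<Sum>j=1..num_parts I. \<Sum>p\<in>positions j. ?h p)"
    by (simp add: sum.distrib)
  also have "(\<Sum>j=1..num_parts I. \<Sum>p\<in>positions j. ?h p) = (\<Sum>p\<in>(\<Union>j\<in>{1..num_parts I}. positions j). ?h p)"
    by (rule sum.UNION_disjoint[symmetric]) (auto simp: positions_def)
  also have "(\<Union>j\<in>{1..num_parts I}. positions j) = {..<num_items I}"
    using part_index_mem(1)[OF valid P_mem] by (auto simp: positions_def)
  finally show ?thesis .
qed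

lemma slope_nonneg: "p < num_items I \<Longrightarrow> 0 \<le> slope p"
  using part_levels.slope_nonneg[OF levels, of "part_index I (P p)" p] part_index_mem(1)[OF valid P_mem]
  by (simp add: positions_def)

lemma threshold_nonneg: "0 \<le> ps j"
  using thresholds unfolding thresholds_inv_def by blast

lemma solution_optimal:
  assumes F: "\<And>\<pi>. 0 \<le> \<pi> \<Longrightarrow> F \<pi> = \<pi> * budget I + (\<Sum>j=1..num_parts I. min (B j) (nxt j)) +
    (\<Sum>p<num_items I. (if nxt (T p) < B (T p) then len p * slope p else 0) *
      (max 0 (1 / slope p - \<pi>) - max 0 (min (1 / slope p) (ps (T p)) - \<pi>)))"
    and p: "0 \<le> p" "\<And>\<pi>. 0 \<le> \<pi> \<Longrightarrow> F p \<le> F \<pi>"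
  defines "J \<equiv> {1..num_parts I} \<inter> {j. nxt j < B j \<longrightarrow> p < ps j}"
  shows "choose_items I J A \<in> first_stage I" "robust_cost I (choose_items I J A) = optimal_value I"
    "optimal_value I = F p"
proof -
  \<comment> \<open>\<open>optimality\<close> asks for the formula at every multiplier, whereas the
    hinge form is established for nonnegative ones; there \<open>G\<close> agrees with
    \<open>F\<close>.\<close>
  define G where "G \<pi> = \<pi> * budget I + (\<Sum>j=1..num_parts I. min (B j) (level j \<pi>))" for \<pi>
  have FG: "F \<pi> = G \<pi>" if "0 \<le> \<pi>" for \<pi>
    using F[OF that] hinge_expansion[OF that] by (simp add: G_def)
  have buy: "B j \<le> level j p" if "j \<in> J" for j
  proof -
    have j: "j \<in> {1..num_parts I}" using that by (simp add: J_def)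
    interpret pl: part_levels "positions j" "\<lambda>k. base_cost I (P k)" "\<lambda>k. deviation I (P k)" "V j" len slope
      by (rule levels[OF j])
    show ?thesis
    proof (cases "nxt j < B j")
      case True
      then have "p < ps j" using that by (simp add: J_def)
      then show ?thesis using pl.level_value_ge_threshold[OF threshold[OF j] p(1)] p(1) by (simp add: level_def)
    next
      case False
      then show ?thesis using pl.low_le_level_value[of p] low_eq[OF j] by (simp add: level_def)
    qed
  qed
  have wait: "level j p \<le> B j" if "j \<in> {1..num_parts I} - J" for j
  proof -
    have j: "j \<in> {1..num_parts I}" "nxt j \<le> B j" "ps j \<le> p" using that by (auto simp: J_def)
    then show ?thesis
      using part_levels.level_value_le_threshold[OF levels[OF j(1)] threshold[OF j(1)]] low_eq[OF j(1)]
      by (simp add: level_def)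
  qed
  have JP: "J \<subseteq> {1..num_parts I}" by (auto simp: J_def)
  have minG: "G p \<le> G \<pi>" if "0 \<le> \<pi>" for \<pi> using p(2)[OF that] FG[OF that] FG[OF p(1)] by simp
  note opt = optimality[where F = G and A = A and B = B and J = J, OF _ part_minima(3) G_def p(1) minG JP buy wait]
  show "choose_items I J A \<in> first_stage I" "robust_cost I (choose_items I J A) = optimal_value I"
    by (rule opt; simp add: part_minima)+
  have "optimal_value I = G p" by (rule opt; simp add: part_minima)
  then show "optimal_value I = F p" using FG[OF p(1)] by simp
qed

end


section \<open>The whole program and its running time\<close>

definition algorithm :: com where
  "algorithm =
     Seq (for_loop ''k'' ''n'' minima_step)
     (Seq (NAssign ''N'' (NVar ''n''))
     (Seq merge_sort
     (Seq (for_loop ''k'' ''m'' start_levels_step)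
     (Seq (for_loop ''k'' ''n'' intervals_step)
     (Seq (for_loop ''k'' ''n'' thresholds_step)
     (Seq (for_loop ''k'' ''n'' hinges_step)
     (Seq (for_loop ''k'' ''m'' constant_step)
     (Seq (NAssign ''N'' (NAdd (NVar ''n'') (NVar ''n'')))
     (Seq (for_loop ''k'' ''N'' totals_step)
     (Seq merge_sort
     (Seq (RAssign ''opt'' (RAdd (RVar ''a'') (RVar ''S'')))
     (Seq (for_loop ''k'' ''N'' sweep_step)
          (for_loop ''k'' ''m'' select_step)))))))))))))"

text \<open>The scans, the single assignments and the fixed costs of the sorts add up to at most
  1188 * n + 84. The two logarithmic terms are the sorts of the \<open>n\<close> items and of the
  \<open>2 * n\<close> knots.\<close>

definition running_time :: "nat \<Rightarrow> nat" where
  "running_time n = 200 + 1200 * n + log2_ceil n * (90 * n + 40) + log2_ceil (2 * n) * (180 * n + 40)"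

lemma real_log2_ceil_le:
  assumes "0 < N"
  shows "real (log2_ceil N) \<le> log 2 (real N) + 1"
proof (cases "log2_ceil N")
  case 0
  then show ?thesis using assms by (simp add: zero_le_log_cancel_iff add_nonneg_nonneg)
next
  case (Suc r)
  have "\<not> N \<le> 2 ^ r" using not_less_Least[of r "\<lambda>r. N \<le> 2 ^ r"] Suc unfolding log2_ceil_def by simp
  then have "real (2 ^ r) \<le> real N" by simp
  then have "real r \<le> log 2 (real N)" using assms by (simp add: le_log_iff powr_realpow)
  with Suc show ?thesis by simp
qed

lemma running_time_bigo: "(\<lambda>n. real (running_time n)) \<in> O(\<lambda>n. real n * ln (real n))"
proof -
  let ?g = "\<lambda>n::nat. 200 + 1200 * real n + (log 2 (real n) + 1) * (90 * real n + 40) +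
      (log 2 (2 * real n) + 1) * (180 * real n + 40)"
  have bound: "real (running_time n) \<le> ?g n" if "0 < n" for n
  proof -
    have "real (log2_ceil n) * (90 * real n + 40) \<le> (log 2 (real n) + 1) * (90 * real n + 40)"
      "real (log2_ceil (2 * n)) * (180 * real n + 40) \<le> (log 2 (2 * real n) + 1) * (180 * real n + 40)"
      using real_log2_ceil_le[of n] real_log2_ceil_le[of "2 * n"] that by (auto intro!: mult_right_mono)
    then show ?thesis
      by (simp only: running_time_def of_nat_add of_nat_mult of_nat_numeral)
  qed
  have "eventually (\<lambda>n. norm (real (running_time n)) \<le> 1 * norm (?g n)) at_top"
  proof (rule eventually_mono[OF eventually_gt_at_top[of 0]])
    fix n :: nat assume "0 < n"
    from order_trans[OF bound[OF this] abs_ge_self]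
    show "norm (real (running_time n)) \<le> 1 * norm (?g n)" by (simp only: real_norm_def mult_1 abs_of_nat)
  qed
  then have "(\<lambda>n. real (running_time n)) \<in> O(?g)" by (rule bigoI)
  also have "?g \<in> O(\<lambda>n. real n * ln (real n))" by real_asymp
  finally show ?thesis .
qed


lemma sum_lessThan_add:
  fixes f :: "nat \<Rightarrow> 'a::comm_monoid_add"
  shows "(\<Sum>p<n + m. f p) = (\<Sum>p<n. f p) + (\<Sum>p<m. f (n + p))"
  by (induction m) (auto simp: add.assoc)

lemma algorithm_correct:
  assumes valid: "valid_input I"
  shows "\<exists>t s. exec algorithm (input_state I) t s \<and> t \<le> running_time (num_items I) \<and> correct_output I s"
proof -
  let ?n = "num_items I" and ?m = "num_parts I"
  let ?part = "load ?n (part_index I)" and ?base = "load ?n (base_cost I)" and ?dev = "load ?n (deviation I)"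
  define s0 where "s0 = input_state I"
  \<comment> \<open>The accumulators are never cleared by the program: it relies on the input state
    being zero there. The later lists \<open>f2\<close> to \<open>f13\<close> carry these zeros
    along until each cell is used.\<close>
  have f0: "nvar s0 ''n'' = ?n" "nvar s0 ''m'' = ?m" "narr s0 ''T'' = ?part" "rarr s0 ''c'' = ?base"
      "rarr s0 ''d'' = ?dev" "rarr s0 ''C'' = load ?n (first_cost I)" "rvar s0 ''Gamma'' = budget I"
      "narr s0 ''A'' = (\<lambda>_. 0)" "narr s0 ''x'' = (\<lambda>_. 0)" "rarr s0 ''sig'' = (\<lambda>_. 0)" "rarr s0 ''g'' = (\<lambda>_. 0)"
      "rarr s0 ''lev'' = (\<lambda>_. 0)" "rarr s0 ''ps'' = (\<lambda>_. 0)" "rvar s0 ''a'' = 0" "rvar s0 ''W'' = 0"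
      "rvar s0 ''S'' = 0" "rvar s0 ''pi'' = 0"
    by (simp_all add: s0_def input_state_def)

  obtain t1 s1 where e1: "exec (for_loop ''k'' ''n'' minima_step) s0 t1 s1" "t1 \<le> 6 + ?n * 108"
    and minima: "minima_inv ?part (load ?n (first_cost I)) (\<lambda>i. ?base i + ?dev i) ?n
      (narr s1 ''A'') (rarr s1 ''B'') (rarr s1 ''V'')"
    and P1: "\<forall>a<?n. narr s1 ''P'' a = Suc a \<and> rarr s1 ''key'' (Suc a) = ?base (Suc a)"
    and same1: "same_except (insert ''k'' (writes minima_step)) s0 s1"
    using wp_minima[OF f0(8), unfolded f0] unfolding wp_def by blast
  define s2 where "s2 = s1\<lparr>nvar := (nvar s1)(''N'' := ?n)\<rparr>"
  define A B V where "A = narr s1 ''A''" and "B = rarr s1 ''B''" and "V = rarr s1 ''V''"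
  have "nvar s1 ''n'' = ?n" using same_exceptD[OF same1] f0 by (simp add: writes_minima_step)
  then have e2: "exec (NAssign ''N'' (NVar ''n'')) s1 2 s2"
    using exec_NAssign[of "''N''" "NVar ''n''" s1] by (simp add: s2_def numeral_2_eq_2)
  have f2: "nvar s2 ''N'' = ?n" "nvar s2 ''n'' = ?n" "nvar s2 ''m'' = ?m" "narr s2 ''T'' = ?part" "rarr s2 ''c'' = ?base"
      "rarr s2 ''d'' = ?dev" "rvar s2 ''Gamma'' = budget I"
      "narr s2 ''A'' = A" "narr s2 ''x'' = (\<lambda>_. 0)" "rarr s2 ''sig'' = (\<lambda>_. 0)" "rarr s2 ''g'' = (\<lambda>_. 0)"
      "rarr s2 ''lev'' = (\<lambda>_. 0)" "rarr s2 ''ps'' = (\<lambda>_. 0)" "rvar s2 ''a'' = 0" "rvar s2 ''W'' = 0"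
      "rvar s2 ''S'' = 0" "rvar s2 ''pi'' = 0" "rarr s2 ''B'' = B" "rarr s2 ''V'' = V"
      "narr s2 ''P'' = narr s1 ''P''" "rarr s2 ''key'' = rarr s1 ''key''"
    using same_exceptD[OF same1] f0 by (simp_all add: s2_def writes_minima_step A_def B_def V_def)

  obtain t3 s3 where e3: "exec merge_sort s2 t3 s3" "t3 \<le> 10 + log2_ceil ?n * (90 * ?n + 40)"
    and P3: "mset (map (narr s3 ''P'') [0..<?n]) = mset (map (narr s1 ''P'') [0..<?n])"
    and sorted3: "\<forall>a b. a \<le> b \<and> b < ?n \<longrightarrow> rarr s1 ''key'' (narr s3 ''P'' a) \<le> rarr s1 ''key'' (narr s3 ''P'' b)"
    and same3: "same_except (writes merge_sort) s2 s3"
    using wp_merge_sort[of s2, unfolded f2] unfolding wp_def by blast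
  define P where "P = narr s3 ''P''"
  have f3: "nvar s3 ''n'' = ?n" "nvar s3 ''m'' = ?m" "narr s3 ''T'' = ?part" "rarr s3 ''c'' = ?base"
      "rarr s3 ''d'' = ?dev" "rvar s3 ''Gamma'' = budget I"
      "narr s3 ''A'' = A" "narr s3 ''x'' = (\<lambda>_. 0)" "rarr s3 ''sig'' = (\<lambda>_. 0)" "rarr s3 ''g'' = (\<lambda>_. 0)"
      "rarr s3 ''lev'' = (\<lambda>_. 0)" "rarr s3 ''ps'' = (\<lambda>_. 0)" "rvar s3 ''a'' = 0" "rvar s3 ''W'' = 0"
      "rvar s3 ''S'' = 0" "rvar s3 ''pi'' = 0" "rarr s3 ''B'' = B" "rarr s3 ''V'' = V" "narr s3 ''P'' = P"
    using same_exceptD[OF same3] f2 by (simp_all add: writes_merge_sort P_def)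
  have image: "narr s1 ''P'' ` {..<?n} = {1..?n}"
  proof -
    have "narr s1 ''P'' ` {..<?n} = Suc ` {..<?n}" using P1 by (intro image_cong) auto
    then show ?thesis by (simp add: image_Suc_lessThan)
  qed
  have "inj_on (narr s1 ''P'') {..<?n}" using P1 by (auto intro: inj_onI)
  then have bij: "bij_betw P {..<?n} {1..?n}"
    using bij_betw_if_mset_map_eq[OF P3] image by (simp add: P_def)
  have P_mem: "P p \<in> {1..?n}" if "p < ?n" for p using bij_betwE[OF bij] that by auto
  have key: "rarr s1 ''key'' i = base_cost I i" if "i \<in> {1..?n}" for i
    using P1[rule_format, of "i - 1"] that by (auto simp: load_def)

  obtain t4 s4 where e4: "exec (for_loop ''k'' ''m'' start_levels_step) s3 t4 s4" "t4 \<le> 6 + ?m * 108"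
    and start: "\<forall>j\<in>{1..?m}. rarr s4 ''nxt'' j = V j" and same4: "same_except {''k'', ''nxt''} s3 s4"
    using wp_start_levels[of s3, unfolded f3] unfolding wp_def by blast
  have f4: "nvar s4 ''n'' = ?n" "nvar s4 ''m'' = ?m" "narr s4 ''T'' = ?part" "rarr s4 ''c'' = ?base"
      "rarr s4 ''d'' = ?dev" "rvar s4 ''Gamma'' = budget I"
      "narr s4 ''A'' = A" "narr s4 ''x'' = (\<lambda>_. 0)" "rarr s4 ''sig'' = (\<lambda>_. 0)" "rarr s4 ''g'' = (\<lambda>_. 0)"
      "rarr s4 ''lev'' = (\<lambda>_. 0)" "rarr s4 ''ps'' = (\<lambda>_. 0)" "rvar s4 ''a'' = 0" "rvar s4 ''W'' = 0"
      "rvar s4 ''S'' = 0" "rvar s4 ''pi'' = 0" "rarr s4 ''B'' = B" "rarr s4 ''V'' = V" "narr s4 ''P'' = P"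
    using same_exceptD[OF same4] f3 by simp_all

  define T c d where "T = (\<lambda>p. ?part (P p))" and "c = (\<lambda>p. ?base (P p))" and "d = (\<lambda>p. ?dev (P p))"
  have Tcd: "T p = part_index I (P p)" "c p = base_cost I (P p)" "d p = deviation I (P p)" if "p < ?n" for p
    using P_mem[OF that] by (simp_all add: T_def c_def d_def load_def)
  have T_mem: "T p \<in> {1..?m}" if "p < ?n" for p
    using part_index_mem(1)[OF valid P_mem[OF that]] Tcd(1)[OF that] by simp
  have sorted: "c p \<le> c q" if "p \<le> q" "q < ?n" for p q
    using sorted3 that key[OF P_mem] Tcd(2) by (simp add: P_def)

  obtain t5 s5 where e5: "exec (for_loop ''k'' ''n'' intervals_step) s4 t5 s5" "t5 \<le> 6 + ?n * 108"
    and intervals: "intervals_inv T c V {1..?m} ?n 0 (rarr s5 ''nxt'') (rarr s5 ''len'')"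
    and same5: "same_except (insert ''k'' (writes intervals_step)) s4 s5"
  proof -
    have "wp (for_loop ''k'' ''n'' intervals_step) (\<lambda>t s'. t \<le> 6 + ?n * 108 \<and>
      intervals_inv T c V {1..?m} ?n 0 (rarr s' ''nxt'') (rarr s' ''len'') \<and>
      same_except (insert ''k'' (writes intervals_step)) s4 s') s4"
      using wp_intervals[of s4 "{1..?m}", unfolded f4, folded T_def c_def] T_mem start by (simp add: T_def c_def)
    then show thesis using that unfolding wp_def by blast
  qed
  define nxt len where "nxt = rarr s5 ''nxt''" and "len = rarr s5 ''len''"
  have f5: "nvar s5 ''n'' = ?n" "nvar s5 ''m'' = ?m" "narr s5 ''T'' = ?part"
      "rarr s5 ''d'' = ?dev" "rvar s5 ''Gamma'' = budget I"
      "narr s5 ''A'' = A" "narr s5 ''x'' = (\<lambda>_. 0)" "rarr s5 ''sig'' = (\<lambda>_. 0)" "rarr s5 ''g'' = (\<lambda>_. 0)"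
      "rarr s5 ''lev'' = (\<lambda>_. 0)" "rarr s5 ''ps'' = (\<lambda>_. 0)" "rvar s5 ''a'' = 0" "rvar s5 ''W'' = 0"
      "rvar s5 ''S'' = 0" "rvar s5 ''pi'' = 0" "rarr s5 ''B'' = B" "narr s5 ''P'' = P"
      "rarr s5 ''nxt'' = nxt" "rarr s5 ''len'' = len"
    using same_exceptD[OF same5] f4 by (simp_all add: writes_intervals_step nxt_def len_def)

  obtain t6 s6 where e6: "exec (for_loop ''k'' ''n'' thresholds_step) s5 t6 s6" "t6 \<le> 6 + ?n * 108"
    and thresholds: "thresholds_inv T d len nxt B ?n (rarr s6 ''slope'') (rarr s6 ''sig'') (rarr s6 ''g'')
      (rarr s6 ''lev'') (rarr s6 ''ps'')"
    and same6: "same_except (insert ''k'' (writes thresholds_step)) s5 s6"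
    using wp_thresholds[OF f5(8-11), unfolded f5, folded T_def d_def] unfolding wp_def by blast
  define slope ps where "slope = rarr s6 ''slope''" and "ps = rarr s6 ''ps''"
  have f6: "nvar s6 ''n'' = ?n" "nvar s6 ''m'' = ?m" "narr s6 ''T'' = ?part" "rvar s6 ''Gamma'' = budget I"
      "narr s6 ''A'' = A" "narr s6 ''x'' = (\<lambda>_. 0)" "rvar s6 ''a'' = 0" "rvar s6 ''W'' = 0"
      "rvar s6 ''S'' = 0" "rvar s6 ''pi'' = 0" "rarr s6 ''B'' = B" "narr s6 ''P'' = P"
      "rarr s6 ''nxt'' = nxt" "rarr s6 ''len'' = len" "rarr s6 ''slope'' = slope" "rarr s6 ''ps'' = ps"
    using same_exceptD[OF same6] f5 by (simp_all add: writes_thresholds_step slope_def ps_def)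

  obtain t7 s7 where e7: "exec (for_loop ''k'' ''n'' hinges_step) s6 t7 s7" "t7 \<le> 6 + ?n * 108"
    and hinges: "\<forall>p<?n. rarr s7 ''key'' p = 1 / slope p \<and>
       rarr s7 ''key'' (?n + p) = min (1 / slope p) (ps (T p)) \<and>
       rarr s7 ''hw'' p = (if nxt (T p) < B (T p) then len p * slope p else 0) \<and>
       rarr s7 ''hw'' (?n + p) = - rarr s7 ''hw'' p"
    and same7: "same_except (insert ''k'' (writes hinges_step)) s6 s7"
    using wp_hinges[of s6, unfolded f6] unfolding T_def wp_def by blast
  define kn hw where "kn = rarr s7 ''key''" and "hw = rarr s7 ''hw''"
  have f7: "nvar s7 ''n'' = ?n" "nvar s7 ''m'' = ?m" "rvar s7 ''Gamma'' = budget I"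
      "narr s7 ''A'' = A" "narr s7 ''x'' = (\<lambda>_. 0)" "rvar s7 ''a'' = 0" "rvar s7 ''W'' = 0"
      "rvar s7 ''S'' = 0" "rvar s7 ''pi'' = 0" "rarr s7 ''B'' = B"
      "rarr s7 ''nxt'' = nxt" "rarr s7 ''ps'' = ps" "rarr s7 ''key'' = kn" "rarr s7 ''hw'' = hw"
    using same_exceptD[OF same7] f6 by (simp_all add: writes_hinges_step kn_def hw_def)

  obtain t8 s8 where e8: "exec (for_loop ''k'' ''m'' constant_step) s7 t8 s8" "t8 \<le> 6 + ?m * 108"
    and const: "rvar s8 ''a'' = (\<Sum>j=1..?m. min (B j) (nxt j))" and same8: "same_except {''k'', ''j'', ''a''} s7 s8"
    using wp_constant[OF f7(6), unfolded f7] unfolding wp_def by blast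
  define s9 where "s9 = s8\<lparr>nvar := (nvar s8)(''N'' := ?n + ?n)\<rparr>"
  have "nvar s8 ''n'' = ?n" using same_exceptD[OF same8] f7 by simp
  then have e9: "exec (NAssign ''N'' (NAdd (NVar ''n'') (NVar ''n''))) s8 4 s9"
    using exec_NAssign[of "''N''" "NAdd (NVar ''n'') (NVar ''n'')" s8] by (simp add: s9_def eval_nat_numeral)
  define a where "a = (\<Sum>j=1..?m. min (B j) (nxt j))"
  have f9: "nvar s9 ''N'' = ?n + ?n" "nvar s9 ''m'' = ?m" "rvar s9 ''Gamma'' = budget I"
      "narr s9 ''A'' = A" "narr s9 ''x'' = (\<lambda>_. 0)" "rvar s9 ''a'' = a" "rvar s9 ''W'' = 0"
      "rvar s9 ''S'' = 0" "rvar s9 ''pi'' = 0" "rarr s9 ''B'' = B"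
      "rarr s9 ''nxt'' = nxt" "rarr s9 ''ps'' = ps" "rarr s9 ''key'' = kn" "rarr s9 ''hw'' = hw"
    using same_exceptD[OF same8] f7 const by (simp_all add: s9_def a_def)

  obtain t10 s10 where e10: "exec (for_loop ''k'' ''N'' totals_step) s9 t10 s10" "t10 \<le> 6 + (?n + ?n) * 108"
    and P10: "\<forall>p<?n + ?n. narr s10 ''P'' p = p" and W: "rvar s10 ''W'' = (\<Sum>p<?n + ?n. hw p)"
    and S: "rvar s10 ''S'' = (\<Sum>p<?n + ?n. hw p * kn p)" and same10: "same_except {''k'', ''P'', ''W'', ''S''} s9 s10"
    using wp_totals[OF f9(7,8), unfolded f9] unfolding wp_def by blast
  have f10: "nvar s10 ''N'' = ?n + ?n" "nvar s10 ''m'' = ?m" "rvar s10 ''Gamma'' = budget I"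
      "narr s10 ''A'' = A" "narr s10 ''x'' = (\<lambda>_. 0)" "rvar s10 ''a'' = a"
      "rvar s10 ''pi'' = 0" "rarr s10 ''B'' = B"
      "rarr s10 ''nxt'' = nxt" "rarr s10 ''ps'' = ps" "rarr s10 ''key'' = kn" "rarr s10 ''hw'' = hw"
    using same_exceptD[OF same10] f9 by simp_all

  \<comment> \<open>The same sort now orders the knots, since \<open>key\<close> and
    \<open>P\<close> have been overwritten after the first sort.\<close>
  obtain t11 s11 where e11: "exec merge_sort s10 t11 s11" "t11 \<le> 10 + log2_ceil (?n + ?n) * (90 * (?n + ?n) + 40)"
    and P11: "mset (map (narr s11 ''P'') [0..<?n + ?n]) = mset (map (narr s10 ''P'') [0..<?n + ?n])"
    and sorted11: "\<forall>a b. a \<le> b \<and> b < ?n + ?n \<longrightarrow> kn (narr s11 ''P'' a) \<le> kn (narr s11 ''P'' b)"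
    and same11: "same_except (writes merge_sort) s10 s11"
    using wp_merge_sort[of s10, unfolded f10] unfolding wp_def by blast
  define s12 where "s12 = s11\<lparr>rvar := (rvar s11)(''opt'' := rvar s11 ''a'' + rvar s11 ''S'')\<rparr>"
  have e12: "exec (RAssign ''opt'' (RAdd (RVar ''a'') (RVar ''S''))) s11 4 s12"
    using exec_RAssign[of "''opt''" "RAdd (RVar ''a'') (RVar ''S'')" s11] by (simp add: s12_def eval_nat_numeral)
  have f12: "nvar s12 ''N'' = ?n + ?n" "nvar s12 ''m'' = ?m" "rvar s12 ''Gamma'' = budget I"
      "narr s12 ''A'' = A" "narr s12 ''x'' = (\<lambda>_. 0)" "rvar s12 ''a'' = a"
      "rvar s12 ''pi'' = 0" "rarr s12 ''B'' = B" "rarr s12 ''nxt'' = nxt" "rarr s12 ''ps'' = ps"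
      "rarr s12 ''key'' = kn" "rarr s12 ''hw'' = hw" "rvar s12 ''opt'' = rvar s12 ''a'' + rvar s12 ''S''"
      "rvar s12 ''W'' = (\<Sum>p<?n + ?n. hw p)" "rvar s12 ''S'' = (\<Sum>p<?n + ?n. hw p * kn p)"
      "narr s12 ''P'' = narr s11 ''P''"
    using same_exceptD[OF same11] f10 W S by (simp_all add: s12_def writes_merge_sort)
  have "narr s10 ''P'' ` {..<?n + ?n} = {..<?n + ?n}" "inj_on (narr s10 ''P'') {..<?n + ?n}"
    using P10 by (auto simp: image_iff intro: inj_onI)
  then have bij12: "bij_betw (narr s12 ''P'') {..<?n + ?n} {..<?n + ?n}"
    using bij_betw_if_mset_map_eq[OF P11] f12(16) by simp

  \<comment> \<open>The assumptions of the context above, in their order, so that its exported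
    lemmas apply directly.\<close>
  have glue: "valid_input I" "bij_betw P {..<?n} {1..?n}" "\<And>p. p < ?n \<Longrightarrow> c p = base_cost I (P p)"
      "\<And>p. p < ?n \<Longrightarrow> d p = deviation I (P p)" "\<And>p. p < ?n \<Longrightarrow> T p = part_index I (P p)"
      "\<And>p q. p \<le> q \<Longrightarrow> q < ?n \<Longrightarrow> c p \<le> c q"
      "\<And>i. i \<in> {1..?n} \<Longrightarrow> ?part i = part_index I i \<and> load ?n (first_cost I) i = first_cost I i \<and>
         ?base i + ?dev i = base_cost I i + deviation I i"
      "minima_inv ?part (load ?n (first_cost I)) (\<lambda>i. ?base i + ?dev i) ?n A B V"
      "intervals_inv T c V {1..?m} ?n 0 nxt len"
      "thresholds_inv T d len nxt B ?n slope (rarr s6 ''sig'') (rarr s6 ''g'') (rarr s6 ''lev'') ps"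
    using valid bij Tcd sorted minima intervals thresholds
    by (auto simp: load_def A_def B_def V_def nxt_def len_def slope_def ps_def)
  have nonneg: "0 \<le> slope p" "0 \<le> ps j" if "p < ?n" for p j
    using slope_nonneg[OF glue that] threshold_nonneg[OF glue] by blast+
  have kn_nonneg: "0 \<le> kn p" if "p < ?n + ?n" for p
  proof (cases "p < ?n")
    case True
    then show ?thesis using hinges nonneg(1)[OF True] by (simp add: kn_def)
  next
    case False
    then have "p - ?n < ?n" "p = ?n + (p - ?n)" using that by auto
    then have "kn p = min (1 / slope (p - ?n)) (ps (T (p - ?n)))" using hinges unfolding kn_def by metis
    then show ?thesis using nonneg[OF \<open>p - ?n < ?n\<close>] by simp
  qed
  define F where "F \<pi> = \<pi> * budget I + a + (\<Sum>p<?n + ?n. hw p * max 0 (kn p - \<pi>))" for \<pi>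
  obtain t13 s13 where e13: "exec (for_loop ''k'' ''N'' sweep_step) s12 t13 s13" "t13 \<le> 6 + (?n + ?n) * 108"
    and opt: "rvar s13 ''opt'' = F (rvar s13 ''pi'')" "0 \<le> rvar s13 ''pi''"
      "\<forall>\<pi>\<ge>0. F (rvar s13 ''pi'') \<le> F \<pi>"
    and same13: "same_except (insert ''k'' (writes sweep_step)) s12 s13"
  proof -
    have "wp (for_loop ''k'' ''N'' sweep_step) (\<lambda>t s'. t \<le> 6 + (?n + ?n) * 108 \<and>
      rvar s' ''opt'' = F (rvar s' ''pi'') \<and> 0 \<le> rvar s' ''pi'' \<and> (\<forall>\<pi>\<ge>0. F (rvar s' ''pi'') \<le> F \<pi>) \<and>
      same_except (insert ''k'' (writes sweep_step)) s12 s') s12"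
      unfolding F_def
      by (rule wp_sweep[of s12, unfolded f12(1,3,6,11,12)])
         (use bij12 sorted11 kn_nonneg valid f12 in \<open>auto simp: valid_input_def\<close>)
    then show thesis using that unfolding wp_def by blast
  qed
  define p where "p = rvar s13 ''pi''"
  have f13: "nvar s13 ''m'' = ?m" "narr s13 ''A'' = A" "narr s13 ''x'' = (\<lambda>_. 0)" "rvar s13 ''pi'' = p"
      "rarr s13 ''B'' = B" "rarr s13 ''nxt'' = nxt" "rarr s13 ''ps'' = ps"
    using same_exceptD[OF same13] f12 by (simp_all add: writes_sweep_step p_def)
  obtain t14 s14 where e14: "exec (for_loop ''k'' ''m'' select_step) s13 t14 s14" "t14 \<le> 6 + ?m * 108"
    and x: "\<forall>i. narr s14 ''x'' i =
      (if \<exists>j\<in>{1..?m} \<inter> {j. nxt j < B j \<longrightarrow> p < ps j}. i = A j then 1 else 0)"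
    and same14: "same_except {''k'', ''j'', ''x''} s13 s14"
    using wp_select[OF f13(3), unfolded f13] unfolding wp_def by blast

  have F: "F \<pi> = \<pi> * budget I + (\<Sum>j=1..?m. min (B j) (nxt j)) +
      (\<Sum>p<?n. (if nxt (T p) < B (T p) then len p * slope p else 0) *
        (max 0 (1 / slope p - \<pi>) - max 0 (min (1 / slope p) (ps (T p)) - \<pi>)))" for \<pi>
  proof -
    \<comment> \<open>Entries \<open>p\<close> and \<open>?n + p\<close> carry opposite weights and
      recombine into the difference of hinges for position \<open>p\<close>.\<close>
    have "(\<Sum>p<?n + ?n. hw p * max 0 (kn p - \<pi>)) =
        (\<Sum>p<?n. hw p * max 0 (kn p - \<pi>) + hw (?n + p) * max 0 (kn (?n + p) - \<pi>))"
      by (simp add: sum_lessThan_add sum.distrib)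
    also have "\<dots> = (\<Sum>p<?n. (if nxt (T p) < B (T p) then len p * slope p else 0) *
        (max 0 (1 / slope p - \<pi>) - max 0 (min (1 / slope p) (ps (T p)) - \<pi>)))"
      using hinges by (intro sum.cong) (auto simp: kn_def hw_def right_diff_distrib)
    finally show ?thesis by (simp add: F_def a_def)
  qed
  let ?J = "{1..?m} \<inter> {j. nxt j < B j \<longrightarrow> p < ps j}"
  have p: "0 \<le> p" "\<And>\<pi>. 0 \<le> \<pi> \<Longrightarrow> F p \<le> F \<pi>" using opt by (simp_all add: p_def)
  have "output_solution I s14 = choose_items I ?J A"
    unfolding output_solution_def choose_items_def by (rule restrict_ext) (rule x[rule_format])
  moreover have "rvar s14 ''opt'' = F p" using same_exceptD[OF same14] opt(1) by (simp add: p_def)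
  moreover note solution_optimal[OF glue F p]
  ultimately have correct: "correct_output I s14"
    unfolding correct_output_def by (simp only: simp_thms)
  have run: "exec algorithm s0 (t1 + (2 + (t3 + (t4 + (t5 + (t6 + (t7 + (t8 + (4 + (t10 + (t11 + (4 + (t13 + t14))))))))))))) s14"
    unfolding algorithm_def
    by (intro exec_Seq[OF e1(1)] exec_Seq[OF e2] exec_Seq[OF e3(1)] exec_Seq[OF e4(1)] exec_Seq[OF e5(1)]
        exec_Seq[OF e6(1)] exec_Seq[OF e7(1)] exec_Seq[OF e8(1)] exec_Seq[OF e9] exec_Seq[OF e10(1)]
        exec_Seq[OF e11(1)] exec_Seq[OF e12] exec_Seq[OF e13(1)] e14(1))
  define X Y where "X = log2_ceil ?n * (90 * ?n + 40)" and "Y = log2_ceil (2 * ?n) * (180 * ?n + 40)"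
  have "t11 \<le> 10 + Y" using e11(2) by (simp add: Y_def mult_2[symmetric])
  moreover have "t3 \<le> 10 + X" using e3(2) by (simp add: X_def)
  moreover have "running_time ?n = 200 + 1200 * ?n + X + Y" by (simp add: running_time_def X_def Y_def)
  moreover have "t1 + t5 + t6 + t7 \<le> 24 + 432 * ?n" "t10 + t13 \<le> 12 + 432 * ?n"
    using e1(2) e5(2) e6(2) e7(2) e10(2) e13(2) by simp_all
  moreover have "t4 + t8 + t14 \<le> 18 + 324 * ?n"
    using e4(2) e8(2) e14(2) num_parts_le[OF valid] by simp
  ultimately have "t1 + (2 + (t3 + (t4 + (t5 + (t6 + (t7 + (t8 + (4 + (t10 + (t11 + (4 + (t13 + t14)))))))))))) \<le> running_time ?n"
    by simp
  with run correct show ?thesis unfolding s0_def by (intro exI conjI)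
qed

theorem theorem5:
  shows "\<exists>P \<tau>. solves_in_time P \<tau> \<and> (\<lambda>n. real (\<tau> n)) \<in> O(\<lambda>n. real n * ln (real n))"
proof (intro exI conjI)
  show "solves_in_time algorithm running_time" using algorithm_correct by (simp add: solves_in_time_def)
qed (rule running_time_bigo)

end
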